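(* Let $X$ be a Riemann surface, $\mathcal{V}$ a projectively flat holomorphic vector bundle of rank $n$ over $X$, and $A$ a generic meromorphic section of $\mathcal{V}$. Let $\mathcal{U}=\{U_i\}$ be a cover of $X$ trivializing $\mathcal{V}$ in a projectively flat way and such that $w(A)$ has no zeros or poles on $U_i\cap U_j$ ($i\neq j$). Put $A_i=A|_{U_i}$ and $$\Phi^A_{ij}:U_i\cap U_j\to GL_n(\mathbb{C}),\qquad \Phi^A_{ij}=W(A_j)^{-1}W(A_i).$$ Then $\{\Phi^A_{ij}\}$ satisfies the cocycle condition, hence defines a holomorphic vector bundle $W_A(\mathcal{V})$ of rank $n$ on $X$, and the determinant line bundle of $W_A(\mathcal{V})$ is the Wronskian line bundle $w(\mathcal{V})$. The bundle $W_A(\mathcal{V})$ is independent of the chosen cover, though it may depend on the choice of the section $A$.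
   Context: A holomorphic vector bundle $\mathcal{V}$ of rank $n$ over $X$ is projectively flat if there are an open cover $\{U_i\}$ of $X$ and trivializations of $\mathcal{V}$ over the $U_i$ whose transition functions on $U_i\cap U_j$ have the form $\lambda_{ij}T_{ij}$, with $\lambda_{ij}:U_i\cap U_j\to\mathbb{C}^\times$ holomorphic and $T_{ij}\in GL_n(\mathbb{C})$ constant. A cover trivializes $\mathcal{V}$ in a projectively flat way if it comes with trivializations related by transition functions of this form; the sets $U_i$ are taken to be local charts with a coordinate. Local sections are written as row vectors of component functions, so $A_i=\lambda_{ij}A_jT_{ij}$. On a local chart with coordinate $z$ and a projectively flat trivialization, a meromorphic section $A$ has components $(a_1,\dots,a_n)$; its Wronskian matrix $W(A)$ is the $n\times n$ matrix whose $k$-th row is $(a_1^{(k-1)},\dots,a_n^{(k-1)})$ (derivatives in $z$), and $w(A)=\det W(A)$. $A$ is generic if $w(A)\not\equiv0$ (independent of choices). $W(A_i)$ denotes the Wronskian matrix computed on $U_i$ with its coordinate and trivialization. The divisor of $w(A)$ is globally well defined and is denoted $\mathrm{div}(A)$; its class in $\mathrm{Pic}(X)$ is independent of the generic section $A$, and the Wronskian line bundle $w(\mathcal{V})$ is the line bundle corresponding to this class. Cocycle convention (row vectors): a section of the bundle with cocycle $\Phi_{ij}$ is given by row-vector functions $s_i$ on $U_i$ with $s_i=s_j\Phi_{ij}$, so the cocycle condition reads $\Phi_{jk}\Phi_{ij}=\Phi_{ik}$.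
   Formalization: Covers must also have no poles of A on the overlaps, and independence of the cover is claimed only for covers which, near zeros or poles of w(A) and poles of A, use the same coordinate up to translation and the same trivialization up to a constant matrix; otherwise the claims are false. *)

theory Defs
  imports
    "HOL-Complex_Analysis.Complex_Analysis"
    "Jordan_Normal_Form.Gauss_Jordan_Elimination"
    "Jordan_Normal_Form.Determinant"
begin

unbundle no vec_syntax

section \<open>Riemann surfaces\<close>

record 'x surface =
  surf_top :: "'x topology"
  charts :: "('x set \<times> ('x \<Rightarrow> complex)) set"

definition topological_chart :: "'x topology \<Rightarrow> 'x set \<Rightarrow> ('x \<Rightarrow> complex) \<Rightarrow> bool" where
  "topological_chart X U z \<longleftrightarrow>
     openin X U \<and> open (z ` U) \<and> homeomorphic_map (subtopology X U) (top_of_set (z ` U)) z"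

definition charts_compatible ::
    "'x set \<times> ('x \<Rightarrow> complex) \<Rightarrow> 'x set \<times> ('x \<Rightarrow> complex) \<Rightarrow> bool" where
  "charts_compatible = (\<lambda>(U, z) (W, w).
     (w \<circ> inv_into U z) holomorphic_on z ` (U \<inter> W) \<and>
     (z \<circ> inv_into W w) holomorphic_on w ` (U \<inter> W))"

definition riemann_surface :: "'x surface \<Rightarrow> bool" where
  "riemann_surface S \<longleftrightarrow>
     topspace (surf_top S) \<noteq> {} \<and> Hausdorff_space (surf_top S) \<and> connected_space (surf_top S) \<and>
     (\<Union>(U, z)\<in>charts S. U) = topspace (surf_top S) \<and>
     (\<forall>(U, z)\<in>charts S. topological_chart (surf_top S) U z) \<and>
     (\<forall>c\<in>charts S. \<forall>d\<in>charts S. charts_compatible c d)"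

text \<open>A local coordinate is any member of the maximal atlas determined by \<^term>\<open>charts S\<close>.\<close>

definition local_coordinate :: "'x surface \<Rightarrow> 'x set \<Rightarrow> ('x \<Rightarrow> complex) \<Rightarrow> bool" where
  "local_coordinate S U z \<longleftrightarrow>
     topological_chart (surf_top S) U z \<and> (\<forall>c\<in>charts S. charts_compatible (U, z) c)"

definition holomorphic_at :: "'x surface \<Rightarrow> ('x \<Rightarrow> complex) \<Rightarrow> 'x \<Rightarrow> bool" where
  "holomorphic_at S f x \<longleftrightarrow>
     (\<forall>(C, z)\<in>charts S. x \<in> C \<longrightarrow> (f \<circ> inv_into C z) analytic_on {z x})"

definition meromorphic_at :: "'x surface \<Rightarrow> ('x \<Rightarrow> complex) \<Rightarrow> 'x \<Rightarrow> bool" where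
  "meromorphic_at S f x \<longleftrightarrow>
     (\<forall>(C, z)\<in>charts S. x \<in> C \<longrightarrow> (f \<circ> inv_into C z) meromorphic_on {z x})"

definition pole_at :: "'x surface \<Rightarrow> ('x \<Rightarrow> complex) \<Rightarrow> 'x \<Rightarrow> bool" where
  "pole_at S f x \<longleftrightarrow>
     (\<forall>(C, z)\<in>charts S. x \<in> C \<longrightarrow> is_pole (f \<circ> inv_into C z) (z x))"

text \<open>The order does not depend on the chart. It only depends on the values of \<open>f\<close> on a punctured
  neighbourhood of \<open>x\<close>, and it is meaningful only if \<open>f\<close> does not vanish identically near \<open>x\<close>.\<close>

definition order_at :: "'x surface \<Rightarrow> ('x \<Rightarrow> complex) \<Rightarrow> 'x \<Rightarrow> int" where
  "order_at S f x =
     (THE d. \<forall>(C, z)\<in>charts S. x \<in> C \<longrightarrow> zorder (f \<circ> inv_into C z) (z x) = d)"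


section \<open>Holomorphic vector bundles\<close>

text \<open>Fibre coordinates are row vectors, so matrices act from the right:
  \<open>M\<^sup>T *\<^sub>v v\<close> is the row vector \<open>v M\<close>.\<close>

definition GL :: "nat \<Rightarrow> complex mat set" where
  "GL n = {M \<in> carrier_mat n n. invertible_mat M}"

definition holomorphic_GL :: "'x surface \<Rightarrow> nat \<Rightarrow> 'x set \<Rightarrow> ('x \<Rightarrow> complex mat) \<Rightarrow> bool" where
  "holomorphic_GL S n N g \<longleftrightarrow>
     (\<forall>x\<in>N. g x \<in> GL n) \<and>
     (\<forall>k<n. \<forall>l<n. \<forall>x\<in>N. holomorphic_at S (\<lambda>y. g y $$ (k, l)) x)"

text \<open>The topology and the complex structure of the total space are those induced by the local
  trivializations, which are recorded by their fibre coordinates.\<close>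

record ('x, 'e) vbundle =
  total :: "'e set"
  proj :: "'e \<Rightarrow> 'x"
  trivs :: "('x set \<times> ('e \<Rightarrow> complex vec)) set"

definition local_trivialization ::
    "'x surface \<Rightarrow> nat \<Rightarrow> ('x, 'e) vbundle \<Rightarrow> 'x set \<Rightarrow> ('e \<Rightarrow> complex vec) \<Rightarrow> bool" where
  "local_trivialization S n E U \<psi> \<longleftrightarrow>
     openin (surf_top S) U \<and>
     bij_betw (\<lambda>e. (proj E e, \<psi> e)) {e \<in> total E. proj E e \<in> U} (U \<times> carrier_vec n) \<and>
     (\<forall>(W, \<chi>)\<in>trivs E. \<exists>g. holomorphic_GL S n (U \<inter> W) g \<and>
        (\<forall>e\<in>total E. proj E e \<in> U \<inter> W \<longrightarrow> \<psi> e = (g (proj E e))\<^sup>T *\<^sub>v \<chi> e))"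

definition holomorphic_vector_bundle :: "'x surface \<Rightarrow> nat \<Rightarrow> ('x, 'e) vbundle \<Rightarrow> bool" where
  "holomorphic_vector_bundle S n E \<longleftrightarrow>
     proj E ` total E \<subseteq> topspace (surf_top S) \<and>
     (\<Union>(U, \<psi>)\<in>trivs E. U) = topspace (surf_top S) \<and>
     (\<forall>(U, \<psi>)\<in>trivs E. local_trivialization S n E U \<psi>)"

definition bundle_iso ::
    "'x surface \<Rightarrow> nat \<Rightarrow> ('x, 'e) vbundle \<Rightarrow> ('x, 'f) vbundle \<Rightarrow> bool" where
  "bundle_iso S n E F \<longleftrightarrow>
     (\<exists>h. bij_betw h (total E) (total F) \<and>
        (\<forall>e\<in>total E. proj F (h e) = proj E e) \<and>
        (\<forall>(U, \<psi>)\<in>trivs E. \<forall>(W, \<chi>)\<in>trivs F. \<exists>g. holomorphic_GL S n (U \<inter> W) g \<and>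
           (\<forall>e\<in>total E. proj E e \<in> U \<inter> W \<longrightarrow> \<chi> (h e) = (g (proj E e))\<^sup>T *\<^sub>v \<psi> e)))"

definition cocycle ::
    "'x surface \<Rightarrow> nat \<Rightarrow> 'i set \<Rightarrow> ('i \<Rightarrow> 'x set) \<Rightarrow> ('i \<Rightarrow> 'i \<Rightarrow> 'x \<Rightarrow> complex mat) \<Rightarrow> bool" where
  "cocycle S n I U \<Phi> \<longleftrightarrow>
     (\<forall>i\<in>I. openin (surf_top S) (U i)) \<and> (\<Union>i\<in>I. U i) = topspace (surf_top S) \<and>
     (\<forall>i\<in>I. \<forall>j\<in>I. holomorphic_GL S n (U i \<inter> U j) (\<Phi> i j)) \<and>
     (\<forall>i\<in>I. \<forall>j\<in>I. \<forall>k\<in>I. \<forall>x\<in>U i \<inter> U j \<inter> U k. \<Phi> j k x * \<Phi> i j x = \<Phi> i k x)"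

text \<open>The bundle glued from a cocycle: the points over \<open>x\<close> are the families \<open>(s\<^sub>i)\<close> of row vectors,
  indexed by the \<open>i\<close> with \<open>x \<in> U\<^sub>i\<close>, such that \<open>s\<^sub>i = s\<^sub>j \<Phi>\<^sub>i\<^sub>j(x)\<close>.\<close>

definition cocycle_bundle ::
    "nat \<Rightarrow> 'i set \<Rightarrow> ('i \<Rightarrow> 'x set) \<Rightarrow> ('i \<Rightarrow> 'i \<Rightarrow> 'x \<Rightarrow> complex mat)
       \<Rightarrow> ('x, 'x \<times> ('i \<Rightarrow> complex vec)) vbundle" where
  "cocycle_bundle n I U \<Phi> =
     \<lparr>total = {(x, s). x \<in> (\<Union>i\<in>I. U i) \<and>
                (\<forall>i\<in>I. x \<in> U i \<longrightarrow> s i \<in> carrier_vec n) \<and>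
                (\<forall>i\<in>I. \<forall>j\<in>I. x \<in> U i \<inter> U j \<longrightarrow> s i = (\<Phi> i j x)\<^sup>T *\<^sub>v s j) \<and>
                (\<forall>i. \<not> (i \<in> I \<and> x \<in> U i) \<longrightarrow> s i = undefined)},
      proj = fst,
      trivs = (\<lambda>i. (U i, \<lambda>e. snd e i)) ` I\<rparr>"

text \<open>The transition matrix \<open>M\<close> over \<open>x\<close> with \<open>\<psi> = \<chi> M\<close>.\<close>

definition transition_matrix ::
    "nat \<Rightarrow> ('x, 'e) vbundle \<Rightarrow> ('e \<Rightarrow> complex vec) \<Rightarrow> ('e \<Rightarrow> complex vec) \<Rightarrow> 'x \<Rightarrow> complex mat" where
  "transition_matrix n E \<psi> \<chi> x =
     (THE M. M \<in> carrier_mat n n \<and> (\<forall>e\<in>total E. proj E e = x \<longrightarrow> \<psi> e = M\<^sup>T *\<^sub>v \<chi> e))"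

definition det_bundle ::
    "nat \<Rightarrow> ('x, 'e) vbundle \<Rightarrow>
       ('x, 'x \<times> ('x set \<times> ('e \<Rightarrow> complex vec) \<Rightarrow> complex vec)) vbundle" where
  "det_bundle n E = cocycle_bundle 1 (trivs E) fst
     (\<lambda>(U, \<psi>) (W, \<chi>) x. mat 1 1 (\<lambda>_. Determinant.det (transition_matrix n E \<psi> \<chi> x)))"

text \<open>The line bundle of a divisor \<open>D\<close>, glued from all local equations of \<open>D\<close>: the transition
  functions are the quotients \<open>f/g\<close>, with their removable singularities removed by taking the limit.
  Since \<open>s\<^sub>f = s\<^sub>g (f/g)\<close>, the local equations themselves form a meromorphic section with
  divisor \<open>D\<close>.\<close>

definition local_equation :: "'x surface \<Rightarrow> ('x \<Rightarrow> int) \<Rightarrow> 'x set \<Rightarrow> ('x \<Rightarrow> complex) \<Rightarrow> bool" where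
  "local_equation S D U f \<longleftrightarrow>
     openin (surf_top S) U \<and>
     (\<forall>x\<in>U. meromorphic_at S f x \<and> (\<forall>\<^sub>F y in atin (surf_top S) x. f y \<noteq> 0) \<and>
            order_at S f x = D x)"

definition divisor_bundle ::
    "'x surface \<Rightarrow> ('x \<Rightarrow> int) \<Rightarrow> ('x, 'x \<times> ('x set \<times> ('x \<Rightarrow> complex) \<Rightarrow> complex vec)) vbundle" where
  "divisor_bundle S D = cocycle_bundle 1 {(U, f). local_equation S D U f} fst
     (\<lambda>(U, f) (W, g) x. mat 1 1 (\<lambda>_. Lim (atin (surf_top S) x) (\<lambda>y. f y / g y)))"


section \<open>Projectively flat bundles\<close>

text \<open>\<open>\<psi> = \<lambda> \<chi> T\<close> over \<open>N\<close>, with \<open>\<lambda>\<close> holomorphic and nowhere zero and \<open>T\<close> constant.\<close>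

definition proj_flat_on ::
    "'x surface \<Rightarrow> nat \<Rightarrow> ('x, 'e) vbundle \<Rightarrow> 'x set
       \<Rightarrow> ('e \<Rightarrow> complex vec) \<Rightarrow> ('e \<Rightarrow> complex vec) \<Rightarrow> bool" where
  "proj_flat_on S n E N \<psi> \<chi> \<longleftrightarrow>
     (\<exists>l T. (\<forall>x\<in>N. holomorphic_at S l x \<and> l x \<noteq> 0) \<and> T \<in> GL n \<and>
        (\<forall>e\<in>total E. proj E e \<in> N \<longrightarrow> \<psi> e = l (proj E e) \<cdot>\<^sub>v (T\<^sup>T *\<^sub>v \<chi> e)))"

text \<open>A bundle is projectively flat iff it admits such a \<open>P\<close>. The structure \<open>P\<close> is kept fixed, since
  a bundle may carry several inequivalent ones and genericity depends on \<open>P\<close>.\<close>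

definition proj_flat_structure ::
    "'x surface \<Rightarrow> nat \<Rightarrow> ('x, 'e) vbundle \<Rightarrow> ('x set \<times> ('e \<Rightarrow> complex vec)) set \<Rightarrow> bool" where
  "proj_flat_structure S n E P \<longleftrightarrow>
     (\<Union>(U, \<psi>)\<in>P. U) = topspace (surf_top S) \<and>
     (\<forall>(U, \<psi>)\<in>P. local_trivialization S n E U \<psi>) \<and>
     (\<forall>(U, \<psi>)\<in>P. \<forall>(W, \<chi>)\<in>P. proj_flat_on S n E (U \<inter> W) \<psi> \<chi>)"

text \<open>A coordinate neighbourhood together with a trivialization of the bundle over it.\<close>

record ('x, 'e) local_frame =
  fdom :: "'x set"
  fcoord :: "'x \<Rightarrow> complex"
  ftriv :: "'e \<Rightarrow> complex vec"

text \<open>Compatibility with \<open>P\<close> is required locally: on a disconnected overlap the constant matrix may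
  differ from one component to another.\<close>

definition proj_flat_frame ::
    "'x surface \<Rightarrow> nat \<Rightarrow> ('x, 'e) vbundle \<Rightarrow> ('x set \<times> ('e \<Rightarrow> complex vec)) set
       \<Rightarrow> ('x, 'e) local_frame \<Rightarrow> bool" where
  "proj_flat_frame S n E P F \<longleftrightarrow>
     local_coordinate S (fdom F) (fcoord F) \<and>
     local_trivialization S n E (fdom F) (ftriv F) \<and>
     (\<forall>(W, \<chi>)\<in>P. \<forall>x\<in>fdom F \<inter> W. \<exists>N. openin (surf_top S) N \<and> x \<in> N \<and> N \<subseteq> fdom F \<inter> W \<and>
        proj_flat_on S n E N (ftriv F) \<chi>)"


section \<open>Meromorphic sections and Wronskians\<close>

text \<open>At every point the section is either holomorphic or has a genuine pole, so it has no spurious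
  values at removable singularities; its value at a pole is irrelevant.\<close>

definition meromorphic_section ::
    "'x surface \<Rightarrow> nat \<Rightarrow> ('x, 'e) vbundle \<Rightarrow> ('x \<Rightarrow> 'e) \<Rightarrow> bool" where
  "meromorphic_section S n E A \<longleftrightarrow>
     (\<forall>x\<in>topspace (surf_top S). A x \<in> total E \<and> proj E (A x) = x) \<and>
     (\<forall>(U, \<psi>)\<in>trivs E. \<forall>x\<in>U.
        (\<forall>k<n. meromorphic_at S (\<lambda>y. \<psi> (A y) $ k) x) \<and>
        ((\<forall>k<n. holomorphic_at S (\<lambda>y. \<psi> (A y) $ k) x) \<or>
         (\<exists>k<n. pole_at S (\<lambda>y. \<psi> (A y) $ k) x)))"

definition section_pole ::
    "'x surface \<Rightarrow> nat \<Rightarrow> ('x, 'e) vbundle \<Rightarrow> ('x \<Rightarrow> 'e) \<Rightarrow> 'x \<Rightarrow> bool" where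
  "section_pole S n E A x \<longleftrightarrow>
     (\<exists>(U, \<psi>)\<in>trivs E. x \<in> U \<and> (\<exists>k<n. pole_at S (\<lambda>y. \<psi> (A y) $ k) x))"

text \<open>Rows are counted from 0: row \<open>k\<close> consists of the \<open>k\<close>-th derivatives.\<close>

definition wronskian_matrix ::
    "nat \<Rightarrow> ('x \<Rightarrow> 'e) \<Rightarrow> ('x, 'e) local_frame \<Rightarrow> 'x \<Rightarrow> complex mat" where
  "wronskian_matrix n A F x = mat n n (\<lambda>(k, j).
     (deriv ^^ k) (\<lambda>\<zeta>. ftriv F (A (inv_into (fdom F) (fcoord F) \<zeta>)) $ j) (fcoord F x))"

definition wronskian ::
    "nat \<Rightarrow> ('x \<Rightarrow> 'e) \<Rightarrow> ('x, 'e) local_frame \<Rightarrow> 'x \<Rightarrow> complex" where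
  "wronskian n A F x = Determinant.det (wronskian_matrix n A F x)"

definition generic_section ::
    "'x surface \<Rightarrow> nat \<Rightarrow> ('x, 'e) vbundle \<Rightarrow> ('x set \<times> ('e \<Rightarrow> complex vec)) set
       \<Rightarrow> ('x \<Rightarrow> 'e) \<Rightarrow> bool" where
  "generic_section S n E P A \<longleftrightarrow>
     (\<exists>F. proj_flat_frame S n E P F \<and>
        (\<exists>x\<in>fdom F. \<not> section_pole S n E A x \<and> wronskian n A F x \<noteq> 0))"

definition wronskian_divisor ::
    "'x surface \<Rightarrow> nat \<Rightarrow> ('x, 'e) vbundle \<Rightarrow> ('x set \<times> ('e \<Rightarrow> complex vec)) set
       \<Rightarrow> ('x \<Rightarrow> 'e) \<Rightarrow> 'x \<Rightarrow> int" where
  "wronskian_divisor S n E P A x =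
     (THE d. \<forall>F. proj_flat_frame S n E P F \<and> x \<in> fdom F \<longrightarrow> order_at S (wronskian n A F) x = d)"

text \<open>\<open>L\<close> represents the class in the Picard group shared by the divisors of all generic sections.\<close>

definition is_wronskian_line_bundle ::
    "'x surface \<Rightarrow> nat \<Rightarrow> ('x, 'e) vbundle \<Rightarrow> ('x set \<times> ('e \<Rightarrow> complex vec)) set
       \<Rightarrow> ('x, 'l) vbundle \<Rightarrow> bool" where
  "is_wronskian_line_bundle S n E P L \<longleftrightarrow>
     holomorphic_vector_bundle S 1 L \<and>
     (\<forall>B. meromorphic_section S n E B \<and> generic_section S n E P B \<longrightarrow>
        bundle_iso S 1 L (divisor_bundle S (wronskian_divisor S n E P B)))"


section \<open>The bundle of a generic section\<close>

text \<open>Besides \<open>w(A)\<close> having no zeros or poles on the overlaps, \<open>A\<close> itself must have no poles there: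
  for \<open>A = (1/z, z\<^sup>2)\<close> one has \<open>w(A) = 3\<close>, but after multiplying one trivialization by \<open>1 + z\<close> the
  matrix \<open>W(A\<^sub>j)\<^sup>-\<^sup>1 W(A\<^sub>i)\<close> has a pole at 0.\<close>

definition admissible_cover ::
    "'x surface \<Rightarrow> nat \<Rightarrow> ('x, 'e) vbundle \<Rightarrow> ('x set \<times> ('e \<Rightarrow> complex vec)) set
       \<Rightarrow> ('x \<Rightarrow> 'e) \<Rightarrow> 'i set \<Rightarrow> ('i \<Rightarrow> ('x, 'e) local_frame) \<Rightarrow> bool" where
  "admissible_cover S n E P A I C \<longleftrightarrow>
     (\<Union>i\<in>I. fdom (C i)) = topspace (surf_top S) \<and>
     (\<forall>i\<in>I. proj_flat_frame S n E P (C i)) \<and>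
     (\<forall>i\<in>I. \<forall>j\<in>I.
        proj_flat_on S n E (fdom (C i) \<inter> fdom (C j)) (ftriv (C i)) (ftriv (C j))) \<and>
     (\<forall>i\<in>I. \<forall>j\<in>I. i \<noteq> j \<longrightarrow> (\<forall>x\<in>fdom (C i) \<inter> fdom (C j).
        wronskian_divisor S n E P A x = 0 \<and> \<not> section_pole S n E A x))"

text \<open>For \<open>i = j\<close> the quotient is the constant identity matrix as a meromorphic function, also at
  the points where \<open>W(A\<^sub>i)\<close> is singular.\<close>

definition wronskian_cocycle ::
    "nat \<Rightarrow> ('x \<Rightarrow> 'e) \<Rightarrow> ('i \<Rightarrow> ('x, 'e) local_frame) \<Rightarrow> 'i \<Rightarrow> 'i \<Rightarrow> 'x \<Rightarrow> complex mat" where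
  "wronskian_cocycle n A C i j x =
     (if i = j then 1\<^sub>m n
      else the (mat_inverse (wronskian_matrix n A (C j) x)) * wronskian_matrix n A (C i) x)"

definition wronskian_bundle ::
    "nat \<Rightarrow> ('x \<Rightarrow> 'e) \<Rightarrow> 'i set \<Rightarrow> ('i \<Rightarrow> ('x, 'e) local_frame)
       \<Rightarrow> ('x, 'x \<times> ('i \<Rightarrow> complex vec)) vbundle" where
  "wronskian_bundle n A I C = cocycle_bundle n I (\<lambda>i. fdom (C i)) (wronskian_cocycle n A C)"

text \<open>The coordinate (up to translation) and the trivialization (up to a constant matrix) used near
  the isolated points where \<open>W(A)\<close> is not holomorphic and invertible are part of the data that
  determine the bundle. For the trivial bundle on the Riemann sphere and \<open>A = (1, z\<^sup>2)\<close>, replacing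
  the trivialization near 0 by its multiple by \<open>1 + c z\<close>, \<open>c \<noteq> 0\<close>, changes \<open>O \<oplus> O(-2)\<close> into
  \<open>O(-1) \<oplus> O(-1)\<close>. Two covers are therefore compared when they agree, in this sense, near those
  points; nothing is required elsewhere.\<close>

definition covers_agree ::
    "'x surface \<Rightarrow> nat \<Rightarrow> ('x, 'e) vbundle \<Rightarrow> ('x set \<times> ('e \<Rightarrow> complex vec)) set \<Rightarrow> ('x \<Rightarrow> 'e)
       \<Rightarrow> 'i set \<Rightarrow> ('i \<Rightarrow> ('x, 'e) local_frame) \<Rightarrow> 'j set \<Rightarrow> ('j \<Rightarrow> ('x, 'e) local_frame) \<Rightarrow> bool" where
  "covers_agree S n E P A I C J C' \<longleftrightarrow>
     (\<forall>i\<in>I. \<forall>j\<in>J. \<forall>x\<in>fdom (C i) \<inter> fdom (C' j).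
        wronskian_divisor S n E P A x \<noteq> 0 \<or> section_pole S n E A x \<longrightarrow>
        (\<exists>N b T. openin (surf_top S) N \<and> x \<in> N \<and> N \<subseteq> fdom (C i) \<inter> fdom (C' j) \<and>
           (\<forall>y\<in>N. fcoord (C' j) y = fcoord (C i) y + b) \<and> T \<in> GL n \<and>
           (\<forall>e\<in>total E. proj E e \<in> N \<longrightarrow> ftriv (C' j) e = T\<^sup>T *\<^sub>v ftriv (C i) e)))"

end

theory Submission
  imports Defs
begin

text \<open>Under a change of coordinate and of projectively flat frame the Wronskian matrix is multiplied from
  the left by a lower triangular matrix of holomorphic functions and from the right by a constant
  matrix, neither of which depends on the section. Hence \<open>w(A)\<close> is multiplied by a nowhere vanishing
  holomorphic factor independent of \<open>A\<close>. This makes the divisor of \<open>w(A)\<close> well defined, and it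
  identifies \<open>det \<Phi>\<^sup>A\<^sub>i\<^sub>j = w(A\<^sub>i) / w(A\<^sub>j)\<close> with \<open>w(B\<^sub>i) / w(B\<^sub>j)\<close> for every other generic section \<open>B\<close>, which
  is the cocycle of the line bundle of \<open>div(B)\<close>. Two covers are related by the matrices
  \<open>W(A\<^sub>i)\<^sup>-\<^sup>1 W(A'\<^sub>j)\<close>, which are constant near the singular points of \<open>A\<close> when the covers agree there. On the
  sphere the sections \<open>(1, z\<^sup>2)\<close> and \<open>(1, z)\<close> of the trivial bundle of rank 2 give the bundles
  \<open>O \<oplus> O(-2)\<close> and \<open>O(-1) \<oplus> O(-1)\<close>; only the first has a nonzero holomorphic section.\<close>

section \<open>Functions on a Riemann surface in local coordinates\<close>

text \<open>The difficulty sits at the isolated points where a Wronskian matrix is singular or the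
  section has a pole: the matrix cannot be inverted there, and at a pole its entries are derivatives
  with no meaning. Two devices deal with this. Where the section is holomorphic and the matrix
  invertible (\<open>regular_at\<close>, a property that survives every change of frame), identities
  are proved pointwise. Elsewhere they are proved on a punctured neighbourhood and carried to the
  centre, either as limits of a holomorphic function or because the matrices in question are
  constant there. Genericity is given at one point only; connectedness of the surface spreads it to
  a punctured neighbourhood of every point. Both bundle isomorphisms come from one criterion,
  \<open>cocycle_bundle_iso\<close>, which asks for matrices on the intersections of two covers that
  intertwine two cocycles. For the determinant such a family is almost free:
  \<open>divisor_bundle\<close> is glued from all local equations at once, the Wronskians of
  \<open>B\<close> are among them, and so its own cocycle already compares them with every other
  local equation.\<close>

lemma zorder_compose_deriv:
  assumes f: "f meromorphic_on {g z}" "eventually (\<lambda>w. f w \<noteq> 0) (at (g z))"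
    and g: "g analytic_on {z}" "deriv g z \<noteq> 0"
  shows "zorder (f \<circ> g) z = zorder f (g z)"
proof -
  define G where "G = fps_expansion g z - fps_const (g z)"
  have "(\<lambda>x. g (z + x)) has_fps_expansion fps_expansion g z"
    using g(1) by (rule analytic_at_imp_has_fps_expansion)
  then have G: "(\<lambda>x. g (z + x) - g z) has_fps_expansion G"
    unfolding G_def by (intro fps_expansion_intros)
  have G1: "fps_nth G 1 \<noteq> 0" "fps_nth G 0 = 0"
    using g(2) by (auto simp: G_def fps_expansion_def)
  \<comment> \<open>A nonzero derivative means that \<open>g\<close> takes the value
    \<open>g z\<close> to exactly first order, so composition multiplies the order by 1.\<close>
  then have "subdegree G = 1" by (intro subdegreeI) auto
  moreover have "zorder (f \<circ> g) z = zorder f (g z) * subdegree G"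
    using f G G1 by (intro zorder_compose) (auto simp: meromorphic_at_iff)
  ultimately show ?thesis by simp
qed

lemma topological_chart_inj:
  assumes "topological_chart X U z"
  shows "inj_on z U" "U \<subseteq> topspace X"
proof -
  show U: "U \<subseteq> topspace X"
    using assms by (simp add: topological_chart_def openin_subset)
  have "inj_on z (topspace (subtopology X U))"
    using assms homeomorphic_imp_injective_map unfolding topological_chart_def by blast
  then show "inj_on z U" using Int_absorb1[OF U] by simp
qed

lemma topological_chart_open_image:
  assumes c: "topological_chart X U z" and N: "openin X N" "N \<subseteq> U"
  shows "open (z ` N)"
proof -
  have "open_map (subtopology X U) (top_of_set (z ` U)) z"
    using c by (auto simp: topological_chart_def intro: homeomorphic_imp_open_map)
  moreover have "openin (subtopology X U) N"
    using N by (simp add: openin_subset_topspace_eq openin_subtopology) blast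
  ultimately have "openin (top_of_set (z ` U)) (z ` N)" by (simp add: open_map_def)
  then show ?thesis using c by (meson openin_open_trans topological_chart_def)
qed

lemma topological_chart_open_preimage:
  assumes c: "topological_chart X U z" and D: "open D"
  shows "openin X {x \<in> U. z x \<in> D}"
proof -
  have U: "U \<subseteq> topspace X" "openin X U"
    using c by (auto simp: topological_chart_def openin_subset)
  have "continuous_map (subtopology X U) (top_of_set (z ` U)) z"
    using c by (auto simp: topological_chart_def intro: homeomorphic_imp_continuous_map)
  then have "continuous_map (subtopology X U) euclidean z"
    by (simp add: continuous_map_in_subtopology)
  then have "openin (subtopology X U) {x \<in> topspace (subtopology X U). z x \<in> D}"
    using D by (intro openin_continuous_map_preimage) auto
  moreover have "{x \<in> topspace (subtopology X U). z x \<in> D} = {x \<in> U. z x \<in> D}" using U(1) by auto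
  ultimately have "openin (subtopology X U) {x \<in> U. z x \<in> D}" by simp
  then show ?thesis using U openin_trans_full by blast
qed

lemma topological_chart_subset:
  assumes c: "topological_chart X U z" and N: "openin X N" "N \<subseteq> U"
  shows "topological_chart X N z"
proof -
  have "homeomorphic_map (subtopology X U) (top_of_set (z ` U)) z"
    using c by (simp add: topological_chart_def)
  then have "homeomorphic_map (subtopology (subtopology X U) N) (subtopology (top_of_set (z ` U)) (z ` N)) z"
  proof (rule homeomorphic_map_subtopologies)
    have "topspace (subtopology X U) \<inter> N = N"
      using N topological_chart_inj(2)[OF c] by (auto simp: topspace_subtopology_subset)
    then show "z ` (topspace (subtopology X U) \<inter> N) = topspace (top_of_set (z ` U)) \<inter> z ` N"
      using N by auto
  qed
  moreover have "U \<inter> N = N" "z ` U \<inter> z ` N = z ` N" using N by auto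
  ultimately have "homeomorphic_map (subtopology X N) (top_of_set (z ` N)) z"
    by (simp add: subtopology_subtopology)
  then show ?thesis using topological_chart_open_image[OF c N] N
    by (simp add: topological_chart_def)
qed

text \<open>Dictionary that moves local arguments between plane and surface; it works because a
  chart and its inverse both carry open sets to open sets.\<close>

lemma eventually_nhds_chart:
  assumes c: "topological_chart X U z" and x: "x \<in> U"
  shows "eventually (\<lambda>t. P (inv_into U z t)) (nhds (z x)) \<longleftrightarrow>
    (\<exists>N. openin X N \<and> x \<in> N \<and> N \<subseteq> U \<and> (\<forall>y\<in>N. P y))"
proof
  assume "eventually (\<lambda>t. P (inv_into U z t)) (nhds (z x))"
  then obtain D where D: "open D" "z x \<in> D" "\<And>t. t \<in> D \<Longrightarrow> P (inv_into U z t)"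
    by (auto simp: eventually_nhds)
  have "P y" if "y \<in> U" "z y \<in> D" for y
    using D(3)[OF that(2)] that topological_chart_inj(1)[OF c] by simp
  then show "\<exists>N. openin X N \<and> x \<in> N \<and> N \<subseteq> U \<and> (\<forall>y\<in>N. P y)"
    using topological_chart_open_preimage[OF c D(1)] D(2) x
    by (intro exI[of _ "{x \<in> U. z x \<in> D}"]) auto
next
  assume "\<exists>N. openin X N \<and> x \<in> N \<and> N \<subseteq> U \<and> (\<forall>y\<in>N. P y)"
  then obtain N where N: "openin X N" "x \<in> N" "N \<subseteq> U" "\<And>y. y \<in> N \<Longrightarrow> P y" by blast
  have "open (z ` N)" using topological_chart_open_image[OF c N(1,3)] .
  moreover have "P (inv_into U z t)" if "t \<in> z ` N" for t
    using that N topological_chart_inj(1)[OF c] by (auto simp: subset_iff)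
  ultimately show "eventually (\<lambda>t. P (inv_into U z t)) (nhds (z x))"
    using N(2) by (auto simp: eventually_nhds)
qed

text \<open>Charts are injective, so the excluded centre \<open>z x\<close> corresponds exactly to
  \<open>x\<close>. Limits and generic nonvanishing on the surface thereby reduce to the filter
  \<open>at\<close> in the plane.\<close>

lemma atin_chart:
  assumes c: "topological_chart X U z" and x: "x \<in> U"
  shows "atin X x = filtermap (inv_into U z) (at (z x))"
proof (rule filter_eqI)
  fix P
  have xX: "x \<in> topspace X" using x topological_chart_inj(2)[OF c] by blast
  have UX: "openin X U" using c by (simp add: topological_chart_def)
  have inj: "inj_on z U" using topological_chart_inj(1)[OF c] .
  have "eventually P (filtermap (inv_into U z) (at (z x))) \<longleftrightarrow>
      eventually (\<lambda>t. t \<noteq> z x \<longrightarrow> P (inv_into U z t)) (nhds (z x))"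
    by (simp add: eventually_filtermap eventually_at_filter)
  also have "\<dots> \<longleftrightarrow> eventually (\<lambda>t. inv_into U z t \<noteq> x \<longrightarrow> P (inv_into U z t)) (nhds (z x))"
  proof -
    have "open (z ` U)" "z x \<in> z ` U" using c x by (auto simp: topological_chart_def)
    then have "eventually (\<lambda>t. t \<in> z ` U) (nhds (z x))" by (rule eventually_nhds_in_open)
    then have "eventually (\<lambda>t. (t \<noteq> z x) = (inv_into U z t \<noteq> x)) (nhds (z x))"
    proof eventually_elim
      case (elim t)
      then obtain y where "y \<in> U" "t = z y" by blast
      then show ?case using inj x by (simp add: inj_on_eq_iff)
    qed
    then show ?thesis by (rule eventually_cong) blast
  qed
  also have "\<dots> \<longleftrightarrow> (\<exists>N. openin X N \<and> x \<in> N \<and> N \<subseteq> U \<and> (\<forall>y\<in>N. y \<noteq> x \<longrightarrow> P y))"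
    by (rule eventually_nhds_chart[OF c x])
  also have "\<dots> \<longleftrightarrow> eventually P (atin X x)"
  proof
    assume "\<exists>N. openin X N \<and> x \<in> N \<and> N \<subseteq> U \<and> (\<forall>y\<in>N. y \<noteq> x \<longrightarrow> P y)"
    then show "eventually P (atin X x)" by (auto simp: eventually_atin)
  next
    assume "eventually P (atin X x)"
    then obtain N where "openin X N" "x \<in> N" "\<forall>y\<in>N - {x}. P y"
      using xX by (auto simp: eventually_atin)
    then show "\<exists>N. openin X N \<and> x \<in> N \<and> N \<subseteq> U \<and> (\<forall>y\<in>N. y \<noteq> x \<longrightarrow> P y)"
      using UX x by (intro exI[of _ "N \<inter> U"]) auto
  qed
  finally show "eventually P (atin X x) \<longleftrightarrow> eventually P (filtermap (inv_into U z) (at (z x)))"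
    by simp
qed

section \<open>Independence of the chart: holomorphy, meromorphy and order\<close>

locale riemann =
  fixes S :: "'x surface"
  assumes riemann: "riemann_surface S"
begin

abbreviation "X \<equiv> surf_top S"
abbreviation "coord \<equiv> local_coordinate S"

lemma charts_local_coordinate:
  assumes "(C, c) \<in> charts S" shows "coord C c"
  using riemann assms unfolding riemann_surface_def local_coordinate_def by blast

lemma chart_exists:
  assumes "x \<in> topspace X"
  obtains C c where "(C, c) \<in> charts S" "coord C c" "x \<in> C"
proof -
  have "(\<Union>(U, z)\<in>charts S. U) = topspace X" using riemann by (simp add: riemann_surface_def)
  then obtain C c where "(C, c) \<in> charts S" "x \<in> C" using assms by blast
  then show ?thesis using charts_local_coordinate that by blast
qed

lemma local_coordinateD:
  assumes "coord U z"
  shows "topological_chart X U z" "inj_on z U" "U \<subseteq> topspace X" "openin X U" "open (z ` U)"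
  using assms topological_chart_inj[of X U z] by (auto simp: local_coordinate_def topological_chart_def)

lemma eventually_nhds_coordinate:
  assumes "coord U z" "x \<in> U"
  shows "eventually (\<lambda>t. t \<in> z ` U) (nhds (z x))"
  using assms local_coordinateD(5) by (intro eventually_nhds_in_open) auto

lemma local_coordinate_charts_holomorphic:
  assumes "coord U z" "(C, c) \<in> charts S" "x \<in> U \<inter> C"
  shows "(z \<circ> inv_into C c) analytic_on {c x}" "(c \<circ> inv_into U z) analytic_on {z x}"
proof -
  have h: "(z \<circ> inv_into C c) holomorphic_on c ` (U \<inter> C)" "(c \<circ> inv_into U z) holomorphic_on z ` (U \<inter> C)"
    using assms by (auto simp: local_coordinate_def charts_compatible_def)
  have t: "topological_chart X U z" "topological_chart X C c"
    using assms charts_local_coordinate local_coordinateD by blast+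
  then have "open (z ` (U \<inter> C))" "open (c ` (U \<inter> C))"
    by (auto intro!: topological_chart_open_image simp: topological_chart_def)
  then show "(z \<circ> inv_into C c) analytic_on {c x}" "(c \<circ> inv_into U z) analytic_on {z x}"
    using h assms(3) by (auto simp: analytic_at)
qed

lemma transition_eventually:
  assumes U: "coord U z" and V: "coord V w" and x: "x \<in> U" "x \<in> V"
  shows "eventually (\<lambda>t. inv_into V w t \<in> U \<inter> V \<and> w (inv_into V w t) = t \<and>
     inv_into U z ((z \<circ> inv_into V w) t) = inv_into V w t) (nhds (w x))"
proof -
  have "open (w ` (U \<inter> V))"
    using local_coordinateD(1,4)[OF U] local_coordinateD(1,4)[OF V]
    by (intro topological_chart_open_image[of X V w]) auto
  then have "eventually (\<lambda>t. t \<in> w ` (U \<inter> V)) (nhds (w x))"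
    using x by (intro eventually_nhds_in_open) auto
  then show ?thesis
    by eventually_elim (use local_coordinateD(2)[OF U] local_coordinateD(2)[OF V] in auto)
qed

text \<open>Two members of the maximal atlas are only known to be compatible with the charts of
  \<open>S\<close>, so the transition is factored through such a chart around
  \<open>x\<close>.\<close>

lemma transition_analytic:
  assumes U: "coord U z" and V: "coord V w" and x: "x \<in> U" "x \<in> V"
  shows "(z \<circ> inv_into V w) analytic_on {w x}"
proof -
  obtain C c where C: "(C, c) \<in> charts S" "coord C c" "x \<in> C"
    using chart_exists local_coordinateD(3)[OF U] x by blast
  have cx: "inv_into V w (w x) = x" using x local_coordinateD(2)[OF V] by simp
  have "((z \<circ> inv_into C c) \<circ> (c \<circ> inv_into V w)) analytic_on {w x}"
    using local_coordinate_charts_holomorphic(1)[OF U C(1), of x]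
      local_coordinate_charts_holomorphic(2)[OF V C(1), of x] x C
    by (intro analytic_on_compose) (auto simp: cx)
  moreover have "eventually (\<lambda>t. ((z \<circ> inv_into C c) \<circ> (c \<circ> inv_into V w)) t = (z \<circ> inv_into V w) t) (nhds (w x))"
    using transition_eventually[OF C(2) V C(3) x(2)] by eventually_elim auto
  ultimately show ?thesis using analytic_at_cong by blast
qed

text \<open>The reverse transition is a local inverse; by the chain rule a vanishing derivative
  would force the derivative of the identity to be 0.\<close>

lemma transition_deriv_nonzero:
  assumes U: "coord U z" and V: "coord V w" and x: "x \<in> U" "x \<in> V"
  shows "deriv (z \<circ> inv_into V w) (w x) \<noteq> 0"
proof
  assume 0: "deriv (z \<circ> inv_into V w) (w x) = 0"
  have cx: "inv_into V w (w x) = x" using x local_coordinateD(2)[OF V] by simp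
  have a: "(z \<circ> inv_into V w) field_differentiable at (w x)"
    using transition_analytic[OF U V x] by (simp add: analytic_on_imp_differentiable_at)
  have b: "(w \<circ> inv_into U z) field_differentiable at ((z \<circ> inv_into V w) (w x))"
    using transition_analytic[OF V U x(2,1)] by (simp add: analytic_on_imp_differentiable_at cx)
  have "eventually (\<lambda>t. ((w \<circ> inv_into U z) \<circ> (z \<circ> inv_into V w)) t = t) (nhds (w x))"
    using transition_eventually[OF U V x] by eventually_elim auto
  then have "deriv ((w \<circ> inv_into U z) \<circ> (z \<circ> inv_into V w)) (w x) = deriv (\<lambda>t. t) (w x)"
    by (intro deriv_cong_ev) auto
  then show False using deriv_chain[OF a b] 0 by (simp del: o_apply)
qed

text \<open>One scheme for all pointwise properties: anything stable under composition with an
  analytic map and under change within the germ can be tested in a single arbitrary coordinate. The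
  converse direction uses that some chart of the atlas contains \<open>x\<close>.\<close>

lemma chart_independent:
  assumes Q: "\<And>f g \<phi> t. Q f (\<phi> t) \<Longrightarrow> \<phi> analytic_on {t} \<Longrightarrow> eventually (\<lambda>w. (f \<circ> \<phi>) w = g w) (nhds t) \<Longrightarrow> Q g t"
    and U: "coord U z" and x: "x \<in> U"
  shows "(\<forall>(C, c)\<in>charts S. x \<in> C \<longrightarrow> Q (f \<circ> inv_into C c) (c x)) \<longleftrightarrow> Q (f \<circ> inv_into U z) (z x)"
proof -
  have *: "Q (f \<circ> inv_into V w) (w x)"
    if U: "coord U z" and V: "coord V w" and x: "x \<in> U" "x \<in> V"
      and f: "Q (f \<circ> inv_into U z) (z x)" for U z V w
  proof (rule Q)
    show "Q (f \<circ> inv_into U z) ((z \<circ> inv_into V w) (w x))"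
      using f x local_coordinateD(2)[OF V] by simp
    show "(z \<circ> inv_into V w) analytic_on {w x}" by (rule transition_analytic[OF U V x])
    show "eventually (\<lambda>t. ((f \<circ> inv_into U z) \<circ> (z \<circ> inv_into V w)) t = (f \<circ> inv_into V w) t) (nhds (w x))"
      using transition_eventually[OF U V x] by eventually_elim auto
  qed
  obtain C c where C: "(C, c) \<in> charts S" "coord C c" "x \<in> C"
    using chart_exists local_coordinateD(3)[OF U] x by blast
  show ?thesis
  proof
    assume "\<forall>(C, c)\<in>charts S. x \<in> C \<longrightarrow> Q (f \<circ> inv_into C c) (c x)"
    then have "Q (f \<circ> inv_into C c) (c x)" using C by blast
    then show "Q (f \<circ> inv_into U z) (z x)" by (rule *[OF C(2) U C(3) x])
  next
    assume f: "Q (f \<circ> inv_into U z) (z x)"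
    have "Q (f \<circ> inv_into D d) (d x)" if "(D, d) \<in> charts S" "x \<in> D" for D d
      by (rule *[OF U charts_local_coordinate[OF that(1)] x that(2) f])
    then show "\<forall>(C, c)\<in>charts S. x \<in> C \<longrightarrow> Q (f \<circ> inv_into C c) (c x)" by blast
  qed
qed

lemma holomorphic_at_iff:
  assumes "coord U z" "x \<in> U"
  shows "holomorphic_at S f x \<longleftrightarrow> (f \<circ> inv_into U z) analytic_on {z x}"
  unfolding holomorphic_at_def
proof (rule chart_independent[OF _ assms])
  fix f g \<phi> :: "complex \<Rightarrow> complex" and t
  assume *: "f analytic_on {\<phi> t}" "\<phi> analytic_on {t}" "eventually (\<lambda>w. (f \<circ> \<phi>) w = g w) (nhds t)"
  have "(f \<circ> \<phi>) analytic_on {t}" using *(1,2) by (intro analytic_on_compose) auto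
  then show "g analytic_on {t}" using analytic_at_cong[OF *(3) refl] by blast
qed

lemma meromorphic_at_iff':
  assumes "coord U z" "x \<in> U"
  shows "meromorphic_at S f x \<longleftrightarrow> (f \<circ> inv_into U z) meromorphic_on {z x}"
  unfolding meromorphic_at_def
proof (rule chart_independent[OF _ assms])
  fix f g \<phi> :: "complex \<Rightarrow> complex" and t
  assume *: "f meromorphic_on {\<phi> t}" "\<phi> analytic_on {t}" "eventually (\<lambda>w. (f \<circ> \<phi>) w = g w) (nhds t)"
  have 1: "(\<lambda>w. f (\<phi> w)) meromorphic_on {t}" by (rule meromorphic_on_compose[OF *(1,2)]) simp
  have 2: "eventually (\<lambda>w. f (\<phi> w) = g w) (at t)" using *(3) by (simp add: eventually_nhds_conv_at)
  show "g meromorphic_on {t}" by (rule iffD1[OF meromorphic_on_cong[OF _ refl] 1]) (use 2 in simp)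
qed

lemma atin_coordinate:
  assumes U: "coord U z" and x: "x \<in> U"
  shows "atin X x = filtermap (inv_into U z) (at (z x))"
  by (rule atin_chart[OF local_coordinateD(1)[OF U] x])

lemma atin_neq_bot:
  assumes "x \<in> topspace X" shows "atin X x \<noteq> bot"
proof -
  obtain C c where "coord C c" "x \<in> C" using chart_exists assms by metis
  then show ?thesis by (simp add: atin_coordinate filtermap_bot_iff)
qed

text \<open>Makes the definite description in \<open>order_at\<close> usable. Transition maps have
  nonzero derivative and hence preserve \<open>zorder\<close>, so all charts yield one
  number.\<close>

lemma order_at_eq:
  assumes U: "coord U z" and x: "x \<in> U"
    and f: "meromorphic_at S f x" "eventually (\<lambda>y. f y \<noteq> 0) (atin X x)"
  shows "order_at S f x = zorder (f \<circ> inv_into U z) (z x)"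
proof -
  have *: "zorder (f \<circ> inv_into C c) (c x) = zorder (f \<circ> inv_into U z) (z x)"
    if "(C, c) \<in> charts S" "x \<in> C" for C c
  proof -
    have C: "coord C c" using charts_local_coordinate that by blast
    have cx: "inv_into C c (c x) = x" using that local_coordinateD(2)[OF C] by simp
    have "eventually (\<lambda>t. (f \<circ> inv_into C c) t = ((f \<circ> inv_into U z) \<circ> (z \<circ> inv_into C c)) t) (nhds (c x))"
      using transition_eventually[OF U C x that(2)] by eventually_elim auto
    then have "eventually (\<lambda>t. (f \<circ> inv_into C c) t = ((f \<circ> inv_into U z) \<circ> (z \<circ> inv_into C c)) t) (at (c x))"
      using eventually_nhds_conv_at by blast
    then have "zorder (f \<circ> inv_into C c) (c x) = zorder ((f \<circ> inv_into U z) \<circ> (z \<circ> inv_into C c)) (c x)"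
      by (rule zorder_cong) simp
    also have "\<dots> = zorder (f \<circ> inv_into U z) ((z \<circ> inv_into C c) (c x))"
    proof (rule zorder_compose_deriv)
      show "(f \<circ> inv_into U z) meromorphic_on {(z \<circ> inv_into C c) (c x)}"
        using f(1) meromorphic_at_iff'[OF U x] by (simp add: cx)
      show "eventually (\<lambda>w. (f \<circ> inv_into U z) w \<noteq> 0) (at ((z \<circ> inv_into C c) (c x)))"
        using f(2) atin_coordinate[OF U x] by (simp add: cx eventually_filtermap)
    qed (rule transition_analytic[OF U C x that(2)] transition_deriv_nonzero[OF U C x that(2)])+
    finally show ?thesis by (simp add: cx)
  qed
  obtain C c where C: "(C, c) \<in> charts S" "x \<in> C"
    using chart_exists local_coordinateD(3)[OF U] x by blast
  show ?thesis unfolding order_at_def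
  proof (rule the_equality)
    show "\<forall>(C, c)\<in>charts S. x \<in> C \<longrightarrow> zorder (f \<circ> inv_into C c) (c x) = zorder (f \<circ> inv_into U z) (z x)"
      using * by blast
    fix d assume "\<forall>(C, c)\<in>charts S. x \<in> C \<longrightarrow> zorder (f \<circ> inv_into C c) (c x) = d"
    then have "zorder (f \<circ> inv_into C c) (c x) = d" using C by blast
    then show "d = zorder (f \<circ> inv_into U z) (z x)" using *[OF C] by simp
  qed
qed

section \<open>Closure properties and isolated singularities on the surface\<close>

lemma holomorphic_atD:
  "holomorphic_at S f x \<Longrightarrow> (C, c) \<in> charts S \<Longrightarrow> x \<in> C \<Longrightarrow> (\<lambda>t. f (inv_into C c t)) analytic_on {c x}"
  unfolding holomorphic_at_def o_def by blast

lemma holomorphic_atI: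
  "(\<And>C c. (C, c) \<in> charts S \<Longrightarrow> x \<in> C \<Longrightarrow> (\<lambda>t. f (inv_into C c t)) analytic_on {c x}) \<Longrightarrow> holomorphic_at S f x"
  unfolding holomorphic_at_def o_def by blast

lemma meromorphic_atD:
  "meromorphic_at S f x \<Longrightarrow> (C, c) \<in> charts S \<Longrightarrow> x \<in> C \<Longrightarrow> (\<lambda>t. f (inv_into C c t)) meromorphic_on {c x}"
  unfolding meromorphic_at_def o_def by blast

lemma meromorphic_atI:
  "(\<And>C c. (C, c) \<in> charts S \<Longrightarrow> x \<in> C \<Longrightarrow> (\<lambda>t. f (inv_into C c t)) meromorphic_on {c x}) \<Longrightarrow> meromorphic_at S f x"
  unfolding meromorphic_at_def o_def by blast

lemma holomorphic_at_meromorphic: "holomorphic_at S f x \<Longrightarrow> meromorphic_at S f x"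
  by (rule meromorphic_atI) (rule analytic_on_imp_meromorphic_on, rule holomorphic_atD)

lemma holomorphic_at_const: "holomorphic_at S (\<lambda>_. c) x"
  by (rule holomorphic_atI) simp

lemma holomorphic_at_mult:
  "holomorphic_at S f x \<Longrightarrow> holomorphic_at S g x \<Longrightarrow> holomorphic_at S (\<lambda>y. f y * g y) x"
  by (rule holomorphic_atI, rule analytic_on_mult) (rule holomorphic_atD; assumption)+

lemma holomorphic_at_divide:
  assumes "holomorphic_at S f x" "holomorphic_at S g x" "g x \<noteq> 0"
  shows "holomorphic_at S (\<lambda>y. f y / g y) x"
proof (rule holomorphic_atI)
  fix C c assume C: "(C, c) \<in> charts S" "x \<in> C"
  have "inv_into C c (c x) = x"
    using local_coordinateD(2)[OF charts_local_coordinate[OF C(1)]] C(2) by simp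
  then show "(\<lambda>t. f (inv_into C c t) / g (inv_into C c t)) analytic_on {c x}"
    using assms(3) by (intro analytic_on_divide holomorphic_atD[OF _ C] assms) auto
qed

lemma holomorphic_at_sum:
  assumes "\<And>i. i \<in> I \<Longrightarrow> holomorphic_at S (f i) x" 
  shows "holomorphic_at S (\<lambda>y. \<Sum>i\<in>I. f i y) x"
  by (rule holomorphic_atI, rule analytic_on_sum) (rule holomorphic_atD, rule assms)

lemma holomorphic_at_prod:
  assumes "\<And>i. i \<in> I \<Longrightarrow> holomorphic_at S (f i) x" 
  shows "holomorphic_at S (\<lambda>y. \<Prod>i\<in>I. f i y) x"
  by (rule holomorphic_atI, rule analytic_on_prod) (rule holomorphic_atD, rule assms)

lemma meromorphic_at_const: "meromorphic_at S (\<lambda>_. c) x"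
  by (rule meromorphic_atI) auto

lemma meromorphic_at_mult:
  "meromorphic_at S f x \<Longrightarrow> meromorphic_at S g x \<Longrightarrow> meromorphic_at S (\<lambda>y. f y * g y) x"
  by (rule meromorphic_atI, rule meromorphic_on_mult) (rule meromorphic_atD; assumption)+

lemma meromorphic_at_sum:
  assumes "\<And>i. i \<in> I \<Longrightarrow> meromorphic_at S (f i) x" 
  shows "meromorphic_at S (\<lambda>y. \<Sum>i\<in>I. f i y) x"
  by (rule meromorphic_atI, rule meromorphic_on_sum) (rule meromorphic_atD, rule assms)

lemma meromorphic_at_prod:
  assumes "\<And>i. i \<in> I \<Longrightarrow> meromorphic_at S (f i) x" 
  shows "meromorphic_at S (\<lambda>y. \<Prod>i\<in>I. f i y) x"
  by (rule meromorphic_atI, rule meromorphic_on_prod) (rule meromorphic_atD, rule assms)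

lemma eventually_nhds_coordinateI:
  assumes U: "coord U z" and N: "openin X N" "x \<in> N" and x: "x \<in> U"
    and P: "\<And>y. y \<in> N \<Longrightarrow> P y"
  shows "eventually (\<lambda>t. P (inv_into U z t)) (nhds (z x))"
  unfolding eventually_nhds_chart[OF local_coordinateD(1)[OF U] x]
  using N x P local_coordinateD(4)[OF U] by (intro exI[of _ "N \<inter> U"]) auto

lemma holomorphic_at_transform:
  assumes f: "holomorphic_at S f x" and N: "openin X N" "x \<in> N" and eq: "\<And>y. y \<in> N \<Longrightarrow> g y = f y"
  shows "holomorphic_at S g x"
proof -
  have "x \<in> topspace X" using N openin_subset by blast
  then obtain C c where C: "coord C c" "x \<in> C" using chart_exists by metis
  have "eventually (\<lambda>t. g (inv_into C c t) = f (inv_into C c t)) (nhds (c x))"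
    by (rule eventually_nhds_coordinateI[OF C(1) N C(2)]) (rule eq)
  then have "eventually (\<lambda>t. (g \<circ> inv_into C c) t = (f \<circ> inv_into C c) t) (nhds (c x))" by simp
  from analytic_at_cong[OF this refl] show ?thesis using f holomorphic_at_iff[OF C] by blast
qed

text \<open>Poles and misplaced values are isolated: a meromorphic germ is analytic on a punctured
  disc, and the chart pulls this disc back to the surface.\<close>

lemma meromorphic_at_nearby:
  assumes "meromorphic_at S f x" "x \<in> topspace X"
  shows "eventually (holomorphic_at S f) (atin X x)"
proof -
  obtain C c where C: "coord C c" "x \<in> C" using assms chart_exists by metis
  have "(f \<circ> inv_into C c) meromorphic_on {c x}" using assms meromorphic_at_iff'[OF C] by blast
  then have "isolated_singularity_at (f \<circ> inv_into C c) (c x)" by (simp add: meromorphic_at_iff)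
  then obtain r where r: "r > 0" "(f \<circ> inv_into C c) analytic_on ball (c x) r - {c x}"
    by (auto simp: isolated_singularity_at_def)
  have "openin X {y \<in> C. c y \<in> ball (c x) r}"
    by (rule topological_chart_open_preimage[OF local_coordinateD(1)[OF C(1)] open_ball])
  moreover have "holomorphic_at S f y" if y: "y \<in> C" "c y \<in> ball (c x) r" "y \<noteq> x" for y
  proof -
    have "c y \<noteq> c x" using y C local_coordinateD(2)[OF C(1)] by (meson inj_onD)
    then have "(f \<circ> inv_into C c) analytic_on {c y}"
      using r y by (auto intro: analytic_on_subset)
    then show ?thesis using holomorphic_at_iff[OF C(1)] y by blast
  qed
  ultimately show ?thesis unfolding eventually_atin
    using r C by (intro disjI2 exI[of _ "{y \<in> C. c y \<in> ball (c x) r}"]) auto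
qed

text \<open>Local identity theorem; this alternative drives the open-and-closed argument that
  spreads genericity over the surface.\<close>

lemma meromorphic_at_cases:
  assumes "meromorphic_at S f x" "x \<in> topspace X"
  shows "eventually (\<lambda>y. f y = 0) (atin X x) \<or> eventually (\<lambda>y. f y \<noteq> 0) (atin X x)"
proof -
  obtain C c where C: "coord C c" "x \<in> C" using assms chart_exists by metis
  have "(f \<circ> inv_into C c) meromorphic_on {c x}" using assms meromorphic_at_iff'[OF C] by blast
  then show ?thesis unfolding atin_coordinate[OF C] eventually_filtermap
    using non_zero_neighbour[of "f \<circ> inv_into C c" "c x"] 
    by (auto simp: meromorphic_at_iff frequently_def o_def)
qed

lemma local_coordinate_subset:
  assumes U: "coord U z" and N: "openin X N" "N \<subseteq> U"
  shows "coord N z"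
  unfolding local_coordinate_def
proof safe
  show "topological_chart X N z"
    by (rule topological_chart_subset[OF local_coordinateD(1)[OF U] N])
  fix C c assume C: "(C, c) \<in> charts S"
  have h: "(z \<circ> inv_into C c) holomorphic_on c ` (U \<inter> C)" "(c \<circ> inv_into U z) holomorphic_on z ` (U \<inter> C)"
    using U C by (auto simp: local_coordinate_def charts_compatible_def)
  have inj: "inj_on z U" "inj_on z N" using local_coordinateD(2)[OF U] N inj_on_subset by blast+
  \<comment> \<open>\<open>inv_into\<close> depends on the domain, so shrinking \<open>U\<close> to
    \<open>N\<close> changes the function; the two versions agree on the image of
    \<open>N\<close>.\<close>
  have "(c \<circ> inv_into N z) holomorphic_on z ` (N \<inter> C)"
  proof (rule holomorphic_transform)
    show "(c \<circ> inv_into U z) holomorphic_on z ` (N \<inter> C)"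
      using h(2) by (rule holomorphic_on_subset) (use N in auto)
    fix t assume "t \<in> z ` (N \<inter> C)"
    then obtain y where "y \<in> N" "t = z y" by blast
    then show "(c \<circ> inv_into U z) t = (c \<circ> inv_into N z) t" using inj N by (auto simp: subset_iff)
  qed
  moreover have "(z \<circ> inv_into C c) holomorphic_on c ` (N \<inter> C)"
    using h(1) by (rule holomorphic_on_subset) (use N in auto)
  ultimately show "charts_compatible (N, z) (C, c)" by (simp add: charts_compatible_def)
qed

end

section \<open>Invertible matrices\<close>

abbreviation det :: "complex mat \<Rightarrow> complex" where "det \<equiv> Determinant.det"

lemma GL_iff_det: "M \<in> GL n \<longleftrightarrow> M \<in> carrier_mat n n \<and> det M \<noteq> 0"
proof
  assume "M \<in> GL n"
  then have M: "M \<in> carrier_mat n n" "invertible_mat M" by (auto simp: GL_def)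
  then obtain B where B: "M * B = 1\<^sub>m n" "B * M = 1\<^sub>m (dim_row B)"
    by (auto simp: invertible_mat_def inverts_mat_def)
  have "dim_col (M * B) = n" "dim_col (B * M) = dim_row B" using B by simp_all
  then have "B \<in> carrier_mat n n" using M(1) by auto
  then have "det M * det B = 1"
    using B(1) M(1) by (metis Determinant.det_mult det_one)
  then show "M \<in> carrier_mat n n \<and> det M \<noteq> 0" using M by auto
next
  assume M: "M \<in> carrier_mat n n \<and> det M \<noteq> 0"
  define B where "B = inverse (det M) \<cdot>\<^sub>m adj_mat M"
  have a: "adj_mat M \<in> carrier_mat n n" "M * adj_mat M = det M \<cdot>\<^sub>m 1\<^sub>m n"
    "adj_mat M * M = det M \<cdot>\<^sub>m 1\<^sub>m n" using adj_mat M by blast+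
  have "M * B = 1\<^sub>m n" "B * M = 1\<^sub>m n" "dim_row B = n" "square_mat M"
    using a M by (auto simp: B_def mult_smult_distrib[of _ n n] mult_smult_assoc_mat[of _ n n])
  then have "invertible_mat M" using M by (auto simp: invertible_mat_def inverts_mat_def)
  then show "M \<in> GL n" using M by (simp add: GL_def)
qed

lemma GL_carrier: "M \<in> GL n \<Longrightarrow> M \<in> carrier_mat n n"
  by (simp add: GL_def)

lemma GL_one: "1\<^sub>m n \<in> GL n"
  by (simp add: GL_iff_det)

lemma GL_mult: "M \<in> GL n \<Longrightarrow> N \<in> GL n \<Longrightarrow> M * N \<in> GL n"
  by (auto simp: GL_iff_det Determinant.det_mult[of _ n])

text \<open>The same term as in \<open>wronskian_cocycle\<close>. It is a genuine inverse on
  \<open>GL n\<close>; outside it stands for the unspecified \<open>the None\<close>.\<close>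

abbreviation minv :: "complex mat \<Rightarrow> complex mat" where
  "minv M \<equiv> the (mat_inverse M)"

lemma minv:
  assumes "M \<in> GL n"
  shows "minv M \<in> carrier_mat n n" "M * minv M = 1\<^sub>m n" "minv M * M = 1\<^sub>m n"
proof -
  have M: "M \<in> carrier_mat n n" "det M \<noteq> 0" using assms by (auto simp: GL_iff_det)
  then have "M \<in> Units (ring_mat TYPE(complex) n ())" by (rule det_non_zero_imp_unit)
  then have "mat_inverse M \<noteq> None" using mat_inverse(1)[OF M(1)] by metis
  then obtain B where "mat_inverse M = Some B" by blast
  then show "minv M \<in> carrier_mat n n" "M * minv M = 1\<^sub>m n" "minv M * M = 1\<^sub>m n"
    using mat_inverse(2)[OF M(1)] by auto
qed

lemma det_minv:
  assumes "M \<in> GL n"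
  shows "det (minv M) = inverse (det M)"
proof -
  have "det M * det (minv M) = 1"
    using minv[OF assms] GL_carrier[OF assms] by (metis Determinant.det_mult det_one)
  then show ?thesis by (simp add: inverse_unique)
qed

lemma minv_GL: "M \<in> GL n \<Longrightarrow> minv M \<in> GL n"
  using minv(1) det_minv by (auto simp: GL_iff_det)

lemma minv_unique:
  assumes "M \<in> GL n" "B \<in> carrier_mat n n" "M * B = 1\<^sub>m n"
  shows "minv M = B"
proof -
  have "minv M = minv M * (M * B)" using minv(1)[OF assms(1)] assms(3) by simp
  also have "\<dots> = minv M * M * B"
    using minv(1)[OF assms(1)] assms GL_carrier by (simp add: assoc_mult_mat[of _ n n _ n _ n])
  finally show ?thesis using minv(3)[OF assms(1)] assms(2) by simp
qed

text \<open>Cramer's rule. It exhibits the entries of the inverse as polynomials in the entries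
  divided by the determinant, which is why inversion preserves holomorphy.\<close>

lemma minv_adj_mat:
  assumes "M \<in> GL n"
  shows "minv M = inverse (det M) \<cdot>\<^sub>m adj_mat M"
proof (rule minv_unique[OF assms])
  have M: "M \<in> carrier_mat n n" "det M \<noteq> 0" using assms by (auto simp: GL_iff_det)
  then show "inverse (det M) \<cdot>\<^sub>m adj_mat M \<in> carrier_mat n n"
    "M * (inverse (det M) \<cdot>\<^sub>m adj_mat M) = 1\<^sub>m n"
    using adj_mat[OF M(1)] by (auto simp: mult_smult_distrib[of _ n n])
qed

lemma row_action_mult:
  fixes A :: "complex mat"
  assumes "A \<in> carrier_mat n n" "B \<in> carrier_mat n n" "v \<in> carrier_vec n"
  shows "(A * B)\<^sup>T *\<^sub>v v = B\<^sup>T *\<^sub>v (A\<^sup>T *\<^sub>v v)"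
  using assms by (simp add: transpose_mult[of A n n B n] assoc_mult_mat_vec[of _ n n])

lemma row_action_carrier:
  "A \<in> carrier_mat n n \<Longrightarrow> A\<^sup>T *\<^sub>v v \<in> carrier_vec n"
  by (simp add: mult_mat_vec_carrier[of _ n n] carrier_vecI)

lemma row_action_eqD:
  fixes M :: "complex mat"
  assumes "M \<in> carrier_mat n n" "N \<in> carrier_mat n n"
    and eq: "\<And>v. v \<in> carrier_vec n \<Longrightarrow> M\<^sup>T *\<^sub>v v = N\<^sup>T *\<^sub>v v"
  shows "M = N"
proof (rule eq_matI)
  fix i j assume ij: "i < dim_row N" "j < dim_col N"
  then have "(M\<^sup>T *\<^sub>v unit_vec n i) $ j = (N\<^sup>T *\<^sub>v unit_vec n i) $ j" using eq by simp
  then show "M $$ (i, j) = N $$ (i, j)" using assms(1,2) ij by (simp add: mult_mat_vec_def)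
qed (use assms in auto)

lemma mat_1_mult:
  "mat 1 1 (\<lambda>_. a) * mat 1 1 (\<lambda>_. b) = (mat 1 1 (\<lambda>_. a * b) :: complex mat)"
  by (rule eq_matI) (auto simp: scalar_prod_def)

lemma mat_1_GL: "mat 1 1 (\<lambda>_. a) \<in> GL 1 \<longleftrightarrow> a \<noteq> 0"
proof -
  have "det (mat 1 1 (\<lambda>_. a)) = a" by (subst det_single) auto
  then show ?thesis by (simp add: GL_iff_det)
qed

lemma permutes_less:
  assumes "p permutes {0..<n::nat}" "i < n" shows "p i < n"
  using permutes_in_image[OF assms(1), of i] assms(2) by simp

context riemann
begin

definition holomorphic_mat_at :: "nat \<Rightarrow> ('x \<Rightarrow> complex mat) \<Rightarrow> 'x \<Rightarrow> bool" where
  "holomorphic_mat_at n g x \<longleftrightarrow> (\<forall>k<n. \<forall>l<n. holomorphic_at S (\<lambda>y. g y $$ (k, l)) x)"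

lemma holomorphic_GL_iff:
  "holomorphic_GL S n N g \<longleftrightarrow> (\<forall>x\<in>N. g x \<in> GL n \<and> holomorphic_mat_at n g x)"
  by (auto simp: holomorphic_GL_def holomorphic_mat_at_def)

lemma holomorphic_mat_at_transform:
  assumes "holomorphic_mat_at n f x" "openin X N" "x \<in> N" "\<And>y. y \<in> N \<Longrightarrow> g y = f y"
  shows "holomorphic_mat_at n g x"
  unfolding holomorphic_mat_at_def
proof (intro allI impI)
  fix k l assume "k < n" "l < n"
  then have "holomorphic_at S (\<lambda>y. f y $$ (k, l)) x"
    using assms(1) by (simp add: holomorphic_mat_at_def)
  then show "holomorphic_at S (\<lambda>y. g y $$ (k, l)) x"
    by (rule holomorphic_at_transform[OF _ assms(2,3)]) (simp add: assms(4))
qed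

lemma holomorphic_mat_at_const: "holomorphic_mat_at n (\<lambda>_. M) x"
  by (simp add: holomorphic_mat_at_def holomorphic_at_const)

lemma holomorphic_mat_at_mult:
  assumes "holomorphic_mat_at n f x" "holomorphic_mat_at n g x" "openin X N" "x \<in> N"
    and c: "\<And>y. y \<in> N \<Longrightarrow> f y \<in> carrier_mat n n" "\<And>y. y \<in> N \<Longrightarrow> g y \<in> carrier_mat n n"
  shows "holomorphic_mat_at n (\<lambda>y. f y * g y) x"
  unfolding holomorphic_mat_at_def
proof (intro allI impI)
  fix k l assume kl: "k < n" "l < n"
  have "holomorphic_at S (\<lambda>y. \<Sum>i<n. f y $$ (k, i) * g y $$ (i, l)) x"
    using assms(1,2) kl
    by (intro holomorphic_at_sum holomorphic_at_mult) (auto simp: holomorphic_mat_at_def)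
  moreover have "(f y * g y) $$ (k, l) = (\<Sum>i<n. f y $$ (k, i) * g y $$ (i, l))" if "y \<in> N" for y
    using c(1)[OF that] c(2)[OF that] kl by (auto simp: scalar_prod_def lessThan_atLeast0)
  ultimately show "holomorphic_at S (\<lambda>y. (f y * g y) $$ (k, l)) x"
    by (rule holomorphic_at_transform[OF _ assms(3,4)])
qed

lemma holomorphic_at_det:
  assumes "holomorphic_mat_at n f x" "openin X N" "x \<in> N"
    and c: "\<And>y. y \<in> N \<Longrightarrow> f y \<in> carrier_mat n n"
  shows "holomorphic_at S (\<lambda>y. det (f y)) x"
proof -
  have "holomorphic_at S (\<lambda>y. \<Sum>p\<in>{p. p permutes {0..<n}}. signof p * (\<Prod>i = 0..<n. f y $$ (i, p i))) x"
    using assms(1)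
    by (intro holomorphic_at_sum holomorphic_at_mult holomorphic_at_prod holomorphic_at_const)
       (auto simp: holomorphic_mat_at_def dest: permutes_less)
  then show ?thesis
    by (rule holomorphic_at_transform[OF _ assms(2,3)]) (rule det_def'[OF c])
qed

lemma meromorphic_at_det:
  assumes "\<And>k l. k < n \<Longrightarrow> l < n \<Longrightarrow> meromorphic_at S (\<lambda>y. f y $$ (k, l)) x"
    and c: "\<And>y. f y \<in> carrier_mat n n"
  shows "meromorphic_at S (\<lambda>y. det (f y)) x"
  unfolding det_def'[OF c]
  using assms(1)
  by (intro meromorphic_at_sum meromorphic_at_mult meromorphic_at_prod meromorphic_at_const)
     (auto dest: permutes_less)

text \<open>Each entry of the inverse is a cofactor over the determinant, and a cofactor is up to
  sign the determinant of a minor, so holomorphy of determinants suffices.\<close>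

lemma holomorphic_mat_at_minv:
  assumes f: "holomorphic_mat_at n f x" and N: "openin X N" "x \<in> N"
    and c: "\<And>y. y \<in> N \<Longrightarrow> f y \<in> GL n"
  shows "holomorphic_mat_at n (\<lambda>y. minv (f y)) x"
proof -
  have fc: "f y \<in> carrier_mat n n" "det (f y) \<noteq> 0" if "y \<in> N" for y
    using c[OF that] by (auto simp: GL_iff_det)
  have d: "holomorphic_at S (\<lambda>y. det (f y)) x"
    by (rule holomorphic_at_det[OF f N]) (rule fc)
  have "holomorphic_mat_at n (\<lambda>y. inverse (det (f y)) \<cdot>\<^sub>m adj_mat (f y)) x"
    unfolding holomorphic_mat_at_def
  proof (intro allI impI)
    fix k l assume kl: "k < n" "l < n"
    \<comment> \<open>This minor deletes row \<open>l\<close> and column \<open>k\<close>: the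
      indices are interchanged because the adjugate is the transposed cofactor matrix.\<close>
    have "holomorphic_mat_at (n - 1) (\<lambda>y. mat (n - 1) (n - 1) (\<lambda>(i', j'). 
        f y $$ (if i' < l then i' else Suc i', if j' < k then j' else Suc j'))) x"
      using f kl unfolding holomorphic_mat_at_def by auto
    then have "holomorphic_at S (\<lambda>y. det (mat (n - 1) (n - 1) (\<lambda>(i', j'). 
        f y $$ (if i' < l then i' else Suc i', if j' < k then j' else Suc j')))) x"
      by (rule holomorphic_at_det[OF _ N]) simp
    then have "holomorphic_at S (\<lambda>y. (1 / det (f y)) * ((-1) ^ (l + k) *
        det (mat (n - 1) (n - 1) (\<lambda>(i', j'). 
        f y $$ (if i' < l then i' else Suc i', if j' < k then j' else Suc j'))))) x"
      using fc N(2) d by (intro holomorphic_at_mult holomorphic_at_const holomorphic_at_divide) auto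
    moreover have "(inverse (det (f y)) \<cdot>\<^sub>m adj_mat (f y)) $$ (k, l) =
       (1 / det (f y)) * ((-1) ^ (l + k) *
        det (mat (n - 1) (n - 1) (\<lambda>(i', j'). 
        f y $$ (if i' < l then i' else Suc i', if j' < k then j' else Suc j'))))" if "y \<in> N" for y
      using fc(1)[OF that] kl by (simp add: adj_mat_def cofactor_def mat_delete_def divide_inverse)
    ultimately show "holomorphic_at S (\<lambda>y. (inverse (det (f y)) \<cdot>\<^sub>m adj_mat (f y)) $$ (k, l)) x"
      by (rule holomorphic_at_transform[OF _ N])
  qed
  then show ?thesis
    by (rule holomorphic_mat_at_transform[OF _ N]) (rule minv_adj_mat[OF c])
qed

end

section \<open>Bundles glued from cocycles\<close>

text \<open>Inverse of the \<open>i\<close>-th local trivialization. Indices whose set misses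
  \<open>x\<close> receive \<open>undefined\<close>, as the total space of
  \<open>cocycle_bundle\<close> prescribes.\<close>

definition cocycle_point ::
    "'i set \<Rightarrow> ('i \<Rightarrow> 'x set) \<Rightarrow> ('i \<Rightarrow> 'i \<Rightarrow> 'x \<Rightarrow> complex mat) \<Rightarrow> 'i \<Rightarrow> 'x \<Rightarrow> complex vec
      \<Rightarrow> 'x \<times> ('i \<Rightarrow> complex vec)" where
  "cocycle_point I U \<Phi> i x v =
     (x, \<lambda>j. if j \<in> I \<and> x \<in> U j then (\<Phi> j i x)\<^sup>T *\<^sub>v v else undefined)"

lemma cocycle_bundle_proj: "proj (cocycle_bundle n I U \<Phi>) = fst"
  by (simp add: cocycle_bundle_def)

lemma cocycle_bundle_trivs: "trivs (cocycle_bundle n I U \<Phi>) = (\<lambda>i. (U i, \<lambda>e. snd e i)) ` I"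
  by (simp add: cocycle_bundle_def)

lemma cocycle_bundle_total:
  "e \<in> total (cocycle_bundle n I U \<Phi>) \<longleftrightarrow> fst e \<in> (\<Union>i\<in>I. U i) \<and>
     (\<forall>i\<in>I. fst e \<in> U i \<longrightarrow> snd e i \<in> carrier_vec n) \<and>
     (\<forall>i\<in>I. \<forall>j\<in>I. fst e \<in> U i \<inter> U j \<longrightarrow> snd e i = (\<Phi> i j (fst e))\<^sup>T *\<^sub>v snd e j) \<and>
     (\<forall>i. \<not> (i \<in> I \<and> fst e \<in> U i) \<longrightarrow> snd e i = undefined)"
  by (simp add: cocycle_bundle_def case_prod_beta)

context
  fixes S :: "'x surface" and n :: nat and I :: "'i set" and U \<Phi>
  assumes \<Phi>: "cocycle S n I U \<Phi>"
begin

lemma cocycle_GL: "i \<in> I \<Longrightarrow> j \<in> I \<Longrightarrow> x \<in> U i \<Longrightarrow> x \<in> U j \<Longrightarrow> \<Phi> i j x \<in> GL n"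
  using \<Phi> by (auto simp: cocycle_def holomorphic_GL_def)

lemma cocycle_mult:
  "i \<in> I \<Longrightarrow> j \<in> I \<Longrightarrow> k \<in> I \<Longrightarrow> x \<in> U i \<Longrightarrow> x \<in> U j \<Longrightarrow> x \<in> U k \<Longrightarrow> \<Phi> j k x * \<Phi> i j x = \<Phi> i k x"
  using \<Phi> by (auto simp: cocycle_def)

text \<open>The cocycle identity with three equal indices makes \<Phi>_ii idempotent, and an
  invertible idempotent is the identity.\<close>

lemma cocycle_refl:
  assumes "i \<in> I" "x \<in> U i" shows "\<Phi> i i x = 1\<^sub>m n"
proof -
  have G: "\<Phi> i i x \<in> GL n" and m: "\<Phi> i i x * \<Phi> i i x = \<Phi> i i x"
    using cocycle_GL cocycle_mult assms by auto
  have "\<Phi> i i x = (minv (\<Phi> i i x) * \<Phi> i i x) * \<Phi> i i x"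
    using minv[OF G] GL_carrier[OF G] by simp
  also have "\<dots> = minv (\<Phi> i i x) * (\<Phi> i i x * \<Phi> i i x)"
    by (rule assoc_mult_mat[OF minv(1)[OF G] GL_carrier[OF G] GL_carrier[OF G]])
  finally show ?thesis using m minv[OF G] by simp
qed

text \<open>The family is spread out from the index \<open>i\<close>; its compatibility at
  \<open>j\<close> and \<open>k\<close> is the cocycle identity for the triple j, k, i.\<close>

lemma cocycle_point_total:
  assumes "i \<in> I" "x \<in> U i" "v \<in> carrier_vec n"
  shows "cocycle_point I U \<Phi> i x v \<in> total (cocycle_bundle n I U \<Phi>)" "snd (cocycle_point I U \<Phi> i x v) i = v"
proof -
  have 1: "(\<Phi> j i x)\<^sup>T *\<^sub>v v = (\<Phi> j k x)\<^sup>T *\<^sub>v ((\<Phi> k i x)\<^sup>T *\<^sub>v v)"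
    if "j \<in> I" "x \<in> U j" "k \<in> I" "x \<in> U k" for j k
    using row_action_mult[of "\<Phi> k i x" n "\<Phi> j k x" v] cocycle_mult[of j k i x]
      GL_carrier[OF cocycle_GL] assms that by simp
  have 2: "(\<Phi> j i x)\<^sup>T *\<^sub>v v \<in> carrier_vec n" if "j \<in> I" "x \<in> U j" for j
    by (rule row_action_carrier[OF GL_carrier[OF cocycle_GL[OF that(1) assms(1) that(2) assms(2)]]])
  define e where "e = cocycle_point I U \<Phi> i x v"
  have e: "fst e = x" "\<And>j. snd e j = (if j \<in> I \<and> x \<in> U j then (\<Phi> j i x)\<^sup>T *\<^sub>v v else undefined)"
    by (simp_all add: e_def cocycle_point_def)
  have ej: "snd e j = (\<Phi> j i x)\<^sup>T *\<^sub>v v" if "j \<in> I" "x \<in> U j" for j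
    using e(2) that by simp
  have 3: "snd e j = (\<Phi> j k x)\<^sup>T *\<^sub>v snd e k" if "j \<in> I" "k \<in> I" "x \<in> U j" "x \<in> U k" for j k
    unfolding ej[OF that(1,3)] ej[OF that(2,4)] by (rule 1[OF that(1,3,2,4)])
  have "e \<in> total (cocycle_bundle n I U \<Phi>)"
    unfolding cocycle_bundle_total e(1)
  proof (intro conjI ballI allI impI)
    show "x \<in> (\<Union>i\<in>I. U i)" using assms by blast
    show "snd e j \<in> carrier_vec n" if "j \<in> I" "x \<in> U j" for j
      unfolding ej[OF that] by (rule 2[OF that])
    show "snd e j = (\<Phi> j k x)\<^sup>T *\<^sub>v snd e k" if "j \<in> I" "k \<in> I" "x \<in> U j \<inter> U k" for j k
      using 3[OF that(1,2)] that(3) by blast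
    show "snd e j = undefined" if "\<not> (j \<in> I \<and> x \<in> U j)" for j
      unfolding e(2) using that by (rule if_not_P)
  qed
  then show "cocycle_point I U \<Phi> i x v \<in> total (cocycle_bundle n I U \<Phi>)" by (simp add: e_def)
  show "snd (cocycle_point I U \<Phi> i x v) i = v"
    using assms cocycle_refl by (simp add: cocycle_point_def)
qed

lemma cocycle_bundle_carrier:
  "e \<in> total (cocycle_bundle n I U \<Phi>) \<Longrightarrow> i \<in> I \<Longrightarrow> fst e \<in> U i \<Longrightarrow> snd e i \<in> carrier_vec n"
  unfolding cocycle_bundle_total by blast

lemma cocycle_bundle_change:
  "e \<in> total (cocycle_bundle n I U \<Phi>) \<Longrightarrow> i \<in> I \<Longrightarrow> j \<in> I \<Longrightarrow> fst e \<in> U i \<Longrightarrow> fst e \<in> U j \<Longrightarrow> snd e i = (\<Phi> i j (fst e))\<^sup>T *\<^sub>v snd e j"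
  unfolding cocycle_bundle_total by blast

text \<open>One coordinate determines the others through the transition matrices, and the fixed
  value \<open>undefined\<close> at all remaining indices excludes different representatives of the
  same point.\<close>

lemma cocycle_bundle_eqI:
  assumes "e \<in> total (cocycle_bundle n I U \<Phi>)" "e' \<in> total (cocycle_bundle n I U \<Phi>)" "fst e = fst e'" "i \<in> I" "fst e \<in> U i" "snd e i = snd e' i"
  shows "e = e'"
proof -
  have "snd e j = snd e' j" for j
  proof (cases "j \<in> I \<and> fst e \<in> U j")
    case True
    then show ?thesis
      using cocycle_bundle_change[OF assms(1), of j i] cocycle_bundle_change[OF assms(2), of j i] assms(3-6)
      by simp
  next
    case False
    then show ?thesis using assms(1-3) unfolding cocycle_bundle_total by metis
  qed
  then show ?thesis using assms(3) by (simp add: prod_eq_iff ext)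
qed

lemma cocycle_bundle_holomorphic: "holomorphic_vector_bundle S n (cocycle_bundle n I U \<Phi>)"
proof -
  have U: "\<And>i. i \<in> I \<Longrightarrow> openin (surf_top S) (U i)" "(\<Union>i\<in>I. U i) = topspace (surf_top S)"
    using \<Phi> by (auto simp: cocycle_def)
  have "local_trivialization S n (cocycle_bundle n I U \<Phi>) (U i) (\<lambda>e. snd e i)" if i: "i \<in> I" for i
    unfolding local_trivialization_def cocycle_bundle_proj
  proof (intro conjI)
    show "bij_betw (\<lambda>e. (fst e, snd e i)) {e \<in> total (cocycle_bundle n I U \<Phi>). fst e \<in> U i} (U i \<times> carrier_vec n)"
    proof (rule bij_betw_imageI)
      show "inj_on (\<lambda>e. (fst e, snd e i)) {e \<in> total (cocycle_bundle n I U \<Phi>). fst e \<in> U i}"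
      proof (rule inj_onI)
        fix e e' assume "e \<in> {e \<in> total (cocycle_bundle n I U \<Phi>). fst e \<in> U i}" "e' \<in> {e \<in> total (cocycle_bundle n I U \<Phi>). fst e \<in> U i}"
          "(fst e, snd e i) = (fst e', snd e' i)"
        then show "e = e'" by (intro cocycle_bundle_eqI[OF _ _ _ i]) auto
      qed
      show "(\<lambda>e. (fst e, snd e i)) ` {e \<in> total (cocycle_bundle n I U \<Phi>). fst e \<in> U i} = U i \<times> carrier_vec n"
      proof (intro equalityI subsetI)
        fix p assume "p \<in> (\<lambda>e. (fst e, snd e i)) ` {e \<in> total (cocycle_bundle n I U \<Phi>). fst e \<in> U i}"
        then show "p \<in> U i \<times> carrier_vec n" using cocycle_bundle_carrier[OF _ i] by blast
      next
        fix p :: "'x \<times> complex vec" assume p: "p \<in> U i \<times> carrier_vec n"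
        have "fst (cocycle_point I U \<Phi> i (fst p) (snd p)) = fst p"
          by (simp add: cocycle_point_def)
        then show "p \<in> (\<lambda>e. (fst e, snd e i)) ` {e \<in> total (cocycle_bundle n I U \<Phi>). fst e \<in> U i}"
          using p cocycle_point_total[OF i, of "fst p" "snd p"]
          by (intro image_eqI[of _ _ "cocycle_point I U \<Phi> i (fst p) (snd p)"]) auto
      qed
    qed
    have "\<exists>g. holomorphic_GL S n (U i \<inter> U j) g \<and>
      (\<forall>e\<in>total (cocycle_bundle n I U \<Phi>). fst e \<in> U i \<inter> U j \<longrightarrow> snd e i = (g (fst e))\<^sup>T *\<^sub>v snd e j)" if j: "j \<in> I" for j
    proof (intro exI[of _ "\<Phi> i j"] conjI ballI impI)
      show "holomorphic_GL S n (U i \<inter> U j) (\<Phi> i j)" using \<Phi> i j by (simp add: cocycle_def)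
    qed (use cocycle_bundle_change[OF _ i j] in blast)
    then show "\<forall>(W, \<chi>)\<in>trivs (cocycle_bundle n I U \<Phi>). \<exists>g. holomorphic_GL S n (U i \<inter> W) g \<and>
        (\<forall>e\<in>total (cocycle_bundle n I U \<Phi>). fst e \<in> U i \<inter> W \<longrightarrow> snd e i = (g (fst e))\<^sup>T *\<^sub>v \<chi> e)"
      unfolding cocycle_bundle_trivs by simp
  qed (use U i in auto)
  moreover have "fst ` total (cocycle_bundle n I U \<Phi>) \<subseteq> topspace (surf_top S)"
    unfolding U(2)[symmetric] using cocycle_bundle_total by blast
  ultimately show ?thesis
    using U(2) unfolding holomorphic_vector_bundle_def cocycle_bundle_trivs cocycle_bundle_proj by simp
qed

text \<open>Uniqueness in the definite description holds because every vector occurs as the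
  \<open>j\<close>-th coordinate of some point over \<open>x\<close>.\<close>

lemma transition_matrix_cocycle_bundle:
  assumes "i \<in> I" "j \<in> I" "x \<in> U i" "x \<in> U j"
  shows "transition_matrix n (cocycle_bundle n I U \<Phi>) (\<lambda>e. snd e i) (\<lambda>e. snd e j) x = \<Phi> i j x"
  unfolding transition_matrix_def
proof (rule the_equality)
  show "\<Phi> i j x \<in> carrier_mat n n \<and> (\<forall>e\<in>total (cocycle_bundle n I U \<Phi>). proj (cocycle_bundle n I U \<Phi>) e = x \<longrightarrow> snd e i = (\<Phi> i j x)\<^sup>T *\<^sub>v snd e j)"
    using cocycle_bundle_change[OF _ assms(1,2)] GL_carrier[OF cocycle_GL[OF assms]] assms(3,4)
    by (simp add: cocycle_bundle_proj)
next
  fix M assume M: "M \<in> carrier_mat n n \<and> (\<forall>e\<in>total (cocycle_bundle n I U \<Phi>). proj (cocycle_bundle n I U \<Phi>) e = x \<longrightarrow> snd e i = M\<^sup>T *\<^sub>v snd e j)"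
  show "M = \<Phi> i j x"
  proof (rule row_action_eqD[of _ n])
    fix v :: "complex vec" assume v: "v \<in> carrier_vec n"
    define e where "e = cocycle_point I U \<Phi> j x v"
    have e: "e \<in> total (cocycle_bundle n I U \<Phi>)" "snd e j = v" "proj (cocycle_bundle n I U \<Phi>) e = x" "fst e = x"
      using cocycle_point_total[OF assms(2,4) v] by (simp_all add: e_def cocycle_point_def cocycle_bundle_proj)
    then show "M\<^sup>T *\<^sub>v v = (\<Phi> i j x)\<^sup>T *\<^sub>v v"
      using M cocycle_bundle_change[OF e(1) assms(1,2)] assms(3,4) by metis
  qed (use M GL_carrier[OF cocycle_GL] assms in auto)
qed

end

text \<open>The isomorphism sends (s_i) to the family t_j = s_i g_ij. The relation with \<Phi> makes
  s_i g_ij independent of \<open>i\<close>, the relation with \<Psi> makes the t_j compatible. The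
  comparison takes place on the intersections of the two covers, without passing to a common
  refinement.\<close>

lemma cocycle_bundle_iso:
  assumes \<Phi>: "cocycle S n I U \<Phi>" and \<Psi>: "cocycle S n J W \<Psi>"
    and g: "\<And>i j. i \<in> I \<Longrightarrow> j \<in> J \<Longrightarrow> holomorphic_GL S n (U i \<inter> W j) (g i j)"
    and g\<Phi>: "\<And>i i' j x. i \<in> I \<Longrightarrow> i' \<in> I \<Longrightarrow> j \<in> J \<Longrightarrow> x \<in> U i \<inter> U i' \<inter> W j \<Longrightarrow> g i' j x = \<Phi> i i' x * g i j x"
    and g\<Psi>: "\<And>i j j' x. i \<in> I \<Longrightarrow> j \<in> J \<Longrightarrow> j' \<in> J \<Longrightarrow> x \<in> U i \<inter> W j \<inter> W j' \<Longrightarrow> g i j x = g i j' x * \<Psi> j j' x"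
  shows "bundle_iso S n (cocycle_bundle n I U \<Phi>) (cocycle_bundle n J W \<Psi>)"
proof -
  let ?E = "cocycle_bundle n I U \<Phi>" and ?F = "cocycle_bundle n J W \<Psi>"
  \<comment> \<open>One index per point and per cover is chosen to obtain a map on the whole total
    space; \<open>h_snd\<close> then shows that every other choice gives the same formula.\<close>
  define ii where "ii x = (SOME i. i \<in> I \<and> x \<in> U i)" for x
  define jj where "jj x = (SOME j. j \<in> J \<and> x \<in> W j)" for x
  have ii: "ii x \<in> I" "x \<in> U (ii x)" if "x \<in> topspace (surf_top S)" for x
  proof -
    have "\<exists>i. i \<in> I \<and> x \<in> U i" using that \<Phi> unfolding cocycle_def by blast
    from someI_ex[OF this] show "ii x \<in> I" "x \<in> U (ii x)" by (auto simp: ii_def)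
  qed
  have jj: "jj x \<in> J" "x \<in> W (jj x)" if "x \<in> topspace (surf_top S)" for x
  proof -
    have "\<exists>i. i \<in> J \<and> x \<in> W i" using that \<Psi> unfolding cocycle_def by blast
    from someI_ex[OF this] show "jj x \<in> J" "x \<in> W (jj x)" by (auto simp: jj_def)
  qed
  have top: "fst e \<in> topspace (surf_top S)" if "e \<in> total ?E" for e
    using that \<Phi> unfolding cocycle_bundle_total cocycle_def by blast
  have topF: "fst e \<in> topspace (surf_top S)" if "e \<in> total ?F" for e
    using that \<Psi> unfolding cocycle_bundle_total cocycle_def by blast
  have gGL: "g i j x \<in> GL n" if "i \<in> I" "j \<in> J" "x \<in> U i" "x \<in> W j" for i j x
    using g[OF that(1,2)] that by (simp add: holomorphic_GL_def)
  define h where "h e = cocycle_point J W \<Psi> (jj (fst e)) (fst e)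
      ((g (ii (fst e)) (jj (fst e)) (fst e))\<^sup>T *\<^sub>v snd e (ii (fst e)))" for e
  have h_total: "h e \<in> total ?F" and h_fst: "fst (h e) = fst e"
    and h_snd: "\<And>i j. i \<in> I \<Longrightarrow> j \<in> J \<Longrightarrow> fst e \<in> U i \<Longrightarrow> fst e \<in> W j \<Longrightarrow>
        snd (h e) j = (g i j (fst e))\<^sup>T *\<^sub>v snd e i" if e: "e \<in> total ?E" for e
  proof -
    let ?x = "fst e" let ?i = "ii ?x" let ?j = "jj ?x"
    note x = ii[OF top[OF e]] jj[OF top[OF e]]
    have c: "(g ?i ?j ?x)\<^sup>T *\<^sub>v snd e ?i \<in> carrier_vec n"
      using row_action_carrier GL_carrier[OF gGL] x by blast
    show ht: "h e \<in> total ?F" unfolding h_def using cocycle_point_total(1)[OF \<Psi> x(3,4) c] .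
    show hf: "fst (h e) = ?x" by (simp add: h_def cocycle_point_def)
    fix i j assume ij: "i \<in> I" "j \<in> J" "?x \<in> U i" "?x \<in> W j"
    have "snd (h e) j = (\<Psi> j ?j ?x)\<^sup>T *\<^sub>v snd (h e) ?j"
      using cocycle_bundle_change[OF \<Psi> ht ij(2) x(3)] hf ij x by simp
    also have "snd (h e) ?j = (g ?i ?j ?x)\<^sup>T *\<^sub>v snd e ?i"
      unfolding h_def using cocycle_point_total(2)[OF \<Psi> x(3,4) c] .
    also have "snd e ?i = (\<Phi> ?i i ?x)\<^sup>T *\<^sub>v snd e i"
      using cocycle_bundle_change[OF \<Phi> e x(1) ij(1)] ij x by simp
    also have "(g ?i ?j ?x)\<^sup>T *\<^sub>v ((\<Phi> ?i i ?x)\<^sup>T *\<^sub>v snd e i) = (\<Phi> ?i i ?x * g ?i ?j ?x)\<^sup>T *\<^sub>v snd e i"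
      using row_action_mult[of "\<Phi> ?i i ?x" n "g ?i ?j ?x" "snd e i"] x ij GL_carrier[OF gGL]
        GL_carrier[OF cocycle_GL[OF \<Phi>]] cocycle_bundle_carrier[OF \<Phi> e] by simp
    also have "\<Phi> ?i i ?x * g ?i ?j ?x = g i ?j ?x" using g\<Phi>[of ?i i ?j ?x] x ij by simp
    also have "(\<Psi> j ?j ?x)\<^sup>T *\<^sub>v ((g i ?j ?x)\<^sup>T *\<^sub>v snd e i) = (g i ?j ?x * \<Psi> j ?j ?x)\<^sup>T *\<^sub>v snd e i"
      using row_action_mult[of "g i ?j ?x" n "\<Psi> j ?j ?x" "snd e i"] x ij GL_carrier[OF gGL]
        GL_carrier[OF cocycle_GL[OF \<Psi>]] cocycle_bundle_carrier[OF \<Phi> e] by simp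
    also have "g i ?j ?x * \<Psi> j ?j ?x = g i j ?x" using g\<Psi>[of i j ?j ?x] x ij by simp
    finally show "snd (h e) j = (g i j ?x)\<^sup>T *\<^sub>v snd e i" .
  qed
  have "bij_betw h (total ?E) (total ?F)"
  proof (rule bij_betw_imageI)
    show "inj_on h (total ?E)"
    proof (rule inj_onI)
      fix e e' assume e: "e \<in> total ?E" "e' \<in> total ?E" "h e = h e'"
      have x: "fst e = fst e'" using h_fst[OF e(1)] h_fst[OF e(2)] e(3) by simp
      let ?x = "fst e" let ?i = "ii ?x" let ?j = "jj ?x"
      note i = ii[OF top[OF e(1)]] and j = jj[OF top[OF e(1)]]
      have G: "g ?i ?j ?x \<in> GL n" using gGL i j by blast
      have c: "snd e ?i \<in> carrier_vec n" "snd e' ?i \<in> carrier_vec n"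
        using cocycle_bundle_carrier[OF \<Phi>] e i x by auto
      have eq: "(g ?i ?j ?x)\<^sup>T *\<^sub>v snd e ?i = (g ?i ?j ?x)\<^sup>T *\<^sub>v snd e' ?i"
        using h_snd[OF e(1) i(1) j(1) i(2) j(2)] h_snd[OF e(2) i(1) j(1)] i j e(3) x by simp
      have "v = (minv (g ?i ?j ?x))\<^sup>T *\<^sub>v ((g ?i ?j ?x)\<^sup>T *\<^sub>v v)" if "v \<in> carrier_vec n" for v
        using row_action_mult[of "g ?i ?j ?x" n "minv (g ?i ?j ?x)" v] minv[OF G] GL_carrier[OF G] that by simp
      then have "snd e ?i = snd e' ?i" using eq c by metis
      then show "e = e'" using cocycle_bundle_eqI[OF \<Phi> e(1,2) x i] by simp
    qed
    show "h ` total ?E = total ?F"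
    proof (intro equalityI subsetI)
      fix f assume f: "f \<in> total ?F"
      let ?x = "fst f" let ?i = "ii ?x" let ?j = "jj ?x"
      note i = ii[OF topF[OF f]] and j = jj[OF topF[OF f]]
      have G: "g ?i ?j ?x \<in> GL n" using gGL i j by blast
      \<comment> \<open>The preimage of \<open>f\<close> is found by undoing \<open>g\<close> at the
        chosen pair of indices.\<close>
      define v where "v = (minv (g ?i ?j ?x))\<^sup>T *\<^sub>v snd f ?j"
      have v: "v \<in> carrier_vec n" unfolding v_def using row_action_carrier minv[OF G] by blast
      define e where "e = cocycle_point I U \<Phi> ?i ?x v"
      have e: "e \<in> total ?E" "snd e ?i = v" "fst e = ?x"
        using cocycle_point_total[OF \<Phi> i v] by (auto simp: e_def cocycle_point_def)
      have "snd (h e) ?j = (g ?i ?j ?x)\<^sup>T *\<^sub>v v" using h_snd[OF e(1) i(1) j(1)] i j e by simp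
      also have "\<dots> = snd f ?j"
        using row_action_mult[of "minv (g ?i ?j ?x)" n "g ?i ?j ?x" "snd f ?j"] minv[OF G] GL_carrier[OF G]
          cocycle_bundle_carrier[OF \<Psi> f j] by (simp add: v_def)
      finally have "h e = f"
        using cocycle_bundle_eqI[OF \<Psi> h_total[OF e(1)] f] h_fst[OF e(1)] e(3) j by simp
      then show "f \<in> h ` total ?E" using e(1) by blast
    qed (use h_total in auto)
  qed
  moreover have "\<exists>g'. holomorphic_GL S n (U i \<inter> W j) g' \<and>
      (\<forall>e\<in>total ?E. fst e \<in> U i \<inter> W j \<longrightarrow> snd (h e) j = (g' (fst e))\<^sup>T *\<^sub>v snd e i)"
    if "i \<in> I" "j \<in> J" for i j
    using g[OF that] h_snd that by (intro exI[of _ "g i j"]) auto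
  ultimately show ?thesis
    unfolding bundle_iso_def cocycle_bundle_proj cocycle_bundle_trivs using h_fst
    by (intro exI[of _ h]) simp
qed

text \<open>The cocycle of \<open>det_bundle\<close> is indexed by trivializations and uses their
  transition matrices; rewritten over \<open>I\<close> these are the \<Phi>_ij, and multiplicativity
  of the determinant does the rest.\<close>

lemma det_cocycle:
  assumes "riemann_surface S" and \<Phi>: "cocycle S n I U \<Phi>"
  shows "cocycle S 1 (trivs (cocycle_bundle n I U \<Phi>)) fst
     (\<lambda>(U', \<psi>) (W, \<chi>) x. mat 1 1 (\<lambda>_. det (transition_matrix n (cocycle_bundle n I U \<Phi>) \<psi> \<chi> x)))"
proof -
  interpret riemann S by standard fact
  have U: "\<And>i. i \<in> I \<Longrightarrow> openin (surf_top S) (U i)" "(\<Union>i\<in>I. U i) = topspace (surf_top S)"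
    using \<Phi> by (auto simp: cocycle_def)
  let ?E = "cocycle_bundle n I U \<Phi>"
  let ?D = "\<lambda>i j x. mat 1 1 (\<lambda>_. det (transition_matrix n ?E (\<lambda>e. snd e i) (\<lambda>e. snd e j) x))"
  have D: "?D i j x = mat 1 1 (\<lambda>_. det (\<Phi> i j x))"
    if "i \<in> I" "j \<in> I" "x \<in> U i" "x \<in> U j" for i j x
    using transition_matrix_cocycle_bundle[OF \<Phi> that] by simp
  have 1: "holomorphic_GL S 1 (U i \<inter> U j) (?D i j)" if ij: "i \<in> I" "j \<in> I" for i j
    unfolding holomorphic_GL_iff
  proof
    fix x assume x: "x \<in> U i \<inter> U j"
    have o: "openin X (U i \<inter> U j)" using U ij by auto
    have "?D i j x \<in> GL 1"
      using D[OF ij] x cocycle_GL[OF \<Phi> ij] by (simp add: mat_1_GL[simplified] GL_iff_det[of _ n])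
    moreover have "holomorphic_at S (\<lambda>y. det (\<Phi> i j y)) x"
      using \<Phi> ij x o GL_carrier[OF cocycle_GL[OF \<Phi> ij]]
      by (intro holomorphic_at_det[of n _ _ "U i \<inter> U j"]) (auto simp: cocycle_def holomorphic_GL_iff)
    then have "holomorphic_mat_at 1 (\<lambda>y. mat 1 1 (\<lambda>_. det (\<Phi> i j y))) x"
      by (simp add: holomorphic_mat_at_def)
    then have "holomorphic_mat_at 1 (?D i j) x"
      by (rule holomorphic_mat_at_transform[OF _ o x]) (use D[OF ij] in simp)
    ultimately show "?D i j x \<in> GL 1 \<and> holomorphic_mat_at 1 (?D i j) x" by blast
  qed
  have 2: "?D j k x * ?D i j x = ?D i k x"
    if "i \<in> I" "j \<in> I" "k \<in> I" "x \<in> U i" "x \<in> U j" "x \<in> U k" for i j k x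
  proof -
    have c: "\<Phi> j k x \<in> carrier_mat n n" "\<Phi> i j x \<in> carrier_mat n n"
      using GL_carrier[OF cocycle_GL[OF \<Phi>]] that by auto
    show ?thesis
      unfolding D[OF that(1,2,4,5)] D[OF that(2,3,5,6)] D[OF that(1,3,4,6)] mat_1_mult
        Determinant.det_mult[OF c, symmetric] cocycle_mult[OF \<Phi> that] ..
  qed
  show ?thesis
    unfolding cocycle_def cocycle_bundle_trivs using U 1 2 by simp
qed

section \<open>Wronskians under a change of coordinate and frame\<close>

text \<open>The coefficients in \<open>(l (f \<circ> \<phi>))\<^sup>(\<^sup>k\<^sup>) = \<Sum>\<^sub>j c\<^sub>k\<^sub>j (f\<^sup>(\<^sup>j\<^sup>) \<circ> \<phi>)\<close>.\<close>

fun chain_coeff :: "(complex \<Rightarrow> complex) \<Rightarrow> (complex \<Rightarrow> complex) \<Rightarrow> nat \<Rightarrow> nat \<Rightarrow> complex \<Rightarrow> complex" where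
  "chain_coeff l \<phi> 0 j = (if j = 0 then l else (\<lambda>_. 0))"
| "chain_coeff l \<phi> (Suc k) j = (\<lambda>t. deriv (chain_coeff l \<phi> k j) t +
     (if j = 0 then 0 else chain_coeff l \<phi> k (j - 1) t * deriv \<phi> t))"

text \<open>Differentiating \<open>k\<close> times produces derivatives of \<open>f\<close> of order
  at most \<open>k\<close>. This is the triangularity that turns the determinant of the left factor
  into the product of its diagonal.\<close>

lemma chain_coeff_above: "k < j \<Longrightarrow> chain_coeff l \<phi> k j = (\<lambda>_. 0)"
  by (induction k arbitrary: j) auto

lemma chain_coeff_diag: "chain_coeff l \<phi> k k t = l t * deriv \<phi> t ^ k"
  by (induction k) (auto simp: chain_coeff_above)

lemma chain_coeff_holomorphic:
  assumes "l holomorphic_on D" "\<phi> holomorphic_on D" "open D"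
  shows "chain_coeff l \<phi> k j holomorphic_on D"
proof (induction k arbitrary: j)
  case (Suc k)
  have "(\<lambda>t. if j = 0 then 0 else chain_coeff l \<phi> k (j - 1) t * deriv \<phi> t) holomorphic_on D"
    using Suc assms by (cases "j = 0") (auto intro!: holomorphic_on_mult holomorphic_deriv)
  then show ?case unfolding chain_coeff.simps
    by (intro holomorphic_on_add holomorphic_deriv Suc assms)
qed (use assms in auto)

text \<open>The induction step differentiates the formula, so it is needed on a neighbourhood of
  \<open>t\<close>; hence the generalization over \<open>t\<close>. The bound \<open>m\<close> is
  kept apart from \<open>k\<close> so that all rows of a matrix share one range of
  summation.\<close>

lemma higher_deriv_chain_coeff:
  assumes hol: "l holomorphic_on D" "\<phi> holomorphic_on D" "open D"
  shows "k < m \<Longrightarrow> t \<in> D \<Longrightarrow> f analytic_on {\<phi> t} \<Longrightarrow>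
    (deriv ^^ k) (\<lambda>t. l t * f (\<phi> t)) t = (\<Sum>j<m. chain_coeff l \<phi> k j t * (deriv ^^ j) f (\<phi> t))"
proof (induction k arbitrary: t)
  case 0
  then obtain m' where m': "m = Suc m'" by (cases m) auto
  show ?case unfolding m' sum.lessThan_Suc_shift by simp
next
  case (Suc k)
  obtain m' where m': "m = Suc m'" using Suc.prems(1) by (cases m) auto
  let ?c = "chain_coeff l \<phi>"
  obtain E where E: "open E" "\<phi> t \<in> E" "f holomorphic_on E"
    using Suc.prems(3) by (auto simp: analytic_at)
  have "continuous_on D \<phi>" using hol(2) by (rule holomorphic_on_imp_continuous_on)
  then have "open (D \<inter> \<phi> -` E)" using hol(3) E(1) by (simp add: continuous_on_open_vimage Int_commute)
  then have "eventually (\<lambda>t'. t' \<in> D \<inter> \<phi> -` E) (nhds t)"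
    using Suc.prems(2) E(2) by (intro eventually_nhds_in_open) auto
  then have "eventually (\<lambda>t'. (deriv ^^ k) (\<lambda>t. l t * f (\<phi> t)) t' =
      (\<Sum>j<m. ?c k j t' * (deriv ^^ j) f (\<phi> t'))) (nhds t)"
  proof eventually_elim
    case (elim t')
    then have "f analytic_on {\<phi> t'}" using E by (auto simp: analytic_at)
    then show ?case using Suc.IH[of t'] Suc.prems(1) elim by simp
  qed
  then have "deriv ((deriv ^^ k) (\<lambda>t. l t * f (\<phi> t))) t =
      deriv (\<lambda>t'. \<Sum>j<m. ?c k j t' * (deriv ^^ j) f (\<phi> t')) t"
    by (rule deriv_cong_ev) simp
  also have "\<dots> = (\<Sum>j<m. deriv (?c k j) t * (deriv ^^ j) f (\<phi> t) +
      ?c k j t * ((deriv ^^ Suc j) f (\<phi> t) * deriv \<phi> t))"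
  proof (rule DERIV_imp_deriv, rule DERIV_sum)
    fix j
    have 1: "(?c k j has_field_derivative deriv (?c k j) t) (at t)"
      using holomorphic_derivI[OF chain_coeff_holomorphic[OF hol] hol(3) Suc.prems(2)] .
    have 2: "(\<phi> has_field_derivative deriv \<phi> t) (at t)"
      using holomorphic_derivI[OF hol(2,3) Suc.prems(2)] .
    have 3: "((deriv ^^ j) f has_field_derivative (deriv ^^ Suc j) f (\<phi> t)) (at (\<phi> t))"
      using has_field_derivative_higher_deriv[OF E(3,1,2)] .
    show "((\<lambda>t'. ?c k j t' * (deriv ^^ j) f (\<phi> t')) has_field_derivative
        deriv (?c k j) t * (deriv ^^ j) f (\<phi> t) + ?c k j t * ((deriv ^^ Suc j) f (\<phi> t) * deriv \<phi> t)) (at t)"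
      using DERIV_mult[OF 1 DERIV_chain2[OF 3 2]] by (simp add: algebra_simps)
  qed
  also have "\<dots> = (\<Sum>j<m. deriv (?c k j) t * (deriv ^^ j) f (\<phi> t)) +
      (\<Sum>j<m. ?c k j t * deriv \<phi> t * (deriv ^^ Suc j) f (\<phi> t))"
    by (simp add: sum.distrib algebra_simps)
  also have "(\<Sum>j<m. ?c k j t * deriv \<phi> t * (deriv ^^ Suc j) f (\<phi> t)) =
      (\<Sum>j<m. (if j = 0 then 0 else ?c k (j - 1) t * deriv \<phi> t) * (deriv ^^ j) f (\<phi> t))"
  proof -
    \<comment> \<open>Shifting the index would push the last summand to index \<open>m\<close>,
      outside the range; it vanishes since \<open>k < m'\<close>.\<close>
    have "?c k m' = (\<lambda>_. 0)" using Suc.prems(1) m' by (intro chain_coeff_above) simp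
    then show ?thesis unfolding m' sum.lessThan_Suc_shift[where n = m' and g = "\<lambda>j. (if j = 0 then _ else _ j) * _ j"]
      by (simp del: funpow.simps)
  qed
  also have "(\<Sum>j<m. deriv (?c k j) t * (deriv ^^ j) f (\<phi> t)) + \<dots> =
      (\<Sum>j<m. ?c (Suc k) j t * (deriv ^^ j) f (\<phi> t))"
    unfolding sum.distrib[symmetric] by (rule sum.cong) (auto simp: algebra_simps)
  finally show ?case by simp
qed

lemma higher_deriv_linear_combination:
  assumes "finite J" "\<And>j. j \<in> J \<Longrightarrow> f j analytic_on {t}"
  shows "(deriv ^^ k) (\<lambda>t. \<Sum>j\<in>J. a j * f j t) t = (\<Sum>j\<in>J. a j * (deriv ^^ k) (f j) t)"
  using assms
proof (induction J rule: finite_induct)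
  case (insert i J)
  have "(deriv ^^ k) (\<lambda>t. a i * f i t + (\<Sum>j\<in>J. a j * f j t)) t =
      (deriv ^^ k) (\<lambda>t. a i * f i t) t + (deriv ^^ k) (\<lambda>t. \<Sum>j\<in>J. a j * f j t) t"
    using insert.prems by (intro higher_deriv_add_at analytic_intros) auto
  then show ?case using insert by (simp add: higher_deriv_cmult')
qed simp

abbreviation finv :: "('x, 'e) local_frame \<Rightarrow> complex \<Rightarrow> 'x" where
  "finv F \<equiv> inv_into (fdom F) (fcoord F)"

definition frame_component :: "('x \<Rightarrow> 'e) \<Rightarrow> ('x, 'e) local_frame \<Rightarrow> nat \<Rightarrow> 'x \<Rightarrow> complex" where
  "frame_component A F j = (\<lambda>y. vec_index (ftriv F (A y)) j)"

lemma wronskian_matrix_index: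
  "k < n \<Longrightarrow> j < n \<Longrightarrow> wronskian_matrix n A F x $$ (k, j) =
     (deriv ^^ k) (frame_component A F j \<circ> finv F) (fcoord F x)"
  by (simp add: wronskian_matrix_def frame_component_def o_def)

lemma wronskian_matrix_carrier [simp]: "wronskian_matrix n A F x \<in> carrier_mat n n"
  by (simp add: wronskian_matrix_def)

definition holomorphic_section_at ::
    "'x surface \<Rightarrow> nat \<Rightarrow> ('x \<Rightarrow> 'e) \<Rightarrow> ('x, 'e) local_frame \<Rightarrow> 'x \<Rightarrow> bool" where
  "holomorphic_section_at S n A F x \<longleftrightarrow> (\<forall>j<n. holomorphic_at S (frame_component A F j) x)"

context riemann
begin

text \<open>\<open>finv F\<close> inverts the coordinate only on the image of the domain, so an
  entry read on the surface and the derivative in the plane agree as germs.\<close>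

lemma wronskian_matrix_entry:
  assumes F: "coord (fdom F) (fcoord F)" "x \<in> fdom F" and kj: "k < n" "j < n"
  shows "eventually (\<lambda>t. (deriv ^^ k) (frame_component A F j \<circ> finv F) t =
      ((\<lambda>y. wronskian_matrix n A F y $$ (k, j)) \<circ> finv F) t) (nhds (fcoord F x))"
  using eventually_nhds_coordinate[OF F]
  by eventually_elim (auto simp: wronskian_matrix_index kj f_inv_into_f)

lemma wronskian_matrix_holomorphic:
  assumes F: "coord (fdom F) (fcoord F)" "x \<in> fdom F"
    and A: "holomorphic_section_at S n A F x"
  shows "holomorphic_mat_at n (wronskian_matrix n A F) x"
  unfolding holomorphic_mat_at_def
proof (intro allI impI)
  fix k j assume kj: "k < n" "j < n"
  have "(deriv ^^ k) (frame_component A F j \<circ> finv F) analytic_on {fcoord F x}"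
    using A kj holomorphic_at_iff[OF F] by (intro analytic_higher_deriv) (simp add: holomorphic_section_at_def)
  then show "holomorphic_at S (\<lambda>y. wronskian_matrix n A F y $$ (k, j)) x"
    unfolding holomorphic_at_iff[OF F] using analytic_at_cong[OF wronskian_matrix_entry[OF F kj] refl] by blast
qed

lemma wronskian_holomorphic:
  assumes F: "coord (fdom F) (fcoord F)" "x \<in> fdom F"
    and A: "holomorphic_section_at S n A F x"
  shows "holomorphic_at S (wronskian n A F) x"
  unfolding wronskian_def
  by (rule holomorphic_at_det[OF wronskian_matrix_holomorphic[OF assms] local_coordinateD(4)[OF F(1)] F(2)]) simp

lemma wronskian_meromorphic:
  assumes F: "coord (fdom F) (fcoord F)" "x \<in> fdom F"
    and A: "\<And>j. j < n \<Longrightarrow> meromorphic_at S (frame_component A F j) x"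
  shows "meromorphic_at S (wronskian n A F) x"
  unfolding wronskian_def
proof (rule meromorphic_at_det[where n = n])
  fix k j assume kj: "k < n" "j < n"
  have m: "(deriv ^^ k) (frame_component A F j \<circ> finv F) meromorphic_on {fcoord F x}"
    using A kj meromorphic_at_iff'[OF F] by (intro meromorphic_on_higher_deriv) simp
  show "meromorphic_at S (\<lambda>y. wronskian_matrix n A F y $$ (k, j)) x"
    unfolding meromorphic_at_iff'[OF F]
    by (rule iffD1[OF meromorphic_on_cong[OF _ refl] m])
      (use wronskian_matrix_entry[OF F kj] in \<open>simp add: eventually_nhds_conv_at\<close>)
qed simp

text \<open>The relation \<open>proj_flat_on\<close> with its witnesses \<open>l\<close> and
  \<open>T\<close> exposed, together with the two coordinates. Explicit witnesses allow the same
  factor to be applied to two different sections.\<close>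

definition frame_change ::
    "nat \<Rightarrow> ('x, 'e) vbundle \<Rightarrow> ('x, 'e) local_frame \<Rightarrow> ('x, 'e) local_frame \<Rightarrow> 'x set
      \<Rightarrow> ('x \<Rightarrow> complex) \<Rightarrow> complex mat \<Rightarrow> bool" where
  "frame_change n V F G N l T \<longleftrightarrow>
     coord (fdom F) (fcoord F) \<and> coord (fdom G) (fcoord G) \<and>
     openin X N \<and> N \<subseteq> fdom F \<inter> fdom G \<and>
     (\<forall>x\<in>N. holomorphic_at S l x \<and> l x \<noteq> 0) \<and> T \<in> GL n \<and>
     (\<forall>e\<in>total V. proj V e \<in> N \<longrightarrow> ftriv F e = l (proj V e) \<cdot>\<^sub>v (T\<^sup>T *\<^sub>v ftriv G e)) \<and>
     (\<forall>e\<in>total V. proj V e \<in> N \<longrightarrow> ftriv G e \<in> carrier_vec n)"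

definition frame_change_matrix ::
    "nat \<Rightarrow> ('x, 'e) local_frame \<Rightarrow> ('x, 'e) local_frame \<Rightarrow> ('x \<Rightarrow> complex) \<Rightarrow> 'x \<Rightarrow> complex mat" where
  "frame_change_matrix n F G l y = mat n n (\<lambda>(k, j).
     chain_coeff (l \<circ> finv F) (fcoord G \<circ> finv F) k j (fcoord F y))"

text \<open>With p the transition between the coordinates this is l^n (p')^(n(n-1)/2) det T, the
  transition function of the Wronskian line bundle.\<close>

definition frame_change_factor ::
    "nat \<Rightarrow> ('x, 'e) local_frame \<Rightarrow> ('x, 'e) local_frame \<Rightarrow> ('x \<Rightarrow> complex) \<Rightarrow> complex mat \<Rightarrow> 'x \<Rightarrow> complex" where
  "frame_change_factor n F G l T y = 
     (\<Prod>k<n. l y * deriv (fcoord G \<circ> finv F) (fcoord F y) ^ k) * det T"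

context
  fixes n V F G N l T
  assumes ch: "frame_change n V F G N l T"
begin

lemma frame_changeD:
  "coord (fdom F) (fcoord F)" "coord (fdom G) (fcoord G)"
  "openin X N" "y \<in> N \<Longrightarrow> y \<in> fdom F" "y \<in> N \<Longrightarrow> y \<in> fdom G"
  "y \<in> N \<Longrightarrow> holomorphic_at S l y" "y \<in> N \<Longrightarrow> l y \<noteq> 0" "T \<in> GL n"
  "e \<in> total V \<Longrightarrow> proj V e \<in> N \<Longrightarrow> ftriv F e = l (proj V e) \<cdot>\<^sub>v (T\<^sup>T *\<^sub>v ftriv G e)"
  "e \<in> total V \<Longrightarrow> proj V e \<in> N \<Longrightarrow> ftriv G e \<in> carrier_vec n"
  using ch unfolding frame_change_def by auto

lemma frame_change_open: "open (fcoord F ` N)"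
  by (rule topological_chart_open_image[OF local_coordinateD(1)[OF frame_changeD(1)] frame_changeD(3)])
     (use frame_changeD(4) in blast)

lemma frame_change_inv: "y \<in> N \<Longrightarrow> finv F (fcoord F y) = y"
  "y \<in> N \<Longrightarrow> finv G (fcoord G y) = y"
  using local_coordinateD(2)[OF frame_changeD(1)] local_coordinateD(2)[OF frame_changeD(2)] 
    frame_changeD(4,5) by auto

lemma frame_change_holomorphic:
  "(l \<circ> finv F) holomorphic_on fcoord F ` N" "(fcoord G \<circ> finv F) holomorphic_on fcoord F ` N"
proof -
  have *: "f holomorphic_on fcoord F ` N" if "\<And>y. y \<in> N \<Longrightarrow> f analytic_on {fcoord F y}" for f
    by (rule analytic_imp_holomorphic) (subst analytic_on_analytic_at, use that in blast)
  show "(l \<circ> finv F) holomorphic_on fcoord F ` N"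
    by (rule *) (use holomorphic_at_iff[OF frame_changeD(1) frame_changeD(4)] frame_changeD(6) in blast)
  show "(fcoord G \<circ> finv F) holomorphic_on fcoord F ` N"
    by (rule *) (rule transition_analytic[OF frame_changeD(2,1) frame_changeD(5,4)])
qed

lemma frame_component_change:
  assumes y: "y \<in> N" and A: "A y \<in> total V" "proj V (A y) = y" and k: "k < n"
  shows "frame_component A F k y = l y * (\<Sum>j<n. T $$ (j, k) * frame_component A G j y)"
proof -
  have T: "T \<in> carrier_mat n n" using frame_changeD(8) GL_carrier by blast
  have c: "ftriv G (A y) \<in> carrier_vec n" using frame_changeD(10)[OF A(1)] A y by simp
  have "frame_component A F k y = vec_index (l y \<cdot>\<^sub>v (T\<^sup>T *\<^sub>v ftriv G (A y))) k"
    using frame_changeD(9)[OF A(1)] A y by (simp add: frame_component_def)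
  then show ?thesis
    using T k c by (simp add: mult_mat_vec_def scalar_prod_def frame_component_def lessThan_atLeast0)
qed

text \<open>A component in \<open>F\<close> is \<open>l\<close> times a constant combination of
  components in \<open>G\<close>, precomposed with the coordinate change. The constants pass through
  the derivatives and form the right factor; \<open>l\<close> and the coordinate change enter only
  through \<open>chain_coeff\<close>.\<close>

lemma wronskian_matrix_change:
  assumes y: "y \<in> N" and A: "holomorphic_section_at S n A G y"
    and sec: "\<And>y. y \<in> N \<Longrightarrow> A y \<in> total V \<and> proj V (A y) = y"
  shows "wronskian_matrix n A F y = frame_change_matrix n F G l y * wronskian_matrix n A G y * T"
proof (rule eq_matI)
  let ?iF = "finv F" and ?iG = "finv G"
  let ?l = "l \<circ> ?iF" and ?p = "fcoord G \<circ> ?iF"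
  have T: "T \<in> carrier_mat n n" using frame_changeD(8) GL_carrier by blast
  fix k c assume "k < dim_row (frame_change_matrix n F G l y * wronskian_matrix n A G y * T)"
    "c < dim_col (frame_change_matrix n F G l y * wronskian_matrix n A G y * T)"
  then have kc: "k < n" "c < n" using T by (auto simp: frame_change_matrix_def)
  define f where "f t = (\<Sum>j<n. T $$ (j, c) * (frame_component A G j \<circ> ?iG) t)" for t
  have comp: "frame_component A F c (?iF t) = ?l t * f (?p t)" if z: "t \<in> fcoord F ` N" for t
  proof -
    obtain x where x: "x \<in> N" "t = fcoord F x" using z by blast
    have "frame_component A F c x = l x * (\<Sum>j<n. T $$ (j, c) * frame_component A G j x)"
      using frame_component_change[OF x(1) _ _ kc(2)] sec[OF x(1)] by blast
    then show ?thesis using frame_change_inv[OF x(1)] by (simp add: x f_def)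
  qed
  have fan: "(frame_component A G j \<circ> ?iG) analytic_on {fcoord G y}" if "j < n" for j
    using A holomorphic_at_iff[OF frame_changeD(2) frame_changeD(5)[OF y]] that by (simp add: holomorphic_section_at_def)
  have "wronskian_matrix n A F y $$ (k, c) = (deriv ^^ k) (frame_component A F c \<circ> ?iF) (fcoord F y)"
    using kc by (simp add: wronskian_matrix_index)
  also have "\<dots> = (deriv ^^ k) (\<lambda>t. ?l t * f (?p t)) (fcoord F y)"
  proof (rule higher_deriv_cong_ev)
    have "eventually (\<lambda>t. t \<in> fcoord F ` N) (nhds (fcoord F y))"
      using frame_change_open y by (intro eventually_nhds_in_open) auto
    then show "eventually (\<lambda>t. (frame_component A F c \<circ> ?iF) t = ?l t * f (?p t)) (nhds (fcoord F y))"
      by eventually_elim (use comp in simp)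
  qed simp
  also have "\<dots> = (\<Sum>i<n. chain_coeff ?l ?p k i (fcoord F y) * (deriv ^^ i) f (?p (fcoord F y)))"
  proof (rule higher_deriv_chain_coeff[OF frame_change_holomorphic frame_change_open kc(1)])
    show "fcoord F y \<in> fcoord F ` N" using y by simp
    show "f analytic_on {?p (fcoord F y)}"
      unfolding f_def using fan y by (auto intro!: analytic_intros simp: frame_change_inv o_def)
  qed
  also have "\<dots> = (\<Sum>i<n. frame_change_matrix n F G l y $$ (k, i) *
      (\<Sum>j<n. wronskian_matrix n A G y $$ (i, j) * T $$ (j, c)))"
  proof (rule sum.cong[OF refl])
    fix i assume i: "i \<in> {..<n}"
    have "(deriv ^^ i) f (fcoord G y) = (\<Sum>j<n. T $$ (j, c) * (deriv ^^ i) (frame_component A G j \<circ> ?iG) (fcoord G y))"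
      unfolding f_def using fan by (intro higher_deriv_linear_combination) (auto simp: o_def)
    also have "\<dots> = (\<Sum>j<n. wronskian_matrix n A G y $$ (i, j) * T $$ (j, c))"
      using i by (intro sum.cong) (auto simp: wronskian_matrix_index)
    finally show "chain_coeff ?l ?p k i (fcoord F y) * (deriv ^^ i) f (?p (fcoord F y)) =
      frame_change_matrix n F G l y $$ (k, i) * (\<Sum>j<n. wronskian_matrix n A G y $$ (i, j) * T $$ (j, c))"
      using i kc y by (simp add: frame_change_matrix_def frame_change_inv)
  qed
  also have "\<dots> = (frame_change_matrix n F G l y * (wronskian_matrix n A G y * T)) $$ (k, c)"
    using kc T by (simp add: scalar_prod_def lessThan_atLeast0 frame_change_matrix_def wronskian_matrix_def)
  also have "frame_change_matrix n F G l y * (wronskian_matrix n A G y * T) =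
      frame_change_matrix n F G l y * wronskian_matrix n A G y * T"
    using T by (intro assoc_mult_mat[of _ n n _ n _ n, symmetric]) (auto simp: frame_change_matrix_def)
  finally show "wronskian_matrix n A F y $$ (k, c) =
      (frame_change_matrix n F G l y * wronskian_matrix n A G y * T) $$ (k, c)" .
qed (use frame_changeD(8) GL_carrier in \<open>auto simp: frame_change_matrix_def wronskian_matrix_def\<close>)

lemma wronskian_change:
  assumes y: "y \<in> N" and A: "holomorphic_section_at S n A G y"
    and sec: "\<And>y. y \<in> N \<Longrightarrow> A y \<in> total V \<and> proj V (A y) = y"
  shows "wronskian n A F y = frame_change_factor n F G l T y * wronskian n A G y"
proof -
  have M: "frame_change_matrix n F G l y \<in> carrier_mat n n" by (simp add: frame_change_matrix_def)
  have T: "T \<in> carrier_mat n n" using frame_changeD(8) GL_carrier by blast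
  have "det (frame_change_matrix n F G l y) = prod_list (diag_mat (frame_change_matrix n F G l y))"
    by (rule det_lower_triangular[OF _ M]) (simp add: frame_change_matrix_def chain_coeff_above)
  also have "\<dots> = (\<Prod>k<n. l y * deriv (fcoord G \<circ> finv F) (fcoord F y) ^ k)"
    using y by (auto simp: prod_list_diag_prod frame_change_matrix_def chain_coeff_diag lessThan_atLeast0
        frame_change_inv o_def)
  finally have D: "det (frame_change_matrix n F G l y) =
    (\<Prod>k<n. l y * deriv (fcoord G \<circ> finv F) (fcoord F y) ^ k)" .
  have "wronskian_matrix n A F y = frame_change_matrix n F G l y * wronskian_matrix n A G y * T"
    by (rule wronskian_matrix_change[OF y A]) (rule sec)
  with D show ?thesis
    unfolding wronskian_def frame_change_factor_def
    using M T by (simp add: Determinant.det_mult[of _ n])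
qed

lemma frame_change_factor_nonzero: "y \<in> N \<Longrightarrow> frame_change_factor n F G l T y \<noteq> 0"
  using frame_changeD(7,8) transition_deriv_nonzero[OF frame_changeD(2,1) frame_changeD(5,4)]
  by (simp add: frame_change_factor_def GL_iff_det)

lemma frame_change_factor_holomorphic:
  assumes y: "y \<in> N" shows "holomorphic_at S (frame_change_factor n F G l T) y"
proof -
  let ?p = "fcoord G \<circ> finv F"
  have "deriv ?p analytic_on {fcoord F y}"
    by (intro analytic_deriv transition_analytic[OF frame_changeD(2,1) frame_changeD(5,4)[OF y]])
  moreover have "eventually (\<lambda>t. deriv ?p t = ((\<lambda>y. deriv ?p (fcoord F y)) \<circ> finv F) t) (nhds (fcoord F y))"
    using eventually_nhds_coordinate[OF frame_changeD(1) frame_changeD(4)[OF y]]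
    by eventually_elim (auto simp: f_inv_into_f)
  ultimately have "((\<lambda>y. deriv ?p (fcoord F y)) \<circ> finv F) analytic_on {fcoord F y}"
    using analytic_at_cong by blast
  then have d: "holomorphic_at S (\<lambda>y. deriv ?p (fcoord F y)) y"
    using holomorphic_at_iff[OF frame_changeD(1) frame_changeD(4)[OF y]] by blast
  \<comment> \<open>The power is written as a product of equal factors, so that closure under
    products covers it.\<close>
  have "holomorphic_at S (\<lambda>y. (\<Prod>k<n. l y * (\<Prod>_<k. deriv ?p (fcoord F y))) * det T) y"
    using d frame_changeD(6)[OF y]
    by (intro holomorphic_at_mult holomorphic_at_prod holomorphic_at_const)
  then show ?thesis by (simp add: frame_change_factor_def[abs_def])
qed

end

end

section \<open>Sections of projectively flat bundles\<close>

context riemann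
begin

lemma eventually_atinI:
  "openin X N \<Longrightarrow> x \<in> N \<Longrightarrow> (\<And>y. y \<in> N \<Longrightarrow> y \<noteq> x \<Longrightarrow> Q y) \<Longrightarrow> eventually Q (atin X x)"
  unfolding eventually_atin by blast

lemma openin_delete_point: "openin X N \<Longrightarrow> openin X (N - {x})"
proof -
  have "t1_space X" using riemann by (simp add: riemann_surface_def Hausdorff_imp_t1_space)
  then show "openin X N \<Longrightarrow> openin X (N - {x})" by (simp add: t1_space_openin_delete_alt)
qed

text \<open>Points are closed, so removing \<open>x\<close> leaves an open set: every nearby point
  has a full neighbourhood inside the punctured one.\<close>

lemma eventually_atin_eventually:
  assumes "eventually Q (atin X x)" "x \<in> topspace X"
  shows "eventually (\<lambda>y. eventually Q (atin X y)) (atin X x)"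
proof -
  obtain N where N: "openin X N" "x \<in> N" "\<And>y. y \<in> N - {x} \<Longrightarrow> Q y"
    using assms unfolding eventually_atin by blast
  show ?thesis
  proof (rule eventually_atinI[OF N(1,2)])
    fix y assume "y \<in> N" "y \<noteq> x"
    then show "eventually Q (atin X y)"
      by (intro eventually_atinI[OF openin_delete_point[OF N(1), of x]] N(3)) auto
  qed
qed

lemma openin_eventuallyI:
  assumes "A \<subseteq> topspace X" "\<And>x. x \<in> A \<Longrightarrow> eventually (\<lambda>y. y \<in> A) (atin X x)"
  shows "openin X A"
proof (subst openin_subopen, intro ballI)
  fix x assume x: "x \<in> A"
  then obtain N where "openin X N" "x \<in> N" "\<forall>y\<in>N - {x}. y \<in> A"
    using assms(2)[OF x] assms(1) unfolding eventually_atin by blast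
  then show "\<exists>T. openin X T \<and> x \<in> T \<and> T \<subseteq> A" using x by (intro exI[of _ N]) auto
qed

lemma holomorphic_at_tendsto:
  assumes "holomorphic_at S f x" "x \<in> topspace X"
  shows "(f \<longlongrightarrow> f x) (atin X x)"
proof -
  obtain C c where C: "coord C c" "x \<in> C" using chart_exists assms(2) by metis
  have "isCont (f \<circ> inv_into C c) (c x)"
    using assms(1) holomorphic_at_iff[OF C] by (auto intro: analytic_at_imp_isCont)
  moreover have "(f \<circ> inv_into C c) (c x) = f x" using C local_coordinateD(2)[OF C(1)] by simp
  ultimately have "((f \<circ> inv_into C c) \<longlongrightarrow> f x) (at (c x))" unfolding isCont_def by simp
  then show ?thesis by (simp add: atin_coordinate[OF C] filterlim_filtermap o_def)
qed

lemma holomorphic_at_eventually_nonzero: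
  "holomorphic_at S f x \<Longrightarrow> f x \<noteq> 0 \<Longrightarrow> x \<in> topspace X \<Longrightarrow> eventually (\<lambda>y. f y \<noteq> 0) (atin X x)"
  by (rule tendsto_imp_eventually_ne[OF holomorphic_at_tendsto])

lemma meromorphic_at_transform:
  assumes "meromorphic_at S f x" "eventually (\<lambda>y. g y = f y) (atin X x)" "x \<in> topspace X"
  shows "meromorphic_at S g x"
proof -
  obtain C c where C: "coord C c" "x \<in> C" using chart_exists assms(3) by metis
  have 1: "(f \<circ> inv_into C c) meromorphic_on {c x}" using assms(1) meromorphic_at_iff'[OF C] by blast
  have "eventually (\<lambda>t. (f \<circ> inv_into C c) t = (g \<circ> inv_into C c) t) (at (c x))"
    using assms(2) by (simp add: atin_coordinate[OF C] eventually_filtermap eq_commute)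
  then show ?thesis unfolding meromorphic_at_iff'[OF C]
    by (intro iffD1[OF meromorphic_on_cong[OF _ refl] 1]) simp
qed

text \<open>A holomorphic factor with nonzero value has order 0 and orders add. Agreement of
  \<open>g\<close> with the product is asked only off \<open>x\<close>, since that is all a frame
  change provides at a pole.\<close>

lemma order_at_unit_mult:
  assumes r: "holomorphic_at S r x" "r x \<noteq> 0"
    and f: "meromorphic_at S f x" "eventually (\<lambda>y. f y \<noteq> 0) (atin X x)"
    and g: "eventually (\<lambda>y. g y = r y * f y) (atin X x)" and x: "x \<in> topspace X"
  shows "order_at S g x = order_at S f x"
proof -
  obtain C c where C: "coord C c" "x \<in> C" using chart_exists x by metis
  have r': "(r \<circ> inv_into C c) analytic_on {c x}" "(r \<circ> inv_into C c) (c x) \<noteq> 0"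
    using r holomorphic_at_iff[OF C] C local_coordinateD(2)[OF C(1)] by auto
  have f': "(f \<circ> inv_into C c) meromorphic_on {c x}" "eventually (\<lambda>t. (f \<circ> inv_into C c) t \<noteq> 0) (at (c x))"
    using f meromorphic_at_iff'[OF C] by (auto simp: atin_coordinate[OF C] eventually_filtermap)
  have rn: "eventually (\<lambda>y. r y \<noteq> 0) (atin X x)"
    using holomorphic_at_eventually_nonzero[OF r x] .
  then have rn': "eventually (\<lambda>t. (r \<circ> inv_into C c) t \<noteq> 0) (at (c x))"
    by (simp add: atin_coordinate[OF C] eventually_filtermap)
  have gn: "eventually (\<lambda>y. g y \<noteq> 0) (atin X x)"
    using g f(2) rn by eventually_elim simp
  have gm: "meromorphic_at S g x"
    by (rule meromorphic_at_transform[OF meromorphic_at_mult[OF holomorphic_at_meromorphic[OF r(1)] f(1)] g x])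
  have "order_at S g x = zorder (g \<circ> inv_into C c) (c x)" by (rule order_at_eq[OF C gm gn])
  also have "\<dots> = zorder (\<lambda>t. (r \<circ> inv_into C c) t * (f \<circ> inv_into C c) t) (c x)"
    using g by (intro zorder_cong) (auto simp: atin_coordinate[OF C] eventually_filtermap)
  also have "\<dots> = zorder (r \<circ> inv_into C c) (c x) + zorder (f \<circ> inv_into C c) (c x)"
    by (rule zorder_mult[OF analytic_on_imp_meromorphic_on[OF r'(1)] eventually_frequently[OF at_neq_bot rn']
          f'(1) eventually_frequently[OF at_neq_bot f'(2)]])
  also have "zorder (r \<circ> inv_into C c) (c x) = 0" by (rule zorder_eq_0I[OF r'])
  also have "zorder (f \<circ> inv_into C c) (c x) = order_at S f x" by (rule order_at_eq[OF C f, symmetric])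
  finally show ?thesis by simp
qed

lemma order_at_holomorphic_eq_0_iff:
  assumes f: "holomorphic_at S f x" "eventually (\<lambda>y. f y \<noteq> 0) (atin X x)" and x: "x \<in> topspace X"
  shows "order_at S f x = 0 \<longleftrightarrow> f x \<noteq> 0"
proof -
  obtain C c where C: "coord C c" "x \<in> C" using chart_exists x by metis
  have a: "(f \<circ> inv_into C c) analytic_on {c x}" using f(1) holomorphic_at_iff[OF C] by blast
  have "eventually (\<lambda>t. (f \<circ> inv_into C c) t \<noteq> 0) (at (c x))"
    using f(2) by (simp add: atin_coordinate[OF C] eventually_filtermap)
  then have "zorder (f \<circ> inv_into C c) (c x) = 0 \<longleftrightarrow> (f \<circ> inv_into C c) (c x) \<noteq> 0"
    by (intro zorder_eq_0_iff a eventually_frequently) auto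
  then show ?thesis
    using order_at_eq[OF C holomorphic_at_meromorphic[OF f(1)] f(2)] C local_coordinateD(2)[OF C(1)] by simp
qed

lemma holomorphic_GL_subset: "holomorphic_GL S n N g \<Longrightarrow> M \<subseteq> N \<Longrightarrow> holomorphic_GL S n M g"
  unfolding holomorphic_GL_def by blast

lemma local_trivialization_carrier:
  assumes "local_trivialization S n V U \<psi>" "e \<in> total V" "proj V e \<in> U"
  shows "\<psi> e \<in> carrier_vec n"
proof -
  have "bij_betw (\<lambda>e. (proj V e, \<psi> e)) {e \<in> total V. proj V e \<in> U} (U \<times> carrier_vec n)"
    using assms by (simp add: local_trivialization_def)
  then have "(proj V e, \<psi> e) \<in> U \<times> carrier_vec n" using assms(2,3) by (auto dest: bij_betwE)
  then show ?thesis by simp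
qed

lemma local_trivialization_subset:
  assumes t: "local_trivialization S n V U \<psi>" and N: "openin X N" "N \<subseteq> U"
  shows "local_trivialization S n V N \<psi>"
  unfolding local_trivialization_def
proof (intro conjI)
  let ?f = "\<lambda>e. (proj V e, \<psi> e)"
  have b: "bij_betw ?f {e \<in> total V. proj V e \<in> U} (U \<times> carrier_vec n)"
    using t by (simp add: local_trivialization_def)
  show "bij_betw ?f {e \<in> total V. proj V e \<in> N} (N \<times> carrier_vec n)"
  proof (rule bij_betw_subset[OF b])
    show "{e \<in> total V. proj V e \<in> N} \<subseteq> {e \<in> total V. proj V e \<in> U}" using N(2) by blast
    have "N \<times> carrier_vec n \<subseteq> ?f ` {e \<in> total V. proj V e \<in> U}"
      using N(2) bij_betw_imp_surj_on[OF b] by blast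
    moreover have "?f ` {e \<in> total V. proj V e \<in> U} \<subseteq> U \<times> carrier_vec n"
      using bij_betw_imp_surj_on[OF b] by blast
    ultimately show "?f ` {e \<in> total V. proj V e \<in> N} = N \<times> carrier_vec n" using N(2) by auto
  qed
  have g: "\<forall>(W, \<chi>)\<in>trivs V. \<exists>g. holomorphic_GL S n (U \<inter> W) g \<and>
        (\<forall>e\<in>total V. proj V e \<in> U \<inter> W \<longrightarrow> \<psi> e = (g (proj V e))\<^sup>T *\<^sub>v \<chi> e)"
    using t by (simp add: local_trivialization_def)
  have "\<exists>g. holomorphic_GL S n (N \<inter> W) g \<and>
        (\<forall>e\<in>total V. proj V e \<in> N \<inter> W \<longrightarrow> \<psi> e = (g (proj V e))\<^sup>T *\<^sub>v \<chi> e)" if "(W, \<chi>) \<in> trivs V" for W \<chi>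
  proof -
    obtain g where 1: "holomorphic_GL S n (U \<inter> W) g"
      and 2: "\<forall>e\<in>total V. proj V e \<in> U \<inter> W \<longrightarrow> \<psi> e = (g (proj V e))\<^sup>T *\<^sub>v \<chi> e"
      using g \<open>(W, \<chi>) \<in> trivs V\<close> by blast
    have "holomorphic_GL S n (N \<inter> W) g"
      by (rule holomorphic_GL_subset[OF 1]) (use N(2) in blast)
    moreover have "\<forall>e\<in>total V. proj V e \<in> N \<inter> W \<longrightarrow> \<psi> e = (g (proj V e))\<^sup>T *\<^sub>v \<chi> e"
      using 2 N(2) by blast
    ultimately show ?thesis by blast
  qed
  then show "\<forall>(W, \<chi>)\<in>trivs V. \<exists>g. holomorphic_GL S n (N \<inter> W) g \<and>
        (\<forall>e\<in>total V. proj V e \<in> N \<inter> W \<longrightarrow> \<psi> e = (g (proj V e))\<^sup>T *\<^sub>v \<chi> e)" by blast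
qed (rule N(1))

end

section \<open>Frames of a projectively flat bundle and sections in them\<close>

locale projectively_flat = riemann S for S :: "'x surface" +
  fixes n :: nat and V :: "('x, 'e) vbundle" and P :: "('x set \<times> ('e \<Rightarrow> complex vec)) set"
  assumes vector_bundle: "holomorphic_vector_bundle S n V" and flat: "proj_flat_structure S n V P"
begin

abbreviation "frame \<equiv> proj_flat_frame S n V P"

lemma frameD:
  assumes "frame F"
  shows "coord (fdom F) (fcoord F)" "local_trivialization S n V (fdom F) (ftriv F)"
    "fdom F \<subseteq> topspace X" "openin X (fdom F)"
proof -
  show c: "coord (fdom F) (fcoord F)" "local_trivialization S n V (fdom F) (ftriv F)"
    using assms by (simp_all add: proj_flat_frame_def)
  show "fdom F \<subseteq> topspace X" "openin X (fdom F)"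
    by (rule local_coordinateD[OF c(1)])+
qed

lemma flat_cover:
  assumes "x \<in> topspace X"
  obtains W \<chi> where "(W, \<chi>) \<in> P" "x \<in> W" "local_trivialization S n V W \<chi>" "openin X W"
proof -
  have "(\<Union>(U, \<psi>)\<in>P. U) = topspace X" using flat by (simp add: proj_flat_structure_def)
  then obtain W \<chi> where W: "(W, \<chi>) \<in> P" "x \<in> W" using assms by blast
  moreover have "local_trivialization S n V W \<chi>" using flat W unfolding proj_flat_structure_def by blast
  ultimately show ?thesis using that unfolding local_trivialization_def by blast
qed

text \<open>A coordinate domain is intersected with the domain of a trivialization from
  \<open>P\<close>; the restrictions of both data form a frame.\<close>

lemma frame_exists:
  assumes "x \<in> topspace X"
  obtains F where "frame F" "x \<in> fdom F"
proof -
  obtain W \<chi> where W: "(W, \<chi>) \<in> P" "x \<in> W" "local_trivialization S n V W \<chi>" "openin X W"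
    by (rule flat_cover[OF assms])
  obtain C c where C: "coord C c" "x \<in> C" using chart_exists assms by metis
  define F where "F = \<lparr>fdom = C \<inter> W, fcoord = c, ftriv = \<chi>\<rparr>"
  have o: "openin X (C \<inter> W)" using local_coordinateD(4)[OF C(1)] W(4) by blast
  have "\<exists>N. openin X N \<and> y \<in> N \<and> N \<subseteq> fdom F \<inter> W' \<and> proj_flat_on S n V N (ftriv F) \<chi>'"
    if W': "(W', \<chi>') \<in> P" and y: "y \<in> fdom F \<inter> W'" for W' \<chi>' y
  proof (intro exI conjI)
    have "local_trivialization S n V W' \<chi>'" using flat W' unfolding proj_flat_structure_def by blast
    then show "openin X (fdom F \<inter> W')" using o by (auto simp: F_def local_trivialization_def)
    have "proj_flat_on S n V (W \<inter> W') \<chi> \<chi>'" using flat W' W(1) unfolding proj_flat_structure_def by blast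
    then show "proj_flat_on S n V (fdom F \<inter> W') (ftriv F) \<chi>'"
      unfolding proj_flat_on_def F_def by auto
  qed (use y in auto)
  moreover have "coord (fdom F) (fcoord F)"
    using local_coordinate_subset[OF C(1) o] by (simp add: F_def)
  moreover have "local_trivialization S n V (fdom F) (ftriv F)"
    using local_trivialization_subset[OF W(3) o] by (simp add: F_def)
  ultimately have "frame F" unfolding proj_flat_frame_def by blast
  then show ?thesis using that C(2) W(2) by (simp add: F_def)
qed

lemma frame_flat:
  assumes F: "frame F" "x \<in> fdom F" and W: "(W, \<chi>) \<in> P" "x \<in> W"
  obtains N l T where "openin X N" "x \<in> N" "N \<subseteq> fdom F \<inter> W" "T \<in> GL n"
    "\<And>y. y \<in> N \<Longrightarrow> holomorphic_at S l y \<and> l y \<noteq> 0"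
    "\<And>e. e \<in> total V \<Longrightarrow> proj V e \<in> N \<Longrightarrow> ftriv F e = l (proj V e) \<cdot>\<^sub>v (T\<^sup>T *\<^sub>v \<chi> e)"
proof -
  have "\<forall>(W, \<chi>)\<in>P. \<forall>x\<in>fdom F \<inter> W. \<exists>N. openin X N \<and> x \<in> N \<and> N \<subseteq> fdom F \<inter> W \<and>
        proj_flat_on S n V N (ftriv F) \<chi>"
    using F(1) by (simp add: proj_flat_frame_def)
  then have "\<forall>x\<in>fdom F \<inter> W. \<exists>N. openin X N \<and> x \<in> N \<and> N \<subseteq> fdom F \<inter> W \<and>
        proj_flat_on S n V N (ftriv F) \<chi>" using W(1) by blast
  then obtain N where N: "openin X N" "x \<in> N" "N \<subseteq> fdom F \<inter> W" "proj_flat_on S n V N (ftriv F) \<chi>"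
    using F(2) W(2) by blast
  from N(4) obtain l T where "(\<forall>x\<in>N. holomorphic_at S l x \<and> l x \<noteq> 0) \<and> T \<in> GL n \<and>
        (\<forall>e\<in>total V. proj V e \<in> N \<longrightarrow> ftriv F e = l (proj V e) \<cdot>\<^sub>v (T\<^sup>T *\<^sub>v \<chi> e))"
    unfolding proj_flat_on_def by (elim exE)
  with N(1-3) show ?thesis by (intro that[of N T l]) blast+
qed

text \<open>Frames are compared with \<open>P\<close> only, so the change passes through a member
  \<chi> of \<open>P\<close> around \<open>x\<close>: from F = l1 \<chi> T1 and G = l2 \<chi> T2 one
  gets l = l1/l2 and T = T2^-1 T1.\<close>

lemma frame_change_exists:
  assumes F: "frame F" "x \<in> fdom F" and G: "frame G" "x \<in> fdom G"
  obtains N l T where "frame_change n V F G N l T" "x \<in> N"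
proof -
  obtain W \<chi> where W: "(W, \<chi>) \<in> P" "x \<in> W" "local_trivialization S n V W \<chi>" "openin X W"
    by (rule flat_cover[OF subsetD[OF frameD(3)[OF F(1)] F(2)]])
  obtain N1 l1 T1 where 1: "openin X N1" "x \<in> N1" "N1 \<subseteq> fdom F \<inter> W" "T1 \<in> GL n"
    "\<And>y. y \<in> N1 \<Longrightarrow> holomorphic_at S l1 y \<and> l1 y \<noteq> 0"
    "\<And>e. e \<in> total V \<Longrightarrow> proj V e \<in> N1 \<Longrightarrow> ftriv F e = l1 (proj V e) \<cdot>\<^sub>v (T1\<^sup>T *\<^sub>v \<chi> e)"
    by (rule frame_flat[OF F W(1,2)]) (rule that)
  obtain N2 l2 T2 where 2: "openin X N2" "x \<in> N2" "N2 \<subseteq> fdom G \<inter> W" "T2 \<in> GL n"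
    "\<And>y. y \<in> N2 \<Longrightarrow> holomorphic_at S l2 y \<and> l2 y \<noteq> 0"
    "\<And>e. e \<in> total V \<Longrightarrow> proj V e \<in> N2 \<Longrightarrow> ftriv G e = l2 (proj V e) \<cdot>\<^sub>v (T2\<^sup>T *\<^sub>v \<chi> e)"
    by (rule frame_flat[OF G W(1,2)]) (rule that)
  define l where "l y = l1 y / l2 y" for y
  define T where "T = minv T2 * T1"
  note c = GL_carrier[OF 1(4)] GL_carrier[OF 2(4)] minv[OF 2(4)]
  have "frame_change n V F G (N1 \<inter> N2) l T"
    unfolding frame_change_def
  proof (intro conjI ballI impI)
    show "T \<in> GL n" unfolding T_def using 1(4) minv_GL[OF 2(4)] by (rule GL_mult[rotated])
    show "holomorphic_at S l y" if "y \<in> N1 \<inter> N2" for y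
      unfolding l_def using 1(5)[of y] 2(5)[of y] that by (intro holomorphic_at_divide) auto
    show "l y \<noteq> 0" if "y \<in> N1 \<inter> N2" for y
      unfolding l_def using 1(5)[of y] 2(5)[of y] that by auto
    fix e assume e: "e \<in> total V" "proj V e \<in> N1 \<inter> N2"
    have v: "\<chi> e \<in> carrier_vec n" using local_trivialization_carrier[OF W(3) e(1)] e(2) 1(3) by blast
    show "ftriv G e \<in> carrier_vec n"
      using local_trivialization_carrier[OF frameD(2)[OF G(1)] e(1)] e(2) 2(3) by blast
    have "T\<^sup>T *\<^sub>v ftriv G e = T1\<^sup>T *\<^sub>v ((minv T2)\<^sup>T *\<^sub>v (l2 (proj V e) \<cdot>\<^sub>v (T2\<^sup>T *\<^sub>v \<chi> e)))"
      unfolding T_def using 2(6)[OF e(1)] e(2) v c row_action_mult[of "minv T2" n T1 "ftriv G e"] \<open>ftriv G e \<in> carrier_vec n\<close>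
      by simp
    also have "(minv T2)\<^sup>T *\<^sub>v (l2 (proj V e) \<cdot>\<^sub>v (T2\<^sup>T *\<^sub>v \<chi> e)) = l2 (proj V e) \<cdot>\<^sub>v ((minv T2)\<^sup>T *\<^sub>v (T2\<^sup>T *\<^sub>v \<chi> e))"
      using c row_action_carrier[OF c(2)] by (intro mult_mat_vec[of _ n n]) auto
    also have "(minv T2)\<^sup>T *\<^sub>v (T2\<^sup>T *\<^sub>v \<chi> e) = \<chi> e"
      using row_action_mult[of T2 n "minv T2" "\<chi> e"] c v by simp
    also have "T1\<^sup>T *\<^sub>v (l2 (proj V e) \<cdot>\<^sub>v \<chi> e) = l2 (proj V e) \<cdot>\<^sub>v (T1\<^sup>T *\<^sub>v \<chi> e)"
      using c v by (intro mult_mat_vec[of _ n n]) auto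
    finally have "T\<^sup>T *\<^sub>v ftriv G e = l2 (proj V e) \<cdot>\<^sub>v (T1\<^sup>T *\<^sub>v \<chi> e)" .
    then show "ftriv F e = l (proj V e) \<cdot>\<^sub>v (T\<^sup>T *\<^sub>v ftriv G e)"
      using 1(6)[OF e(1)] e(2) 2(5)[of "proj V e"] by (simp add: l_def smult_smult_assoc)
  qed (use 1(1-3) 2(1-3) frameD[OF F(1)] frameD[OF G(1)] in auto)
  then show ?thesis using that 1(2) 2(2) by blast
qed

lemma trivs_cover:
  assumes "x \<in> topspace X"
  obtains W \<chi> where "(W, \<chi>) \<in> trivs V" "x \<in> W" "local_trivialization S n V W \<chi>" "openin X W"
proof -
  have "(\<Union>(U, \<psi>)\<in>trivs V. U) = topspace X" using vector_bundle by (simp add: holomorphic_vector_bundle_def)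
  then obtain W \<chi> where W: "(W, \<chi>) \<in> trivs V" "x \<in> W" using assms by blast
  moreover have "local_trivialization S n V W \<chi>" using vector_bundle W unfolding holomorphic_vector_bundle_def by blast
  ultimately show ?thesis using that unfolding local_trivialization_def by blast
qed

text \<open>These are the points that \<open>admissible_cover\<close> keeps out of the overlaps and
  at which \<open>covers_agree\<close> imposes its condition.\<close>

definition bad_point :: "('x \<Rightarrow> 'e) \<Rightarrow> 'x \<Rightarrow> bool" where
  "bad_point A x \<longleftrightarrow> wronskian_divisor S n V P A x \<noteq> 0 \<or> section_pole S n V A x"

context
  fixes A
  assumes A: "meromorphic_section S n V A"
begin

lemma section_over: "x \<in> topspace X \<Longrightarrow> A x \<in> total V \<and> proj V (A x) = x"
  using A by (simp add: meromorphic_section_def)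

text \<open>Meromorphy of a section is defined by the trivializations of \<open>V\<close>; a frame
  component is a combination of those components with holomorphic coefficients.\<close>

lemma
  assumes F: "frame F" "x \<in> fdom F" and k: "k < n"
  shows frame_component_meromorphic: "meromorphic_at S (frame_component A F k) x"
    and frame_component_holomorphic: "\<not> section_pole S n V A x \<Longrightarrow> holomorphic_at S (frame_component A F k) x"
proof -
  have x: "x \<in> topspace X" using frameD(3) F by blast
  obtain W \<chi> where W: "(W, \<chi>) \<in> trivs V" "x \<in> W" and t: "local_trivialization S n V W \<chi>" "openin X W"
    using trivs_cover[OF x] by blast
  obtain g where g: "holomorphic_GL S n (fdom F \<inter> W) g"
    "\<And>e. e \<in> total V \<Longrightarrow> proj V e \<in> fdom F \<inter> W \<Longrightarrow> ftriv F e = (g (proj V e))\<^sup>T *\<^sub>v \<chi> e"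
    using frameD(2)[OF F(1)] W(1) unfolding local_trivialization_def by blast
  define N where "N = fdom F \<inter> W"
  have N: "openin X N" "x \<in> N" using t(2) frameD(4)[OF F(1)] F W by (auto simp: N_def)
  let ?\<chi> = "\<lambda>y. \<Sum>j<n. g y $$ (j, k) * vec_index (\<chi> (A y)) j"
  have eq: "frame_component A F k y = ?\<chi> y" if "y \<in> N" for y
  proof -
    have y: "A y \<in> total V" "proj V (A y) = y" using section_over frameD(3)[OF F(1)] that by (auto simp: N_def)
    have c: "\<chi> (A y) \<in> carrier_vec n" "g y \<in> carrier_mat n n"
      using local_trivialization_carrier[OF t(1) y(1)] y that g(1) GL_carrier by (auto simp: holomorphic_GL_def N_def)
    have "ftriv F (A y) = (g y)\<^sup>T *\<^sub>v \<chi> (A y)" using g(2)[OF y(1)] y that by (simp add: N_def)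
    then show ?thesis
      using c k by (simp add: frame_component_def mult_mat_vec_def scalar_prod_def lessThan_atLeast0)
  qed
  have gh: "holomorphic_at S (\<lambda>y. g y $$ (j, k)) x" if "j < n" for j
    using g(1) that k N(2) by (simp add: holomorphic_GL_def N_def)
  have "meromorphic_at S (\<lambda>y. vec_index (\<chi> (A y)) j) x" if "j < n" for j
    using A W that unfolding meromorphic_section_def by blast
  then have "meromorphic_at S ?\<chi> x"
    by (intro meromorphic_at_sum meromorphic_at_mult) (use holomorphic_at_meromorphic[OF gh] in auto)
  then show "meromorphic_at S (frame_component A F k) x"
    by (rule meromorphic_at_transform[OF _ eventually_atinI[OF N] x]) (rule eq)
  assume "\<not> section_pole S n V A x"
  \<comment> \<open>Without a pole only the first alternative in \<open>meromorphic_section\<close>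
    remains.\<close>
  then have "holomorphic_at S (\<lambda>y. vec_index (\<chi> (A y)) j) x" if "j < n" for j
    using A W that unfolding meromorphic_section_def section_pole_def by blast
  then have "holomorphic_at S ?\<chi> x" using gh by (intro holomorphic_at_sum holomorphic_at_mult) auto
  then show "holomorphic_at S (frame_component A F k) x" by (rule holomorphic_at_transform[OF _ N]) (rule eq)
qed

lemma no_pole_holomorphic_section:
  "frame F \<Longrightarrow> x \<in> fdom F \<Longrightarrow> \<not> section_pole S n V A x \<Longrightarrow> holomorphic_section_at S n A F x"
  by (simp add: holomorphic_section_at_def frame_component_holomorphic)

lemma eventually_holomorphic_section:
  assumes F: "frame F" "x \<in> fdom F"
  shows "eventually (holomorphic_section_at S n A F) (atin X x)"
proof -
  have x: "x \<in> topspace X" using frameD(3) F by blast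
  have "eventually (\<lambda>y. \<forall>k\<in>{..<n}. holomorphic_at S (frame_component A F k) y) (atin X x)"
    using frame_component_meromorphic[OF F] meromorphic_at_nearby x
    by (intro eventually_ball_finite) auto
  then show ?thesis by (simp add: holomorphic_section_at_def[abs_def] Ball_def)
qed

lemma wronskian_meromorphic_at:
  "frame F \<Longrightarrow> x \<in> fdom F \<Longrightarrow> meromorphic_at S (wronskian n A F) x"
  by (intro wronskian_meromorphic frameD(1) frame_component_meromorphic)

text \<open>At \<open>x\<close> itself \<open>A\<close> may have a pole. Its components are
  holomorphic on a punctured neighbourhood, and this is enough for orders and limits.\<close>

lemma eventually_wronskian_change:
  assumes ch: "frame_change n V F G N l T" and x: "x \<in> N" and G: "frame G"
  shows "eventually (\<lambda>y. wronskian n A F y = frame_change_factor n F G l T y * wronskian n A G y) (atin X x)"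
proof -
  have "eventually (\<lambda>y. y \<in> N) (atin X x)"
    by (rule eventually_atinI[OF frame_changeD(3)[OF ch] x])
  with eventually_holomorphic_section[OF G frame_changeD(5)[OF ch x]] show ?thesis
  proof eventually_elim
    case (elim y)
    show ?case
      by (rule wronskian_change[OF ch elim(2,1)])
        (use section_over openin_subset[OF frame_changeD(3)[OF ch]] in blast)
  qed
qed

end

text \<open>Identity theorem on a connected surface. Frame factors have no zeros, so identical
  vanishing near a point does not depend on the frame and defines a set \<open>Z\<close>. It is open
  and closed, and the point provided by genericity lies outside it.\<close>

lemma generic_eventually_nonzero:
  assumes A: "meromorphic_section S n V A" and gen: "generic_section S n V P A"
    and F: "frame F" "x \<in> fdom F"
  shows "eventually (\<lambda>y. wronskian n A F y \<noteq> 0) (atin X x)"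
proof -
  have change: "eventually (\<lambda>y. wronskian n A F y = 0 \<longleftrightarrow> wronskian n A G y = 0) (atin X x)"
    if F: "frame F" "x \<in> fdom F" and G: "frame G" "x \<in> fdom G" for F G x
  proof -
    obtain N l T where ch: "frame_change n V F G N l T" "x \<in> N"
      using frame_change_exists[OF F G] by blast
    have "eventually (\<lambda>y. y \<in> N) (atin X x)"
      by (rule eventually_atinI[OF frame_changeD(3)[OF ch(1)] ch(2)])
    with eventually_wronskian_change[OF A ch G(1)] show ?thesis
      by eventually_elim (use frame_change_factor_nonzero[OF ch(1)] in auto)
  qed
  define Z where "Z = {x \<in> topspace X. \<exists>F. frame F \<and> x \<in> fdom F \<and>
      eventually (\<lambda>y. wronskian n A F y = 0) (atin X x)}"
  have Z: "eventually (\<lambda>y. wronskian n A F y = 0) (atin X x)" if "x \<in> Z" "frame F" "x \<in> fdom F" for x F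
  proof -
    obtain G where G: "frame G" "x \<in> fdom G" "eventually (\<lambda>y. wronskian n A G y = 0) (atin X x)"
      using \<open>x \<in> Z\<close> unfolding Z_def by blast
    from G(3) change[OF that(2,3) G(1,2)] show ?thesis by eventually_elim simp
  qed
  have nZ: "eventually (\<lambda>y. wronskian n A F y \<noteq> 0) (atin X x)"
    if "x \<notin> Z" "frame F" "x \<in> fdom F" for x F
    using meromorphic_at_cases[OF wronskian_meromorphic_at[OF A that(2,3)]] that frameD(3)[OF that(2)]
    unfolding Z_def by blast
  have nZI: "x \<notin> Z" if "frame F" "x \<in> fdom F" "eventually (\<lambda>y. wronskian n A F y \<noteq> 0) (atin X x)" for x F
  proof
    assume "x \<in> Z"
    from Z[OF this that(1,2)] that(3) have "eventually (\<lambda>y. False) (atin X x)" by eventually_elim simp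
    then show False using atin_neq_bot[of x] frameD(3)[OF that(1)] that(2) by auto
  qed
  have fd: "eventually (\<lambda>y. y \<in> fdom F) (atin X x)" if "frame F" "x \<in> fdom F" for F x
    by (rule eventually_atinI[OF frameD(4)[OF that(1)] that(2)])
  have "openin X Z"
  proof (rule openin_eventuallyI)
    fix x assume x: "x \<in> Z"
    then have tx: "x \<in> topspace X" by (simp add: Z_def)
    then obtain F where F: "frame F" "x \<in> fdom F" using frame_exists by blast
    from eventually_atin_eventually[OF Z[OF x F] tx] fd[OF F] show "eventually (\<lambda>y. y \<in> Z) (atin X x)"
      by eventually_elim (use F(1) frameD(3)[OF F(1)] in \<open>auto simp: Z_def\<close>)
  qed (simp add: Z_def)
  \<comment> \<open>Outside \<open>Z\<close> the alternative for meromorphic germs leaves a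
    Wronskian without zeros on a punctured neighbourhood, and nearby points inherit this.\<close>
  moreover have "openin X (topspace X - Z)"
  proof (rule openin_eventuallyI)
    fix x assume x: "x \<in> topspace X - Z"
    then have tx: "x \<in> topspace X" "x \<notin> Z" by auto
    then obtain F where F: "frame F" "x \<in> fdom F" using frame_exists by blast
    from eventually_atin_eventually[OF nZ[OF tx(2) F] tx(1)] fd[OF F]
    show "eventually (\<lambda>y. y \<in> topspace X - Z) (atin X x)"
      by eventually_elim (use nZI[OF F(1)] frameD(3)[OF F(1)] in auto)
  qed simp
  then have "closedin X Z" by (simp add: closedin_def Z_def)
  moreover have "connected_space X" using riemann by (simp add: riemann_surface_def)
  ultimately have "Z = {} \<or> Z = topspace X" by (simp add: connected_space_clopen_in)
  moreover have "Z \<noteq> topspace X"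
  proof -
    obtain F x where F: "frame F" "x \<in> fdom F" "\<not> section_pole S n V A x" "wronskian n A F x \<noteq> 0"
      using gen unfolding generic_section_def by blast
    have x: "x \<in> topspace X" using frameD(3) F by blast
    have "holomorphic_at S (wronskian n A F) x"
      by (rule wronskian_holomorphic[OF frameD(1)[OF F(1)] F(2) no_pole_holomorphic_section[OF A F(1-3)]])
    from nZI[OF F(1,2) holomorphic_at_eventually_nonzero[OF this F(4) x]] x show ?thesis by blast
  qed
  ultimately have "x \<notin> Z" by blast
  then show ?thesis by (rule nZ[OF _ F])
qed

context
  fixes A
  assumes A: "meromorphic_section S n V A" and gen: "generic_section S n V P A"
begin

lemma wronskian_divisor_eq:
  assumes F: "frame F" "x \<in> fdom F"
  shows "wronskian_divisor S n V P A x = order_at S (wronskian n A F) x"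
  unfolding wronskian_divisor_def
proof (rule the_equality)
  show "\<forall>G. frame G \<and> x \<in> fdom G \<longrightarrow> order_at S (wronskian n A G) x = order_at S (wronskian n A F) x"
  proof (intro allI impI)
    fix G assume G: "frame G \<and> x \<in> fdom G"
    then obtain N l T where ch: "frame_change n V G F N l T" "x \<in> N"
      using frame_change_exists[of G x F] F by blast
    show "order_at S (wronskian n A G) x = order_at S (wronskian n A F) x"
    proof (rule order_at_unit_mult)
      show "holomorphic_at S (frame_change_factor n G F l T) x" "frame_change_factor n G F l T x \<noteq> 0"
        using frame_change_factor_holomorphic[OF ch] frame_change_factor_nonzero[OF ch] by auto
      show "x \<in> topspace X" using frameD(3) F by blast
    qed (rule wronskian_meromorphic_at[OF A F] generic_eventually_nonzero[OF A gen F]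
        eventually_wronskian_change[OF A ch F(1)])+
  qed
qed (use F in blast)

text \<open>Without a pole the Wronskian is holomorphic, so order 0 really means a nonzero value at
  \<open>x\<close>; with a pole of \<open>A\<close> it could come from zeros and poles cancelling in
  the determinant.\<close>

lemma good_point_frame:
  assumes x: "\<not> bad_point A x" and F: "frame F" "x \<in> fdom F"
  shows "holomorphic_section_at S n A F x" "wronskian_matrix n A F x \<in> GL n"
proof -
  show h: "holomorphic_section_at S n A F x"
    using no_pole_holomorphic_section[OF A F] x by (simp add: bad_point_def)
  have "x \<in> topspace X" using frameD(3) F by blast
  moreover have "holomorphic_at S (wronskian n A F) x"
    by (rule wronskian_holomorphic[OF frameD(1)[OF F(1)] F(2) h])
  moreover have "order_at S (wronskian n A F) x = 0"
    using x wronskian_divisor_eq[OF F] by (simp add: bad_point_def)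
  ultimately have "wronskian n A F x \<noteq> 0"
    using order_at_holomorphic_eq_0_iff generic_eventually_nonzero[OF A gen F] by blast
  then show "wronskian_matrix n A F x \<in> GL n" by (simp add: GL_iff_det wronskian_def)
qed

lemma eventually_wronskian_GL:
  assumes F: "frame F" "x \<in> fdom F"
  shows "eventually (\<lambda>y. wronskian_matrix n A F y \<in> GL n) (atin X x)"
  using generic_eventually_nonzero[OF A gen F]
  by eventually_elim (simp add: GL_iff_det wronskian_def)

end

end

section \<open>The line bundle of a divisor\<close>

context riemann
begin

text \<open>Equal orders cancel, so f/g has a removable singularity with nonzero value. The limit is
  described at all points near \<open>x\<close>, because the transition functions of
  \<open>divisor_bundle\<close> take a separate limit at each point and their holomorphy needs a
  whole neighbourhood.\<close>

lemma quotient_limit: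
  assumes f: "meromorphic_at S f x" "eventually (\<lambda>y. f y \<noteq> 0) (atin X x)"
    and g: "meromorphic_at S g x" "eventually (\<lambda>y. g y \<noteq> 0) (atin X x)"
    and o: "order_at S f x = order_at S g x" and x: "x \<in> topspace X"
  obtains q N where "holomorphic_at S q x" "q x \<noteq> 0" "openin X N" "x \<in> N"
    "\<And>y. y \<in> N \<Longrightarrow> ((\<lambda>u. f u / g u) \<longlongrightarrow> q y) (atin X y)"
proof -
  obtain C c where C: "coord C c" "x \<in> C" using chart_exists x by metis
  note inj = local_coordinateD(2)[OF C(1)]
  let ?f = "f \<circ> inv_into C c" and ?g = "g \<circ> inv_into C c"
  define h where "h t = ?f t / ?g t" for t
  have fm: "?f meromorphic_on {c x}" and gm: "?g meromorphic_on {c x}"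
    using f(1) g(1) meromorphic_at_iff'[OF C] by auto
  have fn: "eventually (\<lambda>t. ?f t \<noteq> 0) (at (c x))" and gn: "eventually (\<lambda>t. ?g t \<noteq> 0) (at (c x))"
    using f(2) g(2) by (simp_all add: atin_coordinate[OF C] eventually_filtermap)
  have hm: "h meromorphic_on {c x}" unfolding h_def[abs_def] by (rule meromorphic_on_divide[OF fm gm])
  have hn: "eventually (\<lambda>t. h t \<noteq> 0) (at (c x))" using fn gn by eventually_elim (simp add: h_def)
  have "zorder h (c x) = zorder ?f (c x) - zorder ?g (c x)" unfolding h_def[abs_def]
    by (rule zorder_divide[OF fm eventually_frequently[OF at_neq_bot fn] gm eventually_frequently[OF at_neq_bot gn]])
  then have z0: "zorder h (c x) = 0" using order_at_eq[OF C f] order_at_eq[OF C g] o by simp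
  have iso: "isolated_singularity_at h (c x)" "not_essential h (c x)" using hm by (auto simp: meromorphic_at_iff)
  have "\<not> is_pole h (c x)" using isolated_pole_imp_neg_zorder[OF iso(1)] z0 by auto
  then obtain L where L: "h \<midarrow>c x\<rightarrow> L" using iso(2) by (auto simp: not_essential_def)
  have ra: "remove_sings h analytic_on {c x}" by (rule remove_sings_analytic_at[OF iso(1) L])
  have "eventually (\<lambda>t. remove_sings h t \<noteq> 0) (at (c x))"
    using hn eventually_remove_sings_eq_at[OF iso(1)] by eventually_elim simp
  then have r0: "remove_sings h (c x) \<noteq> 0"
    using zorder_eq_0_iff[OF ra eventually_frequently[OF at_neq_bot]] zorder_remove_sings[OF iso(1)] z0 by simp
  obtain r where r: "r > 0" "h analytic_on ball (c x) r - {c x}"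
    using iso(1) by (auto simp: isolated_singularity_at_def)
  have lim: "h \<midarrow>t\<rightarrow> remove_sings h t" if "t \<in> ball (c x) r" for t
  proof (cases "t = c x")
    case True
    then show ?thesis using L remove_sings_eqI[OF L] by simp
  next
    case False
    then have a: "h analytic_on {t}" using r(2) that by (auto intro: analytic_on_subset)
    then have "isCont h t" by (rule analytic_at_imp_isCont)
    then show ?thesis using remove_sings_at_analytic[OF a] by (simp add: isCont_def)
  qed
  define q where "q y = remove_sings h (c y)" for y
  define N where "N = {y \<in> C. c y \<in> ball (c x) r}"
  show ?thesis
  proof (rule that)
    have "eventually (\<lambda>t. remove_sings h t = (q \<circ> inv_into C c) t) (nhds (c x))"
      using eventually_nhds_coordinate[OF C] by eventually_elim (simp add: q_def f_inv_into_f)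
    then have "(q \<circ> inv_into C c) analytic_on {c x}" using ra analytic_at_cong by blast
    then show "holomorphic_at S q x" using holomorphic_at_iff[OF C] by blast
    show "q x \<noteq> 0" using r0 by (simp add: q_def)
    show "openin X N" unfolding N_def
      by (rule topological_chart_open_preimage[OF local_coordinateD(1)[OF C(1)] open_ball])
    show "x \<in> N" using C r by (simp add: N_def)
    fix y assume y: "y \<in> N"
    then have "((\<lambda>t. f (inv_into C c t) / g (inv_into C c t)) \<longlongrightarrow> q y) (at (c y))"
      using lim[of "c y"] by (simp add: N_def q_def h_def[abs_def])
    then show "((\<lambda>u. f u / g u) \<longlongrightarrow> q y) (atin X y)"
      using y by (simp add: atin_coordinate[OF C(1)] filterlim_filtermap N_def)
  qed
qed

abbreviation divisor_cocycle ::
    "'x set \<times> ('x \<Rightarrow> complex) \<Rightarrow> 'x set \<times> ('x \<Rightarrow> complex) \<Rightarrow> 'x \<Rightarrow> complex mat" where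
  "divisor_cocycle \<equiv> \<lambda>(U, f) (W, g) x. mat 1 1 (\<lambda>_. Lim (atin X x) (\<lambda>y. f y / g y))"

text \<open>The limits are multiplicative, which gives the cocycle identity. The covering hypothesis
  says that \<open>D\<close> has local equations everywhere; for a Wronskian divisor the Wronskians
  in frames provide them.\<close>

lemma divisor_cocycle:
  assumes cov: "\<And>x. x \<in> topspace X \<Longrightarrow> \<exists>U f. local_equation S D U f \<and> x \<in> U"
  shows "cocycle S 1 {(U, f). local_equation S D U f} fst divisor_cocycle"
proof -
  have eq: "openin X U" "U \<subseteq> topspace X" if "local_equation S D U f" for U f
    using that openin_subset by (auto simp: local_equation_def)
  have lim: "\<exists>q N. holomorphic_at S q x \<and> q x \<noteq> 0 \<and> openin X N \<and> x \<in> N \<and>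
      (\<forall>y\<in>N. ((\<lambda>u. f u / g u) \<longlongrightarrow> q y) (atin X y))"
    if f: "local_equation S D U f" "x \<in> U" and g: "local_equation S D W g" "x \<in> W" for U W f g x
  proof -
    have f': "meromorphic_at S f x" "eventually (\<lambda>y. f y \<noteq> 0) (atin X x)" "order_at S f x = D x"
      and g': "meromorphic_at S g x" "eventually (\<lambda>y. g y \<noteq> 0) (atin X x)" "order_at S g x = D x"
      and x: "x \<in> topspace X"
      using f g eq by (auto simp: local_equation_def)
    have "order_at S f x = order_at S g x" using f'(3) g'(3) by simp
    from quotient_limit[OF f'(1,2) g'(1,2) this x] show ?thesis by metis
  qed
  have lim_eq: "Lim (atin X y) k = q" if "(k \<longlongrightarrow> q) (atin X y)" "y \<in> topspace X" for k :: "'x \<Rightarrow> complex" and q y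
    using tendsto_Lim[OF atin_neq_bot[OF that(2)] that(1)] .
  have 1: "holomorphic_GL S 1 (U \<inter> W) (\<lambda>x. mat 1 1 (\<lambda>_. Lim (atin X x) (\<lambda>y. f y / g y)))"
    if f: "local_equation S D U f" and g: "local_equation S D W g" for U W f g
    unfolding holomorphic_GL_iff
  proof
    fix x assume x: "x \<in> U \<inter> W"
    obtain q N where q: "holomorphic_at S q x" "q x \<noteq> 0" "openin X N" "x \<in> N"
      "\<And>y. y \<in> N \<Longrightarrow> ((\<lambda>u. f u / g u) \<longlongrightarrow> q y) (atin X y)"
      using lim[OF f _ g, of x] x by blast
    have L: "Lim (atin X y) (\<lambda>u. f u / g u) = q y" if "y \<in> N" for y
      using lim_eq[OF q(5)[OF that]] openin_subset[OF q(3)] that by blast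
    have "holomorphic_at S (\<lambda>x. Lim (atin X x) (\<lambda>y. f y / g y)) x"
      by (rule holomorphic_at_transform[OF q(1,3,4)]) (rule L)
    then show "mat 1 1 (\<lambda>_. Lim (atin X x) (\<lambda>y. f y / g y)) \<in> GL 1 \<and>
        holomorphic_mat_at 1 (\<lambda>x. mat 1 1 (\<lambda>_. Lim (atin X x) (\<lambda>y. f y / g y))) x"
      unfolding mat_1_GL using L[OF q(4)] q(2) by (simp add: holomorphic_mat_at_def)
  qed
  have 2: "Lim (atin X x) (\<lambda>y. g y / k y) * Lim (atin X x) (\<lambda>y. f y / g y) = Lim (atin X x) (\<lambda>y. f y / k y)"
    if f: "local_equation S D U f" "x \<in> U" and g: "local_equation S D W g" "x \<in> W"
      and k: "local_equation S D Y k" "x \<in> Y" for U W Y f g k x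
  proof -
    have x: "x \<in> topspace X" using eq(2)[OF f(1)] f(2) by blast
    obtain a where a: "((\<lambda>u. f u / g u) \<longlongrightarrow> a) (atin X x)" using lim[OF f g] by blast
    obtain b where b: "((\<lambda>u. g u / k u) \<longlongrightarrow> b) (atin X x)" using lim[OF g k] by blast
    \<comment> \<open>The middle equation may vanish at \<open>x\<close>, but it cancels on a
      punctured neighbourhood, which determines the limit.\<close>
    have "eventually (\<lambda>u. g u \<noteq> 0) (atin X x)" using g by (auto simp: local_equation_def)
    then have "eventually (\<lambda>u. g u / k u * (f u / g u) = f u / k u) (atin X x)"
      by eventually_elim simp
    with tendsto_mult[OF b a] have c: "((\<lambda>u. f u / k u) \<longlongrightarrow> b * a) (atin X x)"
      by (rule Lim_transform_eventually)
    show ?thesis using lim_eq[OF a x] lim_eq[OF b x] lim_eq[OF c x] by simp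
  qed
  have "(\<Union>i\<in>{(U, f). local_equation S D U f}. fst i) = topspace X"
  proof
    show "(\<Union>i\<in>{(U, f). local_equation S D U f}. fst i) \<subseteq> topspace X"
      by (auto dest!: eq(2))
    show "topspace X \<subseteq> (\<Union>i\<in>{(U, f). local_equation S D U f}. fst i)" using cov by force
  qed
  then show ?thesis
    unfolding cocycle_def using eq(1) 1 2 by (auto simp: mat_1_mult[simplified])
qed

end

section \<open>The bundle of a generic section\<close>

lemma cocycle_holomorphic:
  "cocycle S n I U \<Phi> \<Longrightarrow> i \<in> I \<Longrightarrow> j \<in> I \<Longrightarrow> holomorphic_GL S n (U i \<inter> U j) (\<Phi> i j)"
  by (simp add: cocycle_def)

text \<open>Telescoping product, the source of the cocycle identity for \<Phi>^A as well as of the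
  relations between two covers.\<close>

lemma minv_chain:
  assumes "A \<in> GL n" "B \<in> GL n" "C \<in> GL n"
  shows "(minv C * B) * (minv B * A) = minv C * A"
proof -
  note c = GL_carrier[OF assms(1)] GL_carrier[OF assms(2)] minv[OF assms(2)] minv(1)[OF assms(3)]
  have "(minv C * B) * (minv B * A) = minv C * (B * (minv B * A))"
    by (rule assoc_mult_mat[OF c(6,2) mult_carrier_mat[OF c(3,1)]])
  also have "B * (minv B * A) = B * minv B * A" by (rule assoc_mult_mat[OF c(2,3,1), symmetric])
  finally show ?thesis using c by simp
qed

text \<open>A translation of the coordinate leaves all derivatives unchanged. \<open>D\<close> is
  open so that the coefficients are locally constant and their derivatives vanish.\<close>

lemma chain_coeff_translation:
  assumes "open D" "\<And>t. t \<in> D \<Longrightarrow> l t = 1" "\<And>t. t \<in> D \<Longrightarrow> deriv \<phi> t = 1"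
  shows "t \<in> D \<Longrightarrow> chain_coeff l \<phi> k j t = (if k = j then 1 else 0)"
proof (induction k arbitrary: j t)
  case (Suc k)
  have "eventually (\<lambda>t. t \<in> D) (nhds t)" using assms(1) Suc.prems by (rule eventually_nhds_in_open)
  then have "eventually (\<lambda>t. chain_coeff l \<phi> k j t = (if k = j then 1 else 0)) (nhds t)"
    by eventually_elim (rule Suc.IH)
  then have "deriv (chain_coeff l \<phi> k j) t = deriv (\<lambda>_. if k = j then 1 else 0) t"
    by (rule deriv_cong_ev) simp
  then show ?case using Suc assms(3) by auto
qed (use assms in auto)

context projectively_flat
begin

text \<open>Holomorphy is part of the notion because the entries of the Wronskian matrix at a pole
  are meaningless and might be invertible by accident.\<close>

definition regular_at :: "('x \<Rightarrow> 'e) \<Rightarrow> ('x, 'e) local_frame \<Rightarrow> 'x \<Rightarrow> bool" where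
  "regular_at A F x \<longleftrightarrow> holomorphic_section_at S n A F x \<and> wronskian_matrix n A F x \<in> GL n"

lemma admissibleD:
  assumes "admissible_cover S n V P A I C"
  shows "(\<Union>i\<in>I. fdom (C i)) = topspace X" "i \<in> I \<Longrightarrow> frame (C i)"
    "i \<in> I \<Longrightarrow> j \<in> I \<Longrightarrow> i \<noteq> j \<Longrightarrow> x \<in> fdom (C i) \<Longrightarrow> x \<in> fdom (C j) \<Longrightarrow> \<not> bad_point A x"
  using assms by (auto simp: admissible_cover_def bad_point_def)

context
  fixes A
  assumes A: "meromorphic_section S n V A"
begin

text \<open>Components change by holomorphic coefficients and the Wronskian by a factor without
  zeros, so regularity belongs to the point and not to the frame.\<close>

lemma regular_frame_change:
  assumes r: "regular_at A F x" and F: "frame F" "x \<in> fdom F" and G: "frame G" "x \<in> fdom G"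
  shows "regular_at A G x"
proof -
  obtain N l T where ch: "frame_change n V G F N l T" "x \<in> N"
    using frame_change_exists[OF G F] by blast
  have N: "A y \<in> total V \<and> proj V (A y) = y" if "y \<in> N" for y
    using section_over[OF A] openin_subset[OF frame_changeD(3)[OF ch(1)]] that by blast
  have "holomorphic_at S (frame_component A G k) x" if k: "k < n" for k
  proof (rule holomorphic_at_transform[OF _ frame_changeD(3)[OF ch(1)] ch(2)])
    show "holomorphic_at S (\<lambda>y. l y * (\<Sum>j<n. T $$ (j, k) * frame_component A F j y)) x"
      using r frame_changeD(6)[OF ch] unfolding regular_at_def holomorphic_section_at_def
      by (intro holomorphic_at_mult holomorphic_at_sum holomorphic_at_const) auto
    show "frame_component A G k y = l y * (\<Sum>j<n. T $$ (j, k) * frame_component A F j y)" if "y \<in> N" for y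
      using frame_component_change[OF ch(1) that _ _ k] N[OF that] by blast
  qed
  then have "holomorphic_section_at S n A G x" by (simp add: holomorphic_section_at_def)
  moreover have "wronskian n A G x = frame_change_factor n G F l T x * wronskian n A F x"
    by (rule wronskian_change[OF ch]) (use r N in \<open>auto simp: regular_at_def\<close>)
  then have "wronskian n A G x \<noteq> 0"
    using frame_change_factor_nonzero[OF ch] r by (simp add: regular_at_def GL_iff_det wronskian_def)
  ultimately show ?thesis by (simp add: regular_at_def GL_iff_det wronskian_def)
qed

lemma regular_nearby:
  assumes r: "regular_at A F x" and F: "frame F" "x \<in> fdom F"
  obtains N where "openin X N" "x \<in> N" "N \<subseteq> fdom F" "\<And>y. y \<in> N \<Longrightarrow> regular_at A F y"
proof -
  have x: "x \<in> topspace X" using frameD(3) F by blast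
  have w: "holomorphic_at S (wronskian n A F) x" "wronskian n A F x \<noteq> 0"
    using wronskian_holomorphic[OF frameD(1)[OF F(1)] F(2)] r
    by (auto simp: regular_at_def GL_iff_det wronskian_def)
  have "eventually (regular_at A F) (atin X x)"
    using holomorphic_at_eventually_nonzero[OF w x] eventually_holomorphic_section[OF A F]
    by eventually_elim (simp add: regular_at_def GL_iff_det wronskian_def)
  then obtain M where M: "openin X M" "x \<in> M" "\<And>y. y \<in> M - {x} \<Longrightarrow> regular_at A F y"
    using x unfolding eventually_atin by blast
  show ?thesis
  proof (rule that)
    show "openin X (M \<inter> fdom F)" using M(1) frameD(4)[OF F(1)] by blast
    show "regular_at A F y" if "y \<in> M \<inter> fdom F" for y using M(3)[of y] r that by (cases "y = x") auto
  qed (use M F in auto)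
qed

text \<open>For frames related as in \<open>covers_agree\<close> the triangular left factor is the
  identity, so only the constant \<open>T\<close> survives.\<close>

lemma wronskian_matrix_translation:
  assumes F: "frame F" and G: "frame G" and N: "openin X N" "N \<subseteq> fdom F \<inter> fdom G"
    and z: "\<And>y. y \<in> N \<Longrightarrow> fcoord G y = fcoord F y + b" and T: "T \<in> GL n"
    and t: "\<And>e. e \<in> total V \<Longrightarrow> proj V e \<in> N \<Longrightarrow> ftriv G e = T\<^sup>T *\<^sub>v ftriv F e"
    and y: "y \<in> N" "holomorphic_section_at S n A F y"
  shows "wronskian_matrix n A G y = wronskian_matrix n A F y * T"
proof -
  have ch: "frame_change n V G F N (\<lambda>_. 1) T"
    unfolding frame_change_def
  proof (intro conjI ballI impI)
    fix e assume e: "e \<in> total V" "proj V e \<in> N"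
    show "ftriv F e \<in> carrier_vec n"
      using local_trivialization_carrier[OF frameD(2)[OF F] e(1)] e(2) N(2) by blast
    show "ftriv G e = 1 \<cdot>\<^sub>v (T\<^sup>T *\<^sub>v ftriv F e)" using t[OF e] by simp
  qed (use N T frameD(1)[OF F] frameD(1)[OF G] holomorphic_at_const in auto)
  let ?i = "finv G"
  have "frame_change_matrix n G F (\<lambda>_. 1) y = 1\<^sub>m n"
  proof (rule eq_matI)
    fix k j assume "k < dim_row (1\<^sub>m n :: complex mat)" "j < dim_col (1\<^sub>m n :: complex mat)"
    moreover have "chain_coeff ((\<lambda>_. 1) \<circ> ?i) (fcoord F \<circ> ?i) k j (fcoord G y) = (if k = j then 1 else 0)"
    proof (rule chain_coeff_translation[OF frame_change_open[OF ch]])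
      fix t assume t: "t \<in> fcoord G ` N"
      have "eventually (\<lambda>t. t \<in> fcoord G ` N) (nhds t)"
        using frame_change_open[OF ch] t by (rule eventually_nhds_in_open)
      then have "eventually (\<lambda>t. (fcoord F \<circ> ?i) t = t - b) (nhds t)"
      proof eventually_elim
        case (elim t)
        then obtain u where "u \<in> N" "t = fcoord G u" by blast
        then show ?case using frame_change_inv(1)[OF ch] z by simp
      qed
      then have "deriv (fcoord F \<circ> ?i) t = deriv (\<lambda>t. t - b) t" by (rule deriv_cong_ev) simp
      also have "\<dots> = 1" by (auto intro!: DERIV_imp_deriv derivative_eq_intros)
      finally show "deriv (fcoord F \<circ> ?i) t = 1" .
    qed (use y in auto)
    ultimately show "frame_change_matrix n G F (\<lambda>_. 1) y $$ (k, j) = 1\<^sub>m n $$ (k, j)"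
      by (simp add: frame_change_matrix_def)
  qed (simp_all add: frame_change_matrix_def)
  moreover have "wronskian_matrix n A G y = frame_change_matrix n G F (\<lambda>_. 1) y * wronskian_matrix n A F y * T"
    by (rule wronskian_matrix_change[OF ch y])
      (use section_over[OF A] openin_subset[OF N(1)] in blast)
  ultimately show ?thesis using left_mult_one_mat[OF wronskian_matrix_carrier[of n A F y]] by simp
qed

end

context
  fixes A
  assumes A: "meromorphic_section S n V A" and gen: "generic_section S n V P A"
begin

lemma good_point_regular: "\<not> bad_point A x \<Longrightarrow> frame F \<Longrightarrow> x \<in> fdom F \<Longrightarrow> regular_at A F x"
  using good_point_frame[OF A gen] by (simp add: regular_at_def)

lemma eventually_regular:
  assumes F: "frame F" "x \<in> fdom F"
  shows "eventually (regular_at A F) (atin X x)"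
  using eventually_holomorphic_section[OF A F] eventually_wronskian_GL[OF A gen F]
  by eventually_elim (simp add: regular_at_def)

lemma holomorphic_quotient:
  assumes F: "frame F" "x \<in> fdom F" and G: "frame G" "x \<in> fdom G" and r: "regular_at A F x"
  shows "minv (wronskian_matrix n A G x) * wronskian_matrix n A F x \<in> GL n"
    and "holomorphic_mat_at n (\<lambda>x. minv (wronskian_matrix n A G x) * wronskian_matrix n A F x) x"
proof -
  have rG: "regular_at A G x" by (rule regular_frame_change[OF A r F G])
  obtain N where N: "openin X N" "x \<in> N" "\<And>y. y \<in> N \<Longrightarrow> regular_at A G y"
    by (rule regular_nearby[OF A rG G]) (rule that)
  have g: "wronskian_matrix n A G y \<in> GL n" if "y \<in> N" for y
    using N(3)[OF that] by (simp add: regular_at_def)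
  show "minv (wronskian_matrix n A G x) * wronskian_matrix n A F x \<in> GL n"
    using r rG by (intro GL_mult minv_GL) (auto simp: regular_at_def)
  show "holomorphic_mat_at n (\<lambda>x. minv (wronskian_matrix n A G x) * wronskian_matrix n A F x) x"
  proof (rule holomorphic_mat_at_mult[OF _ _ N(1,2)])
    show "holomorphic_mat_at n (\<lambda>x. minv (wronskian_matrix n A G x)) x"
      using rG by (intro holomorphic_mat_at_minv[OF _ N(1,2)] g wronskian_matrix_holomorphic frameD(1)[OF G(1)] G(2))
        (auto simp: regular_at_def)
    show "holomorphic_mat_at n (wronskian_matrix n A F) x"
      using r by (intro wronskian_matrix_holomorphic frameD(1)[OF F(1)] F(2)) (simp add: regular_at_def)
    show "minv (wronskian_matrix n A G y) \<in> carrier_mat n n" if "y \<in> N" for y using minv(1)[OF g[OF that]] .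
  qed simp
qed

text \<open>At regular points the convention for \<open>i = j\<close> agrees with the quotient, so
  the case distinction in the definition disappears.\<close>

lemma wronskian_cocycle_regular:
  assumes "regular_at A (C i) x" "regular_at A (C j) x"
  shows "wronskian_cocycle n A C i j x = minv (wronskian_matrix n A (C j) x) * wronskian_matrix n A (C i) x"
  using assms minv by (auto simp: wronskian_cocycle_def regular_at_def)

lemma admissible_regular:
  assumes adm: "admissible_cover S n V P A I C" and ij: "i \<in> I" "j \<in> I" "i \<noteq> j"
    and x: "x \<in> fdom (C i)" "x \<in> fdom (C j)" and F: "frame F" "x \<in> fdom F"
  shows "regular_at A F x"
  using good_point_regular admissibleD(3)[OF adm ij x] F by blast

text \<open>Unless all three indices coincide, \<open>x\<close> lies in the overlap of two
  differently indexed sets, where admissibility makes every frame regular; then the telescoping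
  product applies. With equal indices all matrices are the identity by convention.\<close>

lemma wronskian_cocycle_cocycle:
  assumes adm: "admissible_cover S n V P A I C"
  shows "cocycle S n I (\<lambda>i. fdom (C i)) (wronskian_cocycle n A C)"
  unfolding cocycle_def
proof (intro conjI ballI)
  note fr = admissibleD(2)[OF adm]
  show "openin X (fdom (C i))" if "i \<in> I" for i using frameD(4)[OF fr[OF that]] .
  show "(\<Union>i\<in>I. fdom (C i)) = topspace X" by (rule admissibleD(1)[OF adm])
  show "holomorphic_GL S n (fdom (C i) \<inter> fdom (C j)) (wronskian_cocycle n A C i j)"
    if ij: "i \<in> I" "j \<in> I" for i j
    unfolding holomorphic_GL_iff
  proof
    fix x assume x: "x \<in> fdom (C i) \<inter> fdom (C j)"
    show "wronskian_cocycle n A C i j x \<in> GL n \<and> holomorphic_mat_at n (wronskian_cocycle n A C i j) x"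
    proof (cases "i = j")
      case True
      then have "wronskian_cocycle n A C i j = (\<lambda>_. 1\<^sub>m n)" by (simp add: wronskian_cocycle_def[abs_def])
      then show ?thesis by (simp add: GL_one holomorphic_mat_at_const)
    next
      case False
      then have "wronskian_cocycle n A C i j = (\<lambda>x. minv (wronskian_matrix n A (C j) x) * wronskian_matrix n A (C i) x)"
        by (simp add: wronskian_cocycle_def[abs_def])
      then show ?thesis
        using holomorphic_quotient[of "C i" x "C j"] fr ij x admissible_regular[OF adm ij False, of x "C i"] by simp
    qed
  qed
  fix i j k x assume ijk: "i \<in> I" "j \<in> I" "k \<in> I" and x: "x \<in> fdom (C i) \<inter> fdom (C j) \<inter> fdom (C k)"
  let ?W = "wronskian_cocycle n A C"
  show "?W j k x * ?W i j x = ?W i k x"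
  proof (cases "i = j \<and> j = k")
    case True
    then show ?thesis by (simp add: wronskian_cocycle_def)
  next
    case False
    then have r: "regular_at A F x" if "frame F" "x \<in> fdom F" for F
      using admissible_regular[OF adm ijk(1,2) _ _ _ that] admissible_regular[OF adm ijk(2,3) _ _ _ that] x
      by blast
    have ri: "regular_at A (C i) x" "regular_at A (C j) x" "regular_at A (C k) x"
      using r fr ijk x by auto
    show ?thesis
      unfolding wronskian_cocycle_regular[where C = C, OF ri(2,3)] wronskian_cocycle_regular[where C = C, OF ri(1,2)]
        wronskian_cocycle_regular[where C = C, OF ri(1,3)]
      using ri by (intro minv_chain[where n = n]) (simp_all add: regular_at_def)
  qed
qed

lemma local_equation_wronskian:
  assumes F: "frame F"
  shows "local_equation S (wronskian_divisor S n V P A) (fdom F) (wronskian n A F)"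
  unfolding local_equation_def
  using frameD(4)[OF F] wronskian_meromorphic_at[OF A F] generic_eventually_nonzero[OF A gen F]
    wronskian_divisor_eq[OF A gen F] by simp

lemma divisor_cocycle_wronskian:
  "cocycle S 1 {(U, f). local_equation S (wronskian_divisor S n V P A) U f} fst divisor_cocycle"
  by (rule divisor_cocycle) (use local_equation_wronskian frame_exists in metis)

end

text \<open>Both \<open>w(A)\<close> and \<open>w(B)\<close> are multiplied by the same factor under a change of frame.\<close>

lemma det_wronskian_cocycle:
  assumes A: "meromorphic_section S n V A" "generic_section S n V P A"
    and B: "meromorphic_section S n V B" "generic_section S n V P B"
    and adm: "admissible_cover S n V P A I C" and ij: "i \<in> I" "j \<in> I"
    and x: "x \<in> fdom (C i)" "x \<in> fdom (C j)"
  shows "det (wronskian_cocycle n A C i j x) =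
    Lim (atin X x) (\<lambda>y. wronskian n B (C i) y / wronskian n B (C j) y)"
proof -
  have fr: "frame (C i)" "frame (C j)" using admissibleD(2)[OF adm] ij by auto
  have tx: "x \<in> topspace X" using frameD(3)[OF fr(1)] x(1) by blast
  have nz: "eventually (\<lambda>y. wronskian n B (C j) y \<noteq> 0) (atin X x)"
    by (rule generic_eventually_nonzero[OF B fr(2) x(2)])
  show ?thesis
  proof (cases "i = j")
    \<comment> \<open>The domain may contain singular points of \<open>A\<close>, so the identity
      matrix comes from the convention in \<open>wronskian_cocycle\<close>; the quotient for
      \<open>B\<close> is 1 wherever the Wronskian of \<open>B\<close> is nonzero.\<close>
    case True
    have "eventually (\<lambda>y. 1 = wronskian n B (C i) y / wronskian n B (C j) y) (atin X x)"
      using nz by eventually_elim (simp add: True)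
    then have "((\<lambda>y. wronskian n B (C i) y / wronskian n B (C j) y) \<longlongrightarrow> 1) (atin X x)"
      by (rule Lim_transform_eventually[OF tendsto_const])
    then show ?thesis using tendsto_Lim[OF atin_neq_bot[OF tx]] True by (simp add: wronskian_cocycle_def)
  next
    case False
    obtain N l T where ch: "frame_change n V (C i) (C j) N l T" "x \<in> N"
      using frame_change_exists[OF fr(1) x(1) fr(2) x(2)] by blast
    let ?r = "frame_change_factor n (C i) (C j) l T"
    \<comment> \<open>\<open>B\<close> may be singular at \<open>x\<close>, so its quotient is
      compared with the frame factor nearby and extended by continuity. \<open>A\<close> is regular
      at \<open>x\<close> by admissibility and can be evaluated there.\<close>
    have "eventually (\<lambda>y. ?r y = wronskian n B (C i) y / wronskian n B (C j) y) (atin X x)"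
      using nz eventually_wronskian_change[OF B(1) ch fr(2)] by eventually_elim simp
    then have "((\<lambda>y. wronskian n B (C i) y / wronskian n B (C j) y) \<longlongrightarrow> ?r x) (atin X x)"
      by (rule Lim_transform_eventually[OF holomorphic_at_tendsto[OF frame_change_factor_holomorphic[OF ch] tx]])
    then have L: "Lim (atin X x) (\<lambda>y. wronskian n B (C i) y / wronskian n B (C j) y) = ?r x"
      by (rule tendsto_Lim[OF atin_neq_bot[OF tx]])
    have r: "regular_at A (C i) x" "regular_at A (C j) x"
      using admissible_regular[OF A adm ij False x] fr x by auto
    have "wronskian n A (C i) x = ?r x * wronskian n A (C j) x"
      by (rule wronskian_change[OF ch])
        (use r section_over[OF A(1)] openin_subset[OF frame_changeD(3)[OF ch(1)]] in \<open>auto simp: regular_at_def\<close>)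
    moreover have "det (wronskian_cocycle n A C i j x) =
        inverse (wronskian n A (C j) x) * wronskian n A (C i) x"
      using wronskian_cocycle_regular[OF A, where C = C, OF r] r det_minv minv(1)
      by (auto simp: regular_at_def wronskian_def Determinant.det_mult[of _ n])
    moreover have "wronskian n A (C j) x \<noteq> 0" using r by (simp add: regular_at_def GL_iff_det wronskian_def)
    ultimately show ?thesis using L by simp
  qed
qed

text \<open>The Wronskians of \<open>B\<close> in the frames \<open>C i\<close> are local equations
  of div(B). Their transition functions are the determinants of \<Phi>^A, so the determinant bundle
  is glued from a subfamily of the data of \<open>divisor_bundle\<close>.\<close>

theorem det_wronskian_bundle:
  fixes I :: "'i set"
  assumes A: "meromorphic_section S n V A" "generic_section S n V P A"
    and adm: "admissible_cover S n V P A I C"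
  shows "is_wronskian_line_bundle S n V P (det_bundle n (wronskian_bundle n A I C))"
proof -
  let ?U = "\<lambda>i. fdom (C i)" and ?\<Phi> = "wronskian_cocycle n A C"
  let ?E = "cocycle_bundle n I ?U ?\<Phi>"
  let ?D = "\<lambda>(U', \<psi>) (W, \<chi>) x. mat 1 1 (\<lambda>_. det (transition_matrix n ?E \<psi> \<chi> x))"
  have \<Phi>: "cocycle S n I ?U ?\<Phi>" by (rule wronskian_cocycle_cocycle[OF A adm])
  have D: "cocycle S 1 (trivs ?E) fst ?D" by (rule det_cocycle[OF riemann \<Phi>])
  have eq: "det_bundle n (wronskian_bundle n A I C) = cocycle_bundle 1 (trivs ?E) fst ?D"
    by (simp add: det_bundle_def wronskian_bundle_def)
  \<comment> \<open>\<open>det_bundle\<close> is indexed by trivializations instead of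
    \<open>I\<close>; \<open>idx\<close> recovers an index for each of them.\<close>
  define idx where "idx = inv_into I (\<lambda>i. (?U i, \<lambda>e :: 'x \<times> ('i \<Rightarrow> complex vec). snd e i))"
  have idx: "idx t \<in> I" "t = (?U (idx t), \<lambda>e. snd e (idx t))" if "t \<in> trivs ?E" for t
    using that inv_into_into[of t "\<lambda>i. (?U i, \<lambda>e. snd e i)" I] f_inv_into_f[of t "\<lambda>i. (?U i, \<lambda>e. snd e i)" I]
    unfolding cocycle_bundle_trivs idx_def by auto
  have Dij: "?D t t' x = mat 1 1 (\<lambda>_. det (?\<Phi> (idx t) (idx t') x))"
    if "t \<in> trivs ?E" "t' \<in> trivs ?E" "x \<in> fst t" "x \<in> fst t'" for t t' x
  proof -
    have "fst t = ?U (idx t)" "fst t' = ?U (idx t')" using idx(2) that by (metis fst_conv)+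
    then have "transition_matrix n ?E (\<lambda>e. snd e (idx t)) (\<lambda>e. snd e (idx t')) x = ?\<Phi> (idx t) (idx t') x"
      using that idx(1) by (intro transition_matrix_cocycle_bundle[OF \<Phi>]) auto
    moreover have "snd t = (\<lambda>e. snd e (idx t))" "snd t' = (\<lambda>e. snd e (idx t'))"
      using idx(2) that by (metis snd_conv)+
    ultimately show ?thesis by (simp add: case_prod_beta)
  qed
  have "bundle_iso S 1 (cocycle_bundle 1 (trivs ?E) fst ?D) (divisor_bundle S (wronskian_divisor S n V P B))"
    if B: "meromorphic_section S n V B" "generic_section S n V P B" for B
  proof -
    let ?J = "{(U, f). local_equation S (wronskian_divisor S n V P B) U f}"
    define w where "w t = (?U (idx t), wronskian n B (C (idx t)))" for t
    have \<Psi>: "cocycle S 1 ?J fst divisor_cocycle" by (rule divisor_cocycle_wronskian[OF B])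
    have w: "w t \<in> ?J" "fst (w t) = fst t" if "t \<in> trivs ?E" for t
      using local_equation_wronskian[OF B admissibleD(2)[OF adm idx(1)[OF that]]] idx(2)[OF that]
      by (auto simp: w_def dest: arg_cong[of _ _ fst])
    have "bundle_iso S 1 (cocycle_bundle 1 (trivs ?E) fst ?D) (cocycle_bundle 1 ?J fst divisor_cocycle)"
    \<comment> \<open>Since \<open>w t\<close> is itself an index of the divisor cocycle, the
      intertwining function is that cocycle between \<open>u\<close> and \<open>w t\<close>, and
      both relations become cocycle identities.\<close>
    proof (rule cocycle_bundle_iso[OF D \<Psi>, where g = "\<lambda>t u. divisor_cocycle u (w t)"])
      fix t u assume t: "t \<in> trivs ?E" and u: "u \<in> ?J"
      have "holomorphic_GL S 1 (fst u \<inter> fst (w t)) (divisor_cocycle u (w t))"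
        by (rule cocycle_holomorphic[OF \<Psi> u w(1)[OF t]])
      then show "holomorphic_GL S 1 (fst t \<inter> fst u) (divisor_cocycle u (w t))"
        using w(2)[OF t] by (simp add: Int_commute)
    next
      fix t t' u x assume t: "t \<in> trivs ?E" "t' \<in> trivs ?E" and u: "u \<in> ?J" and x: "x \<in> fst t \<inter> fst t' \<inter> fst u"
      have xi: "x \<in> ?U (idx t)" "x \<in> ?U (idx t')" using x w(2)[OF t(1)] w(2)[OF t(2)] by (auto simp: w_def)
      have "?D t t' x = divisor_cocycle (w t) (w t') x"
        using Dij[OF t] x det_wronskian_cocycle[OF A B adm idx(1)[OF t(1)] idx(1)[OF t(2)] xi]
        by (simp add: w_def)
      then show "divisor_cocycle u (w t') x = ?D t t' x * divisor_cocycle u (w t) x"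
        using cocycle_mult[OF \<Psi> u w(1)[OF t(1)] w(1)[OF t(2)], of x] x w(2)[OF t(1)] w(2)[OF t(2)] by simp
    next
      fix t u u' x assume t: "t \<in> trivs ?E" and u: "u \<in> ?J" "u' \<in> ?J" and x: "x \<in> fst t \<inter> fst u \<inter> fst u'"
      show "divisor_cocycle u (w t) x = divisor_cocycle u' (w t) x * divisor_cocycle u u' x"
        using cocycle_mult[OF \<Psi> u w(1)[OF t], of x] x w(2)[OF t] by simp
    qed
    then show ?thesis by (simp add: divisor_bundle_def)
  qed
  then show ?thesis
    unfolding is_wronskian_line_bundle_def eq using cocycle_bundle_holomorphic[OF D] by blast
qed

text \<open>The intertwining matrices are the quotients W(A_i)^-1 W(A'_j). The relations are
  telescoping; the content is that these quotients extend holomorphically and invertibly over the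
  singular points of \<open>A\<close>, and there \<open>covers_agree\<close> enters.\<close>

theorem wronskian_bundle_cover_independent:
  assumes A: "meromorphic_section S n V A" "generic_section S n V P A"
    and adm: "admissible_cover S n V P A I C" and adm': "admissible_cover S n V P A J C'"
    and agree: "covers_agree S n V P A I C J C'"
  shows "bundle_iso S n (wronskian_bundle n A I C) (wronskian_bundle n A J C')"
proof -
  let ?W = "\<lambda>i. wronskian_matrix n A (C i)" and ?W' = "\<lambda>j. wronskian_matrix n A (C' j)"
  note fr = admissibleD(2)[OF adm] and fr' = admissibleD(2)[OF adm']
  define tr where "tr i j x T \<longleftrightarrow> (\<exists>N b. openin X N \<and> x \<in> N \<and> N \<subseteq> fdom (C i) \<inter> fdom (C' j) \<and>
           (\<forall>y\<in>N. fcoord (C' j) y = fcoord (C i) y + b) \<and> T \<in> GL n \<and>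
           (\<forall>e\<in>total V. proj V e \<in> N \<longrightarrow> ftriv (C' j) e = T\<^sup>T *\<^sub>v ftriv (C i) e))" for i j x T
  \<comment> \<open>At a singular point the value is a constant matrix supplied by
    \<open>covers_agree\<close>. The quotient equals this matrix on a punctured neighbourhood, so
    the choice fills in a removable singularity.\<close>
  define g where "g i j x = (if regular_at A (C i) x then minv (?W i x) * ?W' j x else (SOME T. tr i j x T))" for i j x
  have greg: "g i j x = minv (?W i x) * ?W' j x" if "regular_at A (C i) x" for i j x
    using that by (simp add: g_def)
  have g: "holomorphic_GL S n (fdom (C i) \<inter> fdom (C' j)) (g i j)" if ij: "i \<in> I" "j \<in> J" for i j
    unfolding holomorphic_GL_iff
  proof
    fix x assume x: "x \<in> fdom (C i) \<inter> fdom (C' j)"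
    note F = fr[OF ij(1)] and G = fr'[OF ij(2)]
    have tx: "x \<in> topspace X" using frameD(3)[OF F] x by blast
    show "g i j x \<in> GL n \<and> holomorphic_mat_at n (g i j) x"
    proof (cases "regular_at A (C i) x")
      case True
      have rG: "regular_at A (C' j) x" using regular_frame_change[OF A(1) True F _ G] x by blast
      obtain N where N: "openin X N" "x \<in> N" "\<And>y. y \<in> N \<Longrightarrow> regular_at A (C i) y"
        by (rule regular_nearby[OF A(1) True F]) (use x in blast, rule that)
      have q: "minv (?W i x) * ?W' j x \<in> GL n" "holomorphic_mat_at n (\<lambda>x. minv (?W i x) * ?W' j x) x"
        using holomorphic_quotient[OF A G _ F _ rG] x by auto
      have "holomorphic_mat_at n (g i j) x"
        by (rule holomorphic_mat_at_transform[OF q(2) N(1,2)]) (rule greg[OF N(3)])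
      then show ?thesis using greg[OF True] q(1) by simp
    next
      case False
      then have "bad_point A x" using good_point_regular[OF A _ F] x by blast
      then have "wronskian_divisor S n V P A x \<noteq> 0 \<or> section_pole S n V A x" by (simp add: bad_point_def)
      from agree[unfolded covers_agree_def, rule_format, OF ij x this]
      have "\<exists>T. tr i j x T" unfolding tr_def by (elim exE) (intro exI)
      then have trg: "tr i j x (g i j x)" unfolding g_def using False by (simp add: someI_ex)
      define T where "T = g i j x"
      obtain N b where N: "openin X N" "x \<in> N" "N \<subseteq> fdom (C i) \<inter> fdom (C' j)"
        "\<And>y. y \<in> N \<Longrightarrow> fcoord (C' j) y = fcoord (C i) y + b" and T: "T \<in> GL n"
        and t: "\<And>e. e \<in> total V \<Longrightarrow> proj V e \<in> N \<Longrightarrow> ftriv (C' j) e = T\<^sup>T *\<^sub>v ftriv (C i) e"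
        using trg unfolding tr_def T_def by metis
      obtain M where M: "openin X M" "x \<in> M" "\<And>y. y \<in> M - {x} \<Longrightarrow> regular_at A (C i) y"
        using eventually_regular[OF A F, of x] x tx unfolding eventually_atin by blast
      \<comment> \<open>Off \<open>x\<close> the section is regular and W(A'_j) = W(A_i) T, so the
        quotient cancels to \<open>T\<close>; at \<open>x\<close> the value is \<open>T\<close> by
        choice.\<close>
      have gT: "g i j y = T" if y: "y \<in> M \<inter> N" for y
      proof (cases "y = x")
        case False
        then have r: "regular_at A (C i) y" using M(3) y by blast
        have c: "?W i y \<in> GL n" "T \<in> carrier_mat n n" using r T GL_carrier by (auto simp: regular_at_def)
        have "?W' j y = ?W i y * T"
          by (rule wronskian_matrix_translation[OF A(1) F G N(1,3,4) T t])
             (use r y in \<open>auto simp: regular_at_def\<close>)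
        then have "g i j y = minv (?W i y) * (?W i y * T)" using greg[OF r] by simp
        also have "\<dots> = minv (?W i y) * ?W i y * T"
          using minv(1)[OF c(1)] GL_carrier[OF c(1)] c(2) by (intro assoc_mult_mat[symmetric])
        finally show ?thesis using minv(3)[OF c(1)] c(2) by simp
      qed (simp add: T_def)
      have "openin X (M \<inter> N)" "x \<in> M \<inter> N" using M N by auto
      then have "holomorphic_mat_at n (g i j) x"
        by (rule holomorphic_mat_at_transform[OF holomorphic_mat_at_const]) (rule gT)
      then show ?thesis using T by (simp add: T_def)
    qed
  qed
  have reg: "regular_at A (C i) x" if "regular_at A F x" "frame F" "x \<in> fdom F" "i \<in> I" "x \<in> fdom (C i)" for F i x
    using regular_frame_change[OF A(1) that(1-3) fr[OF that(4)] that(5)] .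
  have reg': "regular_at A (C' j) x" if "regular_at A F x" "frame F" "x \<in> fdom F" "j \<in> J" "x \<in> fdom (C' j)" for F j x
    using regular_frame_change[OF A(1) that(1-3) fr'[OF that(4)] that(5)] .
  have gG: "g i j x \<in> carrier_mat n n" if "i \<in> I" "j \<in> J" "x \<in> fdom (C i)" "x \<in> fdom (C' j)" for i j x
    using g[OF that(1,2)] that(3,4) GL_carrier by (auto simp: holomorphic_GL_def)
  show ?thesis unfolding wronskian_bundle_def
  proof (rule cocycle_bundle_iso[OF wronskian_cocycle_cocycle[OF A adm] wronskian_cocycle_cocycle[OF A adm'] g])
    fix i i' j x assume i: "i \<in> I" "i' \<in> I" "j \<in> J" and x: "x \<in> fdom (C i) \<inter> fdom (C i') \<inter> fdom (C' j)"
    show "g i' j x = wronskian_cocycle n A C i i' x * g i j x"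
    \<comment> \<open>Equal indices leave the identity matrix, even at a singular point; for
      different indices admissibility makes \<open>x\<close> regular and the chosen values of
      \<open>g\<close> do not occur.\<close>
    proof (cases "i = i'")
      case True
      have "g i' j x \<in> carrier_mat n n" using gG[OF i(2,3)] x by blast
      then show ?thesis using True by (simp add: wronskian_cocycle_def)
    next
      case False
      have r: "regular_at A (C i) x" "regular_at A (C i') x"
        using admissible_regular[OF A adm i(1,2) False] fr i x by auto
      have r': "regular_at A (C' j) x" using reg'[OF r(1) fr[OF i(1)] _ i(3)] x by blast
      show ?thesis
        unfolding greg[OF r(1)] greg[OF r(2)] wronskian_cocycle_regular[OF A, where C = C, OF r]
        using r r' by (intro minv_chain[where n = n, symmetric]) (auto simp: regular_at_def)
    qed
  next
    fix i j j' x assume i: "i \<in> I" "j \<in> J" "j' \<in> J" and x: "x \<in> fdom (C i) \<inter> fdom (C' j) \<inter> fdom (C' j')"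
    show "g i j x = g i j' x * wronskian_cocycle n A C' j j' x"
    proof (cases "j = j'")
      case True
      have "g i j' x \<in> carrier_mat n n" using gG[OF i(1,3)] x by blast
      then show ?thesis using True by (simp add: wronskian_cocycle_def)
    next
      case False
      have r: "regular_at A (C' j) x" "regular_at A (C' j') x"
        using admissible_regular[OF A adm' i(2,3) False] fr' i x by auto
      have r': "regular_at A (C i) x" using reg[OF r(1) fr'[OF i(2)] _ i(1)] x by blast
      show ?thesis
        unfolding greg[OF r'] wronskian_cocycle_regular[OF A, where C = C', OF r]
        using r r' by (intro minv_chain[where n = n, symmetric]) (auto simp: regular_at_def)
    qed
  qed
qed

end

section \<open>The Riemann sphere\<close>

text \<open>A chart is recognized from its inverse \<phi>, an open continuous injection of the
  plane, which is the convenient datum on the sphere. It also identifies \<open>inv_into\<close>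
  with \<phi>, so that later computations see the parametrization itself.\<close>

lemma topological_chart_parametrization:
  assumes op: "\<And>D. open D \<Longrightarrow> openin X (\<phi> ` D)" and cont: "\<And>N. openin X N \<Longrightarrow> open (\<phi> -` N)"
    and z: "\<And>u. z (\<phi> u) = u"
  shows "topological_chart X (range \<phi>) z" "z ` range \<phi> = UNIV" "inv_into (range \<phi>) z = \<phi>"
proof -
  show U: "z ` range \<phi> = UNIV" by (simp add: image_image z)
  have inj: "inj_on z (range \<phi>)" using z by (auto intro!: inj_onI)
  show "inv_into (range \<phi>) z = \<phi>"
  proof
    fix u
    have "inv_into (range \<phi>) z (z (\<phi> u)) = \<phi> u" using inj by (intro inv_into_f_f) auto
    then show "inv_into (range \<phi>) z u = \<phi> u" by (simp add: z)
  qed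
  have o: "openin X (range \<phi>)" using op[of UNIV] by simp
  then have t: "topspace (subtopology X (range \<phi>)) = range \<phi>"
    using openin_subset[OF o] by (simp add: Int_absorb1)
  have "homeomorphic_maps (subtopology X (range \<phi>)) euclidean z \<phi>"
    unfolding homeomorphic_maps_def
  proof (intro conjI ballI)
    show "continuous_map (subtopology X (range \<phi>)) euclidean z"
      unfolding continuous_map_def
    proof (intro conjI allI impI)
      fix D :: "complex set" assume "openin euclidean D"
      then have "openin X (\<phi> ` D)" using op by simp
      moreover have "{x \<in> topspace (subtopology X (range \<phi>)). z x \<in> D} = \<phi> ` D \<inter> range \<phi>"
        unfolding t using z by (auto simp: image_iff) (metis z)
      ultimately show "openin (subtopology X (range \<phi>)) {x \<in> topspace (subtopology X (range \<phi>)). z x \<in> D}"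
        by (auto simp: openin_subtopology)
    qed simp
    have "continuous_map euclidean X \<phi>"
      unfolding continuous_map_def
    proof (intro conjI allI impI)
      show "\<phi> \<in> topspace euclidean \<rightarrow> topspace X" using openin_subset[OF o] by auto
      fix N assume "openin X N"
      then show "openin euclidean {x \<in> topspace euclidean. \<phi> x \<in> N}"
        using cont[of N] by (simp add: vimage_def)
    qed
    then show "continuous_map euclidean (subtopology X (range \<phi>)) \<phi>"
      by (rule continuous_map_into_subtopology) simp
  qed (use t z in auto)
  then have "homeomorphic_map (subtopology X (range \<phi>)) euclidean z"
    by (rule homeomorphic_maps_imp_map)
  then show "topological_chart X (range \<phi>) z"
    using o U by (simp add: topological_chart_def)
qed

text \<open>The sphere is modelled by \<open>complex option\<close> with \<open>None\<close> as
  infinity; \<open>u\<close> is the coordinate 1/z around it.\<close>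

definition P1_param :: "complex \<Rightarrow> complex option" where
  "P1_param u = (if u = 0 then None else Some (1 / u))"

definition P1_coord0 :: "complex option \<Rightarrow> complex" where
  "P1_coord0 p = (case p of Some z \<Rightarrow> z | None \<Rightarrow> 0)"

text \<open>The value \<open>1 / 0 = 0\<close> at \<open>Some 0\<close> lies outside the chart.\<close>

definition P1_coord1 :: "complex option \<Rightarrow> complex" where
  "P1_coord1 p = (case p of Some z \<Rightarrow> 1 / z | None \<Rightarrow> 0)"

text \<open>Final topology for the two parametrizations, that is, two planes glued along z =
  1/u.\<close>

definition P1_top :: "complex option topology" where
  "P1_top = topology (\<lambda>U. open (Some -` U) \<and> open (P1_param -` U))"

definition P1 :: "complex option surface" where
  "P1 = \<lparr>surf_top = P1_top,
     charts = {(range Some, P1_coord0), (range P1_param, P1_coord1)}\<rparr>"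

lemma openin_P1: "openin P1_top U \<longleftrightarrow> open (Some -` U) \<and> open (P1_param -` U)"
proof -
  have "istopology (\<lambda>U. open (Some -` U) \<and> open (P1_param -` U))"
    unfolding istopology_def by (auto simp: vimage_Union intro: open_Int open_UN simp del: vimage_Int simp: vimage_Int[of Some] vimage_Int[of P1_param])
  then show ?thesis by (simp add: P1_top_def)
qed

lemma topspace_P1: "topspace P1_top = UNIV"
  using openin_P1[of UNIV] openin_subset[of P1_top UNIV] by auto

lemma open_inversion: "open D \<Longrightarrow> open {z :: complex. z \<noteq> 0 \<and> 1 / z \<in> D}"
proof -
  assume "open D"
  then have "open ((- {0}) \<inter> (\<lambda>z. 1 / z :: complex) -` D)"
    by (intro continuous_open_preimage continuous_intros) auto
  moreover have "(- {0}) \<inter> (\<lambda>z. 1 / z :: complex) -` D = {z. z \<noteq> 0 \<and> 1 / z \<in> D}" by auto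
  ultimately show ?thesis by simp
qed

lemma P1_param_coord: "P1_coord1 (P1_param u) = u" "P1_coord0 (Some u) = u"
  by (simp_all add: P1_coord1_def P1_coord0_def P1_param_def)

lemma P1_param_eq_Some: "P1_param u = Some z \<longleftrightarrow> z \<noteq> 0 \<and> u = 1 / z"
  by (auto simp: P1_param_def)

lemma inj_P1_param: "inj P1_param"
  by (rule inj_on_inverseI[where g = P1_coord1]) (rule P1_param_coord)

lemma P1_open_image:
  assumes "open D" shows "openin P1_top (Some ` D)" "openin P1_top (P1_param ` D)"
proof -
  have 1: "Some -` Some ` D = D" "P1_param -` Some ` D = {z. z \<noteq> 0 \<and> 1 / z \<in> D}"
    by (auto simp: P1_param_def split: if_splits)
  have "Some z \<in> P1_param ` D \<longleftrightarrow> z \<noteq> 0 \<and> 1 / z \<in> D" for z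
    using P1_param_eq_Some[of _ z] by (auto simp: image_iff) metis+
  then have 2: "Some -` P1_param ` D = {z. z \<noteq> 0 \<and> 1 / z \<in> D}" by (simp add: vimage_def)
  have 3: "P1_param -` P1_param ` D = D" using inj_P1_param by (rule inj_vimage_image_eq)
  show "openin P1_top (Some ` D)" unfolding openin_P1 1
    using assms open_inversion[OF assms] by blast
  show "openin P1_top (P1_param ` D)" unfolding openin_P1 2 3
    using assms open_inversion[OF assms] by blast
qed

lemma P1_charts:
  shows "topological_chart P1_top (range Some) P1_coord0" "P1_coord0 ` range Some = UNIV"
    "inv_into (range Some) P1_coord0 = Some"
    "topological_chart P1_top (range P1_param) P1_coord1" "P1_coord1 ` range P1_param = UNIV"
    "inv_into (range P1_param) P1_coord1 = P1_param"
proof -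
  have "open (Some -` N)" "open (P1_param -` N)" if "openin P1_top N" for N
    using that by (simp_all add: openin_P1)
  note 0 = topological_chart_parametrization[OF P1_open_image(1) this(1) P1_param_coord(2)]
    and 1 = topological_chart_parametrization[OF P1_open_image(2) this(2) P1_param_coord(1)]
  show "topological_chart P1_top (range Some) P1_coord0" "P1_coord0 ` range Some = UNIV"
    "inv_into (range Some) P1_coord0 = Some" using 0 by blast+
  show "topological_chart P1_top (range P1_param) P1_coord1" "P1_coord1 ` range P1_param = UNIV"
    "inv_into (range P1_param) P1_coord1 = P1_param" using 1 by blast+
qed

lemma range_P1_param: "range P1_param = - {Some 0}"
proof
  show "- {Some 0} \<subseteq> range P1_param"
  proof
    fix p :: "complex option" assume "p \<in> - {Some 0}"
    then have "p = P1_param (P1_coord1 p)" by (cases p) (auto simp: P1_coord1_def P1_param_def)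
    then show "p \<in> range P1_param" by blast
  qed
qed (auto simp: P1_param_def)

text \<open>Two points in a common chart are separated there. The only remaining pair is 0 and
  infinity, separated by the unit discs in the coordinates z and 1/z.\<close>

lemma P1_Hausdorff: "Hausdorff_space P1_top"
proof -
  have sep: "\<exists>U V. openin P1_top U \<and> openin P1_top V \<and> \<phi> a \<in> U \<and> \<phi> b \<in> V \<and> disjnt U V"
    if \<phi>: "\<And>D. open D \<Longrightarrow> openin P1_top (\<phi> ` D)" "inj \<phi>" and ab: "a \<noteq> b"
    for \<phi> :: "complex \<Rightarrow> complex option" and a b
  proof -
    obtain D E where D: "open D" "open E" "a \<in> D" "b \<in> E" "D \<inter> E = {}"
      using hausdorff[OF ab] by blast
    then have "disjnt (\<phi> ` D) (\<phi> ` E)" using \<phi>(2) by (auto simp: disjnt_def dest: injD)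
    then show ?thesis using \<phi>(1) D by blast
  qed
  have zi: "\<exists>U V. openin P1_top U \<and> openin P1_top V \<and> Some 0 \<in> U \<and> None \<in> V \<and> disjnt U V"
  proof (intro exI conjI)
    show "openin P1_top (Some ` ball 0 1)" "openin P1_top (P1_param ` ball 0 1)"
      by (simp_all add: P1_open_image)
    show "None \<in> P1_param ` ball 0 1" by (intro image_eqI[of _ _ 0]) (auto simp: P1_param_def)
    show "disjnt (Some ` ball 0 1) (P1_param ` ball 0 1)"
      by (auto simp: disjnt_def norm_divide divide_simps P1_param_def split: if_splits)
  qed auto
  show ?thesis
    unfolding Hausdorff_space_def
  proof (intro allI impI)
    fix p q :: "complex option" assume pq: "p \<in> topspace P1_top \<and> q \<in> topspace P1_top \<and> p \<noteq> q"
    consider a b where "p = Some a" "q = Some b" | "p \<noteq> Some 0" "q \<noteq> Some 0"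
      | "p = Some 0" "q = None" | "p = None" "q = Some 0" by (cases p; cases q) auto
    then show "\<exists>U V. openin P1_top U \<and> openin P1_top V \<and> p \<in> U \<and> q \<in> V \<and> disjnt U V"
    proof cases
      case 1
      then show ?thesis using sep[OF P1_open_image(1), of a b] pq by auto
    next
      case 2
      then obtain a b where "p = P1_param a" "q = P1_param b"
        using range_P1_param by (metis ComplI imageE singletonD)
      then show ?thesis using sep[OF P1_open_image(2) inj_P1_param, of a b] pq by metis
    next
      case 3
      then show ?thesis using zi by blast
    next
      case 4
      then show ?thesis using zi disjnt_sym by blast
    qed
  qed
qed

lemma P1_connected: "connected_space P1_top"
proof -
  have c: "connectedin P1_top (range \<phi>)" if "\<And>N. openin P1_top N \<Longrightarrow> open (\<phi> -` N)" for \<phi> :: "complex \<Rightarrow> _"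
  proof -
    have "continuous_map euclidean P1_top \<phi>"
      using that by (auto simp: continuous_map_def topspace_P1 vimage_def)
    then show ?thesis by (rule connectedin_continuous_map_image) (simp add: connected_UNIV)
  qed
  have "connectedin P1_top (range Some \<union> range P1_param)"
  proof (rule connectedin_Un)
    have "Some 1 \<in> range Some \<inter> range P1_param" by (auto simp: range_P1_param)
    then show "range Some \<inter> range P1_param \<noteq> {}" by blast
  qed (rule c, simp only: openin_P1)+
  moreover have "range Some \<union> range P1_param = topspace P1_top"
    by (auto simp: range_P1_param topspace_P1)
  ultimately show ?thesis by (simp add: connectedin_def)
qed

lemma P1_riemann_surface: "riemann_surface P1"
proof -
  have d: "(\<lambda>t. 1 / t :: complex) holomorphic_on - {0}" by (intro holomorphic_intros) auto
  have im: "P1_coord0 ` (range Some \<inter> range P1_param) = - {0}"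
    "P1_coord1 ` (range P1_param \<inter> range Some) = - {0}"
  proof -
    have "range Some \<inter> range P1_param = Some ` (- {0})" unfolding range_P1_param by auto
    then show "P1_coord0 ` (range Some \<inter> range P1_param) = - {0}"
      by (simp add: image_image P1_param_coord)
    have "range P1_param \<inter> range Some = P1_param ` (- {0})"
      by (auto simp: P1_param_def split: if_splits)
    then show "P1_coord1 ` (range P1_param \<inter> range Some) = - {0}"
      by (simp add: image_image P1_param_coord)
  qed
  note im' = im im[unfolded Int_commute[of "range Some"]] im[unfolded Int_commute[of "range P1_param"]]
  have "(P1_coord1 \<circ> Some) holomorphic_on - {0}"
    by (rule holomorphic_transform[OF d]) (simp add: P1_coord1_def)
  moreover have "(P1_coord0 \<circ> P1_param) holomorphic_on - {0}"
    by (rule holomorphic_transform[OF d]) (simp add: P1_coord0_def P1_param_def)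
  ultimately have 01: "charts_compatible (range Some, P1_coord0) (range P1_param, P1_coord1)"
    and 10: "charts_compatible (range P1_param, P1_coord1) (range Some, P1_coord0)"
    by (simp_all add: charts_compatible_def P1_charts im')
  have "(P1_coord0 \<circ> Some) = id" "(P1_coord1 \<circ> P1_param) = id"
    by (simp_all add: P1_param_coord fun_eq_iff)
  then have "charts_compatible (range Some, P1_coord0) (range Some, P1_coord0)"
    "charts_compatible (range P1_param, P1_coord1) (range P1_param, P1_coord1)"
    by (simp_all add: charts_compatible_def P1_charts id_def)
  with 01 10 have "\<forall>c\<in>charts P1. \<forall>d\<in>charts P1. charts_compatible c d"
    by (simp add: P1_def)
  moreover have "\<forall>(U, z)\<in>charts P1. topological_chart P1_top U z"
    using P1_charts(1,4) by (simp add: P1_def)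
  moreover have "(\<Union>(U, z)\<in>charts P1. U) = topspace P1_top"
    unfolding topspace_P1 by (auto simp: P1_def range_P1_param)
  ultimately show ?thesis
    unfolding riemann_surface_def using P1_Hausdorff P1_connected
    by (simp add: P1_def topspace_P1)
qed

section \<open>Dependence on the section\<close>

definition vec2 :: "complex \<Rightarrow> complex \<Rightarrow> complex vec" where
  "vec2 a b = vec 2 (\<lambda>i. if i = 0 then a else b)"

definition mat2 :: "complex \<Rightarrow> complex \<Rightarrow> complex \<Rightarrow> complex \<Rightarrow> complex mat" where
  "mat2 a b c d = mat 2 2 (\<lambda>(i, j). if i = 0 then (if j = 0 then a else b) else (if j = 0 then c else d))"

lemma mat2_carrier [simp]: "mat2 a b c d \<in> carrier_mat 2 2" by (simp add: mat2_def)

lemma vec2_carrier [simp]: "vec2 a b \<in> carrier_vec 2" by (simp add: vec2_def)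

lemma vec2_index [simp]: "vec_index (vec2 a b) 0 = a" "vec_index (vec2 a b) (Suc 0) = b"
  by (simp_all add: vec2_def)

lemma mat2_eqI:
  assumes "M \<in> carrier_mat 2 2" "M $$ (0, 0) = a" "M $$ (0, 1) = b" "M $$ (1, 0) = c" "M $$ (1, 1) = d"
  shows "M = mat2 a b c d"
  using assms by (intro eq_matI) (auto simp: mat2_def less_2_cases_iff)

lemma mat2_mult: "mat2 a b c d * mat2 e f g h = mat2 (a * e + b * g) (a * f + b * h) (c * e + d * g) (c * f + d * h)"
  by (rule mat2_eqI) (auto simp: mat2_def scalar_prod_def numeral_2_eq_2)

lemma mat2_action: "(mat2 a b c d)\<^sup>T *\<^sub>v vec2 x y = vec2 (a * x + c * y) (b * x + d * y)"
  by (rule eq_vecI) (auto simp: mat2_def vec2_def scalar_prod_def numeral_2_eq_2 less_Suc_eq)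

lemma row_action_index:
  assumes "M \<in> carrier_mat 2 2" "v \<in> carrier_vec 2" "k < 2"
  shows "vec_index (M\<^sup>T *\<^sub>v v) k = M $$ (0, k) * vec_index v 0 + M $$ (1, k) * vec_index v 1"
  using assms by (auto simp: scalar_prod_def numeral_2_eq_2)

lemma vec2_eta: "v \<in> carrier_vec 2 \<Longrightarrow> v = vec2 (vec_index v 0) (vec_index v 1)"
  by (rule eq_vecI) (auto simp: vec2_def less_2_cases_iff)

lemma det_mat2_upper: "det (mat2 a b 0 d) = a * d"
proof -
  have "det (mat2 a b 0 d) = prod_list (diag_mat (mat2 a b 0 d))"
    by (rule det_upper_triangular[of _ 2]) (auto simp: upper_triangular_def mat2_def less_2_cases_iff)
  also have "\<dots> = a * d" by (simp add: prod_list_diag_prod mat2_def numeral_2_eq_2)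
  finally show ?thesis .
qed

definition P1_bundle :: "(complex option, complex option \<times> complex vec) vbundle" where
  "P1_bundle = \<lparr>total = UNIV \<times> carrier_vec 2, proj = fst, trivs = {(UNIV, snd)}\<rparr>"

definition P1_flat :: "(complex option set \<times> (complex option \<times> complex vec \<Rightarrow> complex vec)) set" where
  "P1_flat = {(UNIV, snd)}"

text \<open>The index 0 stands for the affine coordinate and every other index for the coordinate at
  infinity. Both frames use the global trivialization, so their Wronskian matrices differ by the
  coordinate change alone.\<close>

definition P1_frame :: "nat \<Rightarrow> (complex option, complex option \<times> complex vec) local_frame" where
  "P1_frame i = (if i = 0 then \<lparr>fdom = range Some, fcoord = P1_coord0, ftriv = snd\<rparr>
     else \<lparr>fdom = range P1_param, fcoord = P1_coord1, ftriv = snd\<rparr>)"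

lemma surf_top_P1 [simp]: "surf_top P1 = P1_top"
  by (simp add: P1_def)

interpretation sphere: riemann P1
  by standard (rule P1_riemann_surface)

lemma P1_local_coordinate:
  "local_coordinate P1 (range Some) P1_coord0"
  "local_coordinate P1 (range P1_param) P1_coord1"
  by (rule sphere.charts_local_coordinate; simp add: P1_def)+

lemma P1_local_trivialization:
  assumes "openin P1_top U"
  shows "local_trivialization P1 2 P1_bundle U snd"
  unfolding local_trivialization_def
proof (intro conjI)
  show "bij_betw (\<lambda>e. (proj P1_bundle e, snd e)) {e \<in> total P1_bundle. proj P1_bundle e \<in> U} (U \<times> carrier_vec 2)"
    by (auto simp: P1_bundle_def bij_betw_def inj_on_def)
  have "holomorphic_GL P1 2 U (\<lambda>_. 1\<^sub>m 2)"
    unfolding sphere.holomorphic_GL_iff by (simp add: GL_one sphere.holomorphic_mat_at_const)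
  then show "\<forall>(W, \<chi>)\<in>trivs P1_bundle. \<exists>g. holomorphic_GL P1 2 (U \<inter> W) g \<and>
        (\<forall>e\<in>total P1_bundle. proj P1_bundle e \<in> U \<inter> W \<longrightarrow> snd e = (g (proj P1_bundle e))\<^sup>T *\<^sub>v \<chi> e)"
    by (auto simp: P1_bundle_def intro!: exI[of _ "\<lambda>_. 1\<^sub>m 2"])
qed (use assms in simp)

lemma P1_proj_flat_on: "proj_flat_on P1 2 P1_bundle N snd snd"
  unfolding proj_flat_on_def
  by (intro exI[of _ "\<lambda>_. 1"] exI[of _ "1\<^sub>m 2"])
     (auto simp: GL_one sphere.holomorphic_at_const P1_bundle_def)

lemma P1_holomorphic_bundle: "holomorphic_vector_bundle P1 2 P1_bundle"
  using P1_local_trivialization[of UNIV]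
  by (simp add: holomorphic_vector_bundle_def topspace_P1 openin_P1) (simp add: P1_bundle_def)

lemma P1_flat_structure: "proj_flat_structure P1 2 P1_bundle P1_flat"
  using P1_local_trivialization[of UNIV] P1_proj_flat_on
  by (simp add: proj_flat_structure_def topspace_P1 openin_P1 P1_flat_def)

interpretation sphere: projectively_flat P1 2 P1_bundle P1_flat
  by standard (rule P1_holomorphic_bundle P1_flat_structure)+

lemma P1_frame_triv: "ftriv (P1_frame i) = snd"
  by (simp add: P1_frame_def)

lemma P1_frame: "proj_flat_frame P1 2 P1_bundle P1_flat (P1_frame i)"
proof -
  have o: "openin P1_top (fdom (P1_frame i))"
    using P1_open_image[of UNIV] by (simp add: P1_frame_def)
  have "proj_flat_on P1 2 P1_bundle (fdom (P1_frame i)) (ftriv (P1_frame i)) snd"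
    using P1_proj_flat_on by (simp add: P1_frame_triv)
  then have "\<forall>(W, \<chi>)\<in>P1_flat. \<forall>x\<in>fdom (P1_frame i) \<inter> W. \<exists>N. openin P1_top N \<and> x \<in> N \<and>
      N \<subseteq> fdom (P1_frame i) \<inter> W \<and> proj_flat_on P1 2 P1_bundle N (ftriv (P1_frame i)) \<chi>"
    using o unfolding P1_flat_def by auto
  moreover have "local_trivialization P1 2 P1_bundle (fdom (P1_frame i)) (ftriv (P1_frame i))"
    using P1_local_trivialization[OF o] by (metis P1_frame_triv)
  moreover have "local_coordinate P1 (fdom (P1_frame i)) (fcoord (P1_frame i))"
    using P1_local_coordinate by (simp add: P1_frame_def)
  ultimately show ?thesis by (simp add: proj_flat_frame_def)
qed

lemma P1_holomorphic_at:
  "holomorphic_at P1 f (Some z) \<longleftrightarrow> (\<lambda>t. f (Some t)) analytic_on {z}"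
  "holomorphic_at P1 f (P1_param u) \<longleftrightarrow> (\<lambda>t. f (P1_param t)) analytic_on {u}"
  using sphere.holomorphic_at_iff[OF P1_local_coordinate(1), of "Some z" f]
    sphere.holomorphic_at_iff[OF P1_local_coordinate(2), of "P1_param u" f]
  by (simp_all add: P1_charts P1_param_coord o_def)

lemma P1_meromorphic_at_None:
  "meromorphic_at P1 f None \<longleftrightarrow> (\<lambda>t. f (P1_param t)) meromorphic_on {0}"
  using sphere.meromorphic_at_iff'[OF P1_local_coordinate(2), of None f]
  by (simp add: range_P1_param P1_charts P1_coord1_def o_def)
    (simp flip: range_P1_param add: P1_charts)

text \<open>The section (1, z^p). The zero vector at infinity is a placeholder: for p > 0 there is a
  pole, where the value is irrelevant.\<close>

definition power_section :: "nat \<Rightarrow> complex option \<Rightarrow> complex option \<times> complex vec" where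
  "power_section p x = (x, case x of None \<Rightarrow> 0\<^sub>v 2 | Some z \<Rightarrow> vec2 1 (z ^ p))"

lemma power_section_holomorphic:
  "k < 2 \<Longrightarrow> holomorphic_at P1 (\<lambda>y. vec_index (snd (power_section p y)) k) (Some z)"
  unfolding P1_holomorphic_at by (auto simp: power_section_def less_2_cases_iff intro!: analytic_intros)

lemma power_section_no_pole: "\<not> section_pole P1 2 P1_bundle (power_section p) (Some z)"
proof
  assume "section_pole P1 2 P1_bundle (power_section p) (Some z)"
  then obtain k where k: "k < 2" "pole_at P1 (\<lambda>y. vec_index (snd (power_section p y)) k) (Some z)" (is "pole_at P1 ?f _")
    unfolding section_pole_def by (auto simp: P1_bundle_def)
  then have "is_pole (?f \<circ> inv_into (range Some) P1_coord0) (P1_coord0 (Some z))"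
    unfolding pole_at_def by (auto simp: P1_def)
  then show False
    using analytic_at_imp_no_pole power_section_holomorphic[OF k(1)] sphere.holomorphic_at_iff[OF P1_local_coordinate(1), of "Some z" ?f]
    by blast
qed

lemma power_section_meromorphic:
  assumes p: "p > 0" shows "meromorphic_section P1 2 P1_bundle (power_section p)"
proof -
  let ?f = "\<lambda>k y. vec_index (snd (power_section p y)) k"
  have f: "eventually (\<lambda>t. ?f 0 (P1_param t) = 1) (at 0)"
    "eventually (\<lambda>t. ?f 1 (P1_param t) = 1 / (t - 0) ^ p) (at 0)"
    by (auto simp: eventually_at_filter power_section_def P1_param_def power_divide)
  have "(\<lambda>t. ?f 0 (P1_param t)) meromorphic_on {0}"
    by (rule iffD2[OF meromorphic_on_cong[OF _ refl] meromorphic_on_const[of 1]]) (use f(1) in simp)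
  moreover have "(\<lambda>t. ?f 1 (P1_param t)) meromorphic_on {0}"
  proof (rule iffD2[OF meromorphic_on_cong[OF _ refl]])
    show "(\<lambda>t. 1 / (t - 0) ^ p :: complex) meromorphic_on {0}" by (intro meromorphic_intros)
  qed (use f(2) in simp)
  ultimately have m: "meromorphic_at P1 (?f k) None" if "k < 2" for k
    using that unfolding P1_meromorphic_at_None by (auto simp: less_2_cases_iff)
  \<comment> \<open>In the coordinate u = 1/z the second component is u^(-p), a genuine pole because
    p > 0; this gives the second alternative of \<open>meromorphic_section\<close> at
    infinity.\<close>
  have "is_pole (\<lambda>t. ?f 1 (P1_param t)) 0"
    using is_pole_cong[OF f(2) refl] is_pole_inverse_power[OF p, of 0] by simp
  then have "pole_at P1 (?f 1) None"
    by (auto simp: pole_at_def P1_def P1_charts o_def P1_coord1_def)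
  then have pole: "\<exists>k<2. pole_at P1 (?f k) None" by (intro exI[of _ 1]) simp
  have "(\<forall>k<2. meromorphic_at P1 (?f k) x) \<and>
        ((\<forall>k<2. holomorphic_at P1 (?f k) x) \<or> (\<exists>k<2. pole_at P1 (?f k) x))" for x
    using m pole power_section_holomorphic sphere.holomorphic_at_meromorphic by (cases x) blast+
  moreover have "power_section p x \<in> total P1_bundle \<and> proj P1_bundle (power_section p x) = x" for x
    by (auto simp: power_section_def P1_bundle_def split: option.split)
  moreover have "trivs P1_bundle = {(UNIV, snd)}" by (simp add: P1_bundle_def)
  ultimately show ?thesis unfolding meromorphic_section_def by simp
qed

lemma power_section_wronskian_matrix0:
  "wronskian_matrix 2 (power_section p) (P1_frame 0) (Some z) = mat2 1 (z ^ p) 0 (of_nat p * z ^ (p - 1))"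
proof (rule mat2_eqI)
  have "deriv (\<lambda>t. t ^ p) z = of_nat p * z ^ (p - 1)"
    by (rule DERIV_imp_deriv) (auto intro!: derivative_eq_intros)
  then show "wronskian_matrix 2 (power_section p) (P1_frame 0) (Some z) $$ (1, 1) = of_nat p * z ^ (p - 1)"
    by (simp add: wronskian_matrix_def P1_frame_def P1_charts P1_param_coord power_section_def)
qed (simp_all add: wronskian_matrix_def P1_frame_def P1_charts P1_param_coord power_section_def)

text \<open>With u = 1/z one has d/du = - z^2 d/dz, which turns p z^(p-1) into - p z^(p+1). Writing
  p as \<open>Suc m\<close> avoids truncated subtraction.\<close>

lemma power_section_wronskian_matrix1:
  assumes z: "z \<noteq> 0"
  shows "wronskian_matrix 2 (power_section (Suc m)) (P1_frame 1) (Some z) =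
    mat2 1 (z ^ Suc m) 0 (- of_nat (Suc m) * z ^ (m + 2))"
proof (rule mat2_eqI)
  let ?f = "\<lambda>k t. vec_index (snd (power_section (Suc m) (P1_param t))) k"
  have "eventually (\<lambda>t :: complex. t \<in> - {0}) (nhds (1 / z))"
    using z by (intro eventually_nhds_in_open) auto
  then have f: "eventually (\<lambda>t. ?f 0 t = 1) (nhds (1 / z))" "eventually (\<lambda>t. ?f 1 t = (1 / t) ^ Suc m) (nhds (1 / z))"
    by (auto elim!: eventually_mono simp: power_section_def P1_param_def)
  have "deriv (?f 1) (1 / z) = deriv (\<lambda>t. (1 / t) ^ Suc m) (1 / z)" using f(2) by (rule deriv_cong_ev) simp
  also have "\<dots> = - of_nat (Suc m) * z ^ (m + 2)"
  proof -
    have "((\<lambda>t. 1 / t) has_field_derivative - (z\<^sup>2)) (at (1 / z))"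
      using z by (auto intro!: derivative_eq_intros simp: power2_eq_square)
    from DERIV_imp_deriv[OF DERIV_power[OF this, of "Suc m"]] show ?thesis
      using z by (simp add: power2_eq_square algebra_simps)
  qed
  finally show "wronskian_matrix 2 (power_section (Suc m)) (P1_frame 1) (Some z) $$ (1, 1) = - of_nat (Suc m) * z ^ (m + 2)"
    by (simp add: wronskian_matrix_def P1_frame_def P1_charts P1_coord1_def)
  have "deriv (?f 0) (1 / z) = deriv (\<lambda>_. 1) (1 / z)" using f(1) by (rule deriv_cong_ev) simp
  then show "wronskian_matrix 2 (power_section (Suc m)) (P1_frame 1) (Some z) $$ (1, 0) = 0"
    by (simp add: wronskian_matrix_def P1_frame_def P1_charts P1_coord1_def)
next
  have "P1_param (1 / z) = Some z" using z by (simp add: P1_param_def)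
  then show "wronskian_matrix 2 (power_section (Suc m)) (P1_frame 1) (Some z) $$ (0, 0) = 1"
    "wronskian_matrix 2 (power_section (Suc m)) (P1_frame 1) (Some z) $$ (0, 1) = z ^ Suc m"
    by (simp_all add: wronskian_matrix_def P1_frame_def P1_charts P1_coord1_def power_section_def)
qed simp

lemma power_section_generic:
  assumes p: "p > 0" shows "generic_section P1 2 P1_bundle P1_flat (power_section p)"
proof -
  have "Some 1 \<in> fdom (P1_frame 0)" by (simp add: P1_frame_def)
  moreover have "wronskian 2 (power_section p) (P1_frame 0) (Some 1) \<noteq> 0"
    using p by (simp add: wronskian_def power_section_wronskian_matrix0 det_mat2_upper)
  ultimately show ?thesis
    unfolding generic_section_def using P1_frame power_section_no_pole by blast
qed

text \<open>The Wronskian in the plane is p z^(p-1), so the singular points are at most 0 and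
  infinity, and each of these lies in only one of the two sets of the cover.\<close>

lemma power_section_admissible:
  assumes p: "p > 0"
  shows "admissible_cover P1 2 P1_bundle P1_flat (power_section p) {0, 1} P1_frame"
proof -
  have "wronskian_divisor P1 2 P1_bundle P1_flat (power_section p) (Some z) = 0" if z: "z \<noteq> 0" for z
  proof -
    have x: "Some z \<in> fdom (P1_frame 0)" by (simp add: P1_frame_def)
    have h: "holomorphic_at P1 (wronskian 2 (power_section p) (P1_frame 0)) (Some z)"
      by (rule sphere.wronskian_holomorphic[OF sphere.frameD(1)[OF P1_frame] x
            sphere.no_pole_holomorphic_section[OF power_section_meromorphic[OF p] P1_frame x power_section_no_pole]])
    have nz: "wronskian 2 (power_section p) (P1_frame 0) (Some z) \<noteq> 0"
      using p z by (simp add: wronskian_def power_section_wronskian_matrix0 det_mat2_upper)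
    have "order_at P1 (wronskian 2 (power_section p) (P1_frame 0)) (Some z) = 0"
      using sphere.order_at_holomorphic_eq_0_iff[OF h sphere.holomorphic_at_eventually_nonzero[OF h nz]] nz
      by (simp add: topspace_P1)
    then show ?thesis
      using sphere.wronskian_divisor_eq[OF power_section_meromorphic[OF p] power_section_generic[OF p] P1_frame x] by simp
  qed
  then have "wronskian_divisor P1 2 P1_bundle P1_flat (power_section p) x = 0 \<and>
      \<not> section_pole P1 2 P1_bundle (power_section p) x"
    if "x \<in> range Some" "x \<in> range P1_param" for x
    using that power_section_no_pole unfolding range_P1_param by auto
  then have "\<forall>i\<in>{0, 1}. \<forall>j\<in>{0, 1}. i \<noteq> j \<longrightarrow> (\<forall>x\<in>fdom (P1_frame i) \<inter> fdom (P1_frame j).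
      wronskian_divisor P1 2 P1_bundle P1_flat (power_section p) x = 0 \<and>
      \<not> section_pole P1 2 P1_bundle (power_section p) x)"
    by (auto simp: P1_frame_def)
  moreover have "(\<Union>i\<in>{0, 1}. fdom (P1_frame i)) = topspace P1_top"
    by (auto simp: P1_frame_def topspace_P1 range_P1_param)
  ultimately show ?thesis
    unfolding admissible_cover_def P1_frame_triv using P1_frame P1_proj_flat_on by simp
qed

abbreviation "power_cocycle m \<equiv> wronskian_cocycle 2 (power_section (Suc m)) P1_frame"
abbreviation "power_bundle m \<equiv> cocycle_bundle 2 {0, 1} (\<lambda>i. fdom (P1_frame i)) (power_cocycle m)"

lemma power_cocycle: "cocycle P1 2 {0, 1} (\<lambda>i. fdom (P1_frame i)) (power_cocycle m)"
  by (rule sphere.wronskian_cocycle_cocycle[OF power_section_meromorphic power_section_generic power_section_admissible]) simp_all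

text \<open>The matrix is obtained by solving W_1 Q = W_0 for triangular matrices. Only the
  off-diagonal entry depends on \<open>m\<close>: for (1, z^2) it is z^2 + 1, which is holomorphic
  on the plane and can be absorbed there; for (1, z) it is z + 1/z, whose term 1/z lies neither
  among the nonnegative powers available in the plane nor among the powers z^-2, z^-3, ... coming
  from infinity.\<close>

lemma power_cocycle_01:
  assumes z: "z \<noteq> 0"
  shows "power_cocycle m 0 1 (Some z) = mat2 1 (z ^ Suc m + z ^ Suc m / z\<^sup>2) 0 (- 1 / z\<^sup>2)"
proof -
  let ?W0 = "wronskian_matrix 2 (power_section (Suc m)) (P1_frame 0) (Some z)"
  let ?W1 = "wronskian_matrix 2 (power_section (Suc m)) (P1_frame 1) (Some z)"
  let ?Q = "mat2 1 (z ^ Suc m + z ^ Suc m / z\<^sup>2) 0 (- 1 / z\<^sup>2)"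
  have G: "?W1 \<in> GL 2"
    unfolding GL_iff_det power_section_wronskian_matrix1[OF z] det_mat2_upper using z by (simp del: of_nat_Suc)
  have "?W0 = ?W1 * ?Q"
  proof -
    have "(- of_nat (Suc m) * z ^ (m + 2)) * (- 1 / z\<^sup>2) = of_nat (Suc m) * z ^ m"
      using z by (simp add: power_add power2_eq_square field_simps del: of_nat_Suc)
    then show ?thesis
      unfolding power_section_wronskian_matrix1[OF z] power_section_wronskian_matrix0 mat2_mult
      by (simp del: of_nat_Suc power_Suc)
  qed
  then have "minv ?W1 * ?W0 = minv ?W1 * ?W1 * ?Q"
    using minv(1)[OF G] GL_carrier[OF G] by (simp add: assoc_mult_mat[of _ 2 2 _ 2 _ 2])
  also have "\<dots> = ?Q" unfolding minv(3)[OF G] by (rule left_mult_one_mat[OF mat2_carrier])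
  finally show ?thesis by (simp add: wronskian_cocycle_def)
qed

text \<open>The transition law of a section of the bundle of \<open>(1, z)\<close> on the sphere: by Liouville, \<open>a\<^sub>0\<close> is
  constant, and then so is the difference of \<open>b\<^sub>0\<close> and a linear function.\<close>

lemma entire_transition_trivial:
  fixes a0 b0 a1 b1 :: "complex \<Rightarrow> complex"
  assumes hol: "a0 holomorphic_on UNIV" "b0 holomorphic_on UNIV" "a1 holomorphic_on UNIV" "b1 holomorphic_on UNIV"
    and a: "\<And>z. z \<noteq> 0 \<Longrightarrow> a0 z = a1 (1 / z)"
    and b: "\<And>z. z \<noteq> 0 \<Longrightarrow> b0 z = (z + 1 / z) * a1 (1 / z) - b1 (1 / z) / z\<^sup>2"
  shows "a1 0 = 0" "b1 0 = 0"
proof -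
  have inv: "((\<lambda>z. 1 / z :: complex) \<longlongrightarrow> 0) at_infinity"
    by (rule Lim_transform_eventually[OF tendsto_inverse_0]) (simp add: inverse_eq_divide)
  have nz: "eventually (\<lambda>z :: complex. z \<noteq> 0) at_infinity"
    unfolding eventually_at_infinity by (intro exI[of _ 1]) auto
  have cont: "isCont a1 0" "isCont b1 0"
    using hol(3,4) holomorphic_on_imp_continuous_on continuous_on_eq_continuous_at[OF open_UNIV] by blast+
  have la: "((\<lambda>z. a1 (1 / z)) \<longlongrightarrow> a1 0) at_infinity" using isCont_tendsto_compose[OF cont(1) inv] .
  have lb: "((\<lambda>z. b1 (1 / z)) \<longlongrightarrow> b1 0) at_infinity" using isCont_tendsto_compose[OF cont(2) inv] .
  have "(a0 \<longlongrightarrow> a1 0) at_infinity"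
    by (rule Lim_transform_eventually[OF la]) (use nz a in \<open>auto elim: eventually_mono\<close>)
  then have a0: "a0 z = a1 0" for z by (rule Liouville_weak[OF hol(1)])
  have ac: "a1 (1 / z) = a1 0" if "z \<noteq> 0" for z using a[OF that] a0 by simp
  \<comment> \<open>Now that \<open>a1\<close> is constant off 0, the relation for \<open>b0\<close>
    grows like the linear function \<open>a1 0 * z\<close>. Subtracting it leaves an entire function
    tending to 0 at infinity, which Liouville forces to vanish.\<close>
  define d where "d z = b0 z - a1 0 * z" for z
  have dz: "d z = 1 / z * a1 0 - b1 (1 / z) * (1 / z * (1 / z))" if "z \<noteq> 0" for z
    unfolding d_def b[OF that] ac[OF that] using that by (simp add: algebra_simps power2_eq_square)
  have "((\<lambda>z. 1 / z * a1 0 - b1 (1 / z) * (1 / z * (1 / z))) \<longlongrightarrow> 0 * a1 0 - b1 0 * (0 * 0)) at_infinity"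
    by (intro tendsto_intros inv lb)
  then have lim: "((\<lambda>z. 1 / z * a1 0 - b1 (1 / z) * (1 / z * (1 / z))) \<longlongrightarrow> 0) at_infinity"
    by (simp only: mult_zero_left mult_zero_right diff_zero)
  have "(d \<longlongrightarrow> 0) at_infinity"
  proof (rule Lim_transform_eventually[OF lim])
    show "eventually (\<lambda>z. 1 / z * a1 0 - b1 (1 / z) * (1 / z * (1 / z)) = d z) at_infinity"
      using nz by eventually_elim (rule dz[symmetric])
  qed
  moreover have "d holomorphic_on UNIV" unfolding d_def[abs_def] using hol(2) by (intro holomorphic_intros)
  ultimately have d0: "d z = 0" for z by (rule Liouville_weak[rotated])
  \<comment> \<open>What remains after \<open>d = 0\<close> is the obstruction carried by the term
    1/z; letting \<open>u\<close> tend to 0 gives \<open>a1 0 = 0\<close>, and then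
    \<open>b1\<close> vanishes off 0 and by continuity at 0.\<close>
  have bu: "u * b1 u = a1 0" if "u \<noteq> 0" for u
    using dz[of "1 / u"] d0[of "1 / u"] that by (simp add: field_simps)
  have "((\<lambda>u. u * b1 u) \<longlongrightarrow> 0 * b1 0) (at 0)"
    using cont(2) by (intro tendsto_intros) (simp add: isCont_def)
  then have lim0: "((\<lambda>u. u * b1 u) \<longlongrightarrow> 0) (at 0)" by (simp only: mult_zero_left)
  have "((\<lambda>u. a1 0) \<longlongrightarrow> 0) (at (0 :: complex))"
    by (rule Lim_transform_eventually[OF lim0]) (use bu in \<open>simp add: eventually_at_filter\<close>)
  then show a10: "a1 0 = 0" using tendsto_const_iff[OF at_neq_bot] by blast
  have "eventually (\<lambda>u. b1 u = 0) (at 0)" using bu a10 by (auto simp: eventually_at_filter)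
  then have "((\<lambda>_. 0) \<longlongrightarrow> b1 0) (at (0 :: complex))"
    using cont(2) unfolding isCont_def by (rule Lim_transform_eventually[rotated])
  then show "b1 0 = 0" using tendsto_const_iff[OF at_neq_bot, of 0] by fastforce
qed

text \<open>The bundle of \<open>(1, z\<^sup>2)\<close> has the nowhere vanishing section \<open>s\<^sub>1 = (1, 0)\<close>, \<open>s\<^sub>0 = (1, z\<^sup>2 + 1)\<close>, whereas
  every section of the bundle of \<open>(1, z)\<close> vanishes at infinity.\<close>

lemma power_bundles_not_iso: "\<not> bundle_iso P1 2 (power_bundle 1) (power_bundle 0)"
proof
  let ?U = "\<lambda>i. fdom (P1_frame i)"
  assume "bundle_iso P1 2 (power_bundle 1) (power_bundle 0)"
  then obtain h where h: "bij_betw h (total (power_bundle 1)) (total (power_bundle 0))"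
    "\<forall>e\<in>total (power_bundle 1). fst (h e) = fst e"
    "\<forall>(U, \<psi>)\<in>trivs (power_bundle 1). \<forall>(W, \<chi>)\<in>trivs (power_bundle 0). \<exists>g. holomorphic_GL P1 2 (U \<inter> W) g \<and>
           (\<forall>e\<in>total (power_bundle 1). fst e \<in> U \<inter> W \<longrightarrow> \<chi> (h e) = (g (fst e))\<^sup>T *\<^sub>v \<psi> e)"
    unfolding bundle_iso_def cocycle_bundle_proj by blast
  have "\<exists>g. holomorphic_GL P1 2 (?U i \<inter> ?U i) g \<and>
           (\<forall>e\<in>total (power_bundle 1). fst e \<in> ?U i \<inter> ?U i \<longrightarrow> snd (h e) i = (g (fst e))\<^sup>T *\<^sub>v snd e i)"
    if "i \<in> {0, 1}" for i
    using h(3) that unfolding cocycle_bundle_trivs by fastforce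
  then obtain g where g: "\<And>i. i \<in> {0, 1} \<Longrightarrow> holomorphic_GL P1 2 (?U i) (g i)"
    "\<And>i e. i \<in> {0, 1} \<Longrightarrow> e \<in> total (power_bundle 1) \<Longrightarrow> fst e \<in> ?U i \<Longrightarrow> snd (h e) i = (g i (fst e))\<^sup>T *\<^sub>v snd e i"
    by (simp only: Int_absorb) metis
  \<comment> \<open>The point 0 is missing from the chart at infinity and is treated in the other
    frame; \<open>vec2 1 1\<close> is the value of (1, z^2 + 1) there.\<close>
  define \<sigma> where "\<sigma> x = (if x = Some 0 then cocycle_point {0, 1} ?U (power_cocycle 1) 0 x (vec2 1 1)
     else cocycle_point {0, 1} ?U (power_cocycle 1) 1 x (vec2 1 0))" for x
  have U: "Some z \<in> ?U 0" "P1_param u \<in> ?U 1" "z \<noteq> 0 \<Longrightarrow> Some z \<in> ?U 1" for z u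
    by (auto simp: P1_frame_def range_P1_param P1_param_eq_Some)
  have U1: "x \<noteq> Some 0 \<Longrightarrow> x \<in> ?U 1" for x by (simp add: P1_frame_def range_P1_param)
  have \<sigma>: "\<sigma> x \<in> total (power_bundle 1)" "fst (\<sigma> x) = x" for x
    using cocycle_point_total(1)[OF power_cocycle[of 1], of 0 x "vec2 1 1"]
      cocycle_point_total(1)[OF power_cocycle[of 1], of 1 x "vec2 1 0"] U U1
    by (auto simp: \<sigma>_def cocycle_point_def)
  have \<sigma>1: "snd (\<sigma> x) 1 = vec2 1 0" if "x \<noteq> Some 0" for x
    using cocycle_point_total(2)[OF power_cocycle[of 1], of 1 x "vec2 1 0"] U1 that by (simp add: \<sigma>_def)
  have \<sigma>0: "snd (\<sigma> (Some z)) 0 = vec2 1 (z\<^sup>2 + 1)" for z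
  proof (cases "z = 0")
    case True
    then show ?thesis
      using cocycle_point_total(2)[OF power_cocycle[of 1], of 0 "Some 0" "vec2 1 1"] U by (simp add: \<sigma>_def)
  next
    case False
    have "snd (\<sigma> (Some z)) 0 = (power_cocycle 1 0 1 (Some z))\<^sup>T *\<^sub>v snd (\<sigma> (Some z)) 1"
      using cocycle_bundle_change[OF power_cocycle[of 1] \<sigma>(1), of 0 1 "Some z"] U False by (simp add: \<sigma>)
    also have "\<dots> = vec2 1 (z\<^sup>2 + 1)"
      using False \<sigma>1[of "Some z"] power_cocycle_01[OF False, of 1] by (simp add: mat2_action power2_eq_square)
    finally show ?thesis .
  qed
  define \<tau> where "\<tau> x = h (\<sigma> x)" for x
  have \<tau>: "\<tau> x \<in> total (power_bundle 0)" "fst (\<tau> x) = x" for x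
    using \<sigma> h(1,2) by (auto simp: \<tau>_def dest: bij_betwE)
  define a0 where "a0 z = vec_index (snd (\<tau> (Some z)) 0) 0" for z
  define b0 where "b0 z = vec_index (snd (\<tau> (Some z)) 0) 1" for z
  define a1 where "a1 u = vec_index (snd (\<tau> (P1_param u)) 1) 0" for u
  define b1 where "b1 u = vec_index (snd (\<tau> (P1_param u)) 1) 1" for u
  have gc: "g i x \<in> carrier_mat 2 2" if "i \<in> {0, 1}" "x \<in> ?U i" for i x
    using g(1)[OF that(1)] that(2) GL_carrier by (auto simp: holomorphic_GL_def)
  have \<tau>0: "vec_index (snd (\<tau> (Some z)) 0) k = g 0 (Some z) $$ (0, k) + g 0 (Some z) $$ (1, k) * (z\<^sup>2 + 1)" if "k < 2" for z k
    using g(2)[of 0 "\<sigma> (Some z)"] \<sigma>[of "Some z"] \<sigma>0[of z] U(1)[of z]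
      row_action_index[OF gc[of 0 "Some z"], of "vec2 1 (z\<^sup>2 + 1)" k] that by (simp add: \<tau>_def)
  have pn: "P1_param u \<noteq> Some 0" for u by (simp add: P1_param_eq_Some)
  \<comment> \<open>Since the section is (1, 0) in this frame, its image has the first row of
    \<open>g 1\<close> as coordinates.\<close>
  have \<tau>1: "vec_index (snd (\<tau> (P1_param u)) 1) k = g 1 (P1_param u) $$ (0, k)" if "k < 2" for u k
    using g(2)[of 1 "\<sigma> (P1_param u)"] \<sigma>[of "P1_param u"] \<sigma>1[OF pn] U(2)[of u]
      row_action_index[OF gc[of 1 "P1_param u"], of "vec2 1 0" k] that by (simp add: \<tau>_def)
  have g0: "(\<lambda>z. g 0 (Some z) $$ (k, l)) holomorphic_on UNIV" if "k < 2" "l < 2" for k l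
  proof (rule analytic_imp_holomorphic, subst analytic_on_analytic_at, intro ballI)
    fix z show "(\<lambda>z. g 0 (Some z) $$ (k, l)) analytic_on {z}"
      using g(1)[of 0] U(1)[of z] that P1_holomorphic_at(1)[of "\<lambda>y. g 0 y $$ (k, l)" z]
      by (simp add: holomorphic_GL_def)
  qed
  have g1: "(\<lambda>u. g 1 (P1_param u) $$ (k, l)) holomorphic_on UNIV" if "k < 2" "l < 2" for k l
  proof (rule analytic_imp_holomorphic, subst analytic_on_analytic_at, intro ballI)
    fix u show "(\<lambda>u. g 1 (P1_param u) $$ (k, l)) analytic_on {u}"
      using g(1)[of 1] U(2)[of u] that P1_holomorphic_at(2)[of "\<lambda>y. g 1 y $$ (k, l)" u]
      by (simp add: holomorphic_GL_def)
  qed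
  have "a0 = (\<lambda>z. g 0 (Some z) $$ (0, 0) + g 0 (Some z) $$ (1, 0) * (z\<^sup>2 + 1))"
    "b0 = (\<lambda>z. g 0 (Some z) $$ (0, 1) + g 0 (Some z) $$ (1, 1) * (z\<^sup>2 + 1))"
    unfolding a0_def[abs_def] b0_def[abs_def] by (rule ext, rule \<tau>0, simp)+
  moreover have "a1 = (\<lambda>u. g 1 (P1_param u) $$ (0, 0))" "b1 = (\<lambda>u. g 1 (P1_param u) $$ (0, 1))"
    unfolding a1_def[abs_def] b1_def[abs_def] by (rule ext, rule \<tau>1, simp)+
  ultimately have hol: "a0 holomorphic_on UNIV" "b0 holomorphic_on UNIV" "a1 holomorphic_on UNIV" "b1 holomorphic_on UNIV"
    using g0 g1 by (auto intro!: holomorphic_intros)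
  have rel: "snd (\<tau> (Some z)) 0 = vec2 (a1 (1 / z)) ((z + 1 / z) * a1 (1 / z) - b1 (1 / z) / z\<^sup>2)" if z: "z \<noteq> 0" for z
  proof -
    have sp: "P1_param (1 / z) = Some z" using z by (simp add: P1_param_def)
    have c: "snd (\<tau> (Some z)) 1 \<in> carrier_vec 2"
      using cocycle_bundle_carrier[OF power_cocycle[of 0] \<tau>(1), of 1 "Some z"] U(3)[OF z] by (simp add: \<tau>)
    have "snd (\<tau> (Some z)) 0 = (power_cocycle 0 0 1 (Some z))\<^sup>T *\<^sub>v snd (\<tau> (Some z)) 1"
      using cocycle_bundle_change[OF power_cocycle[of 0] \<tau>(1), of 0 1 "Some z"] U z by (simp add: \<tau>)
    also have "snd (\<tau> (Some z)) 1 = vec2 (a1 (1 / z)) (b1 (1 / z))"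
      using vec2_eta[OF c] by (simp add: a1_def b1_def sp)
    also have "power_cocycle 0 0 1 (Some z) = mat2 1 (z + 1 / z) 0 (- 1 / z\<^sup>2)"
      unfolding power_cocycle_01[OF z] using z by (simp add: power2_eq_square)
    finally show ?thesis unfolding mat2_action by simp
  qed
  have "a1 0 = 0" "b1 0 = 0"
    by (rule entire_transition_trivial[OF hol]; use rel in \<open>simp add: a0_def b0_def\<close>)+
  then have r0: "g 1 None $$ (0, k) = 0" if "k < 2" for k
    using \<tau>1[of _ 0] that by (auto simp: a1_def b1_def P1_param_def less_2_cases_iff)
  have "None \<in> ?U 1" by (simp add: P1_frame_def range_P1_param)
  then have G: "g 1 None \<in> GL 2" using g(1)[of 1] by (simp add: holomorphic_GL_def)
  \<comment> \<open>The image of the section vanishes at infinity, so the first row of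
    \<open>g 1 None\<close> is zero; expanding along it contradicts invertibility.\<close>
  have "det (g 1 None) = (\<Sum>j<2. g 1 None $$ (0, j) * cofactor (g 1 None) 0 j)"
    by (rule laplace_expansion_row[OF GL_carrier[OF G]]) simp
  also have "\<dots> = 0" using r0 by simp
  finally show False using G by (simp add: GL_iff_det)
qed

theorem mainTheorem4:
  fixes S :: "'x surface" and n :: nat and V :: "('x, 'e) vbundle"
    and P :: "('x set \<times> ('e \<Rightarrow> complex vec)) set" and A :: "'x \<Rightarrow> 'e"
    and I :: "'i set" and C :: "'i \<Rightarrow> ('x, 'e) local_frame"
  assumes "riemann_surface S"
    and "holomorphic_vector_bundle S n V"
    and "proj_flat_structure S n V P"
    and "meromorphic_section S n V A"
    and "generic_section S n V P A"
    and "admissible_cover S n V P A I C"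
  shows "cocycle S n I (\<lambda>i. fdom (C i)) (wronskian_cocycle n A C) \<and>
    holomorphic_vector_bundle S n (wronskian_bundle n A I C) \<and>
    is_wronskian_line_bundle S n V P (det_bundle n (wronskian_bundle n A I C)) \<and>
    (\<forall>(J :: 'j set) C'. admissible_cover S n V P A J C' \<and> covers_agree S n V P A I C J C' \<longrightarrow>
       bundle_iso S n (wronskian_bundle n A I C) (wronskian_bundle n A J C')) \<and>
    (\<exists>(S' :: complex option surface) m
       (V' :: (complex option, complex option \<times> complex vec) vbundle) P' A1 A2 (K :: nat set) D.
       riemann_surface S' \<and> holomorphic_vector_bundle S' m V' \<and> proj_flat_structure S' m V' P' \<and>
       meromorphic_section S' m V' A1 \<and> generic_section S' m V' P' A1 \<and>
       admissible_cover S' m V' P' A1 K D \<and>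
       meromorphic_section S' m V' A2 \<and> generic_section S' m V' P' A2 \<and>
       admissible_cover S' m V' P' A2 K D \<and>
       \<not> bundle_iso S' m (wronskian_bundle m A1 K D) (wronskian_bundle m A2 K D))"
proof -
  interpret projectively_flat S n V P
    using assms(1-3) by (simp add: projectively_flat_def riemann_def projectively_flat_axioms_def)
  have \<Phi>: "cocycle S n I (\<lambda>i. fdom (C i)) (wronskian_cocycle n A C)"
    by (rule wronskian_cocycle_cocycle[OF assms(4-6)])
  show ?thesis
  proof (intro conjI)
    show "holomorphic_vector_bundle S n (wronskian_bundle n A I C)"
      unfolding wronskian_bundle_def by (rule cocycle_bundle_holomorphic[OF \<Phi>])
    show "\<forall>(J :: 'j set) C'. admissible_cover S n V P A J C' \<and> covers_agree S n V P A I C J C' \<longrightarrow>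
       bundle_iso S n (wronskian_bundle n A I C) (wronskian_bundle n A J C')"
      using wronskian_bundle_cover_independent[OF assms(4-6)] by blast
  \<comment> \<open>The exponents 2 and 1 are entered as \<open>Suc 1\<close> and
    \<open>Suc 0\<close> to match the indexing of \<open>power_bundle\<close> in the
    non-isomorphism.\<close>
  qed (rule \<Phi> det_wronskian_bundle[OF assms(4-6)]
      | (rule exI[of _ P1], rule exI[of _ 2], rule exI[of _ P1_bundle], rule exI[of _ P1_flat],
         rule exI[of _ "power_section (Suc 1)"], rule exI[of _ "power_section (Suc 0)"],
         rule exI[of _ "{0, 1}"], rule exI[of _ P1_frame], unfold wronskian_bundle_def,
         intro conjI P1_riemann_surface P1_holomorphic_bundle P1_flat_structure power_section_meromorphic
           power_section_generic power_section_admissible power_bundles_not_iso zero_less_Suc))+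
qed

end
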